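(* Let $f:[-\pi,\pi]\to\mathbb R$ be even and bounded with a finite number of local maximum points, local minimum points, and discontinuity points, and with $\mathcal{ER}(f)=[\inf_{[0,\pi]}f,\sup_{[0,\pi]}f]$ and $(\inf_{[0,\pi]}f,\sup_{[0,\pi]}f)\subseteq f([0,\pi])$. Then, for every $n$, there exist an a.u. grid $\{x_{i,n}\}_{i=1,\ldots,n}$ in $[0,\pi]$, a real unitary matrix $V_n$, and an ordering of the eigenvalues $\lambda_1(T_n(f)),\ldots,\lambda_n(T_n(f))$ of $T_n(f)$ and $\lambda_1(H_n(f)),\ldots,\lambda_n(H_n(f))$ of $H_n(f)$ such that $$Y_n=V_n\Delta_nV_n^*,\qquad \Delta_n=\operatorname{diag}_{i=1,\ldots,n}(-1)^{i+1},$$ $$T_n(f)=V_nD_nV_n^*,\qquad D_n=\operatorname{diag}_{i=1,\ldots,n}\lambda_i(T_n(f)),$$ $$H_n(f)=V_nE_nV_n^*,\qquad E_n=\Delta_nD_n=\operatorname{diag}_{i=1,\ldots,n}\lambda_i(H_n(f)),$$ $$\lambda_i(H_n(f))=(-1)^{i+1}\lambda_i(T_n(f)),\qquad i=1,\ldots,n,$$ $$\lambda_i(T_n(f))=f(x_{i,n}),\qquad i=1,\ldots,n.$$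
   Context: For $f\in L^1([-\pi,\pi])$ the Fourier coefficients are $f_k=\frac1{2\pi}\int_{-\pi}^{\pi}f(x)e^{-\mathrm{i}kx}\,dx$, $k\in\mathbb Z$; $T_n(f)=[f_{i-j}]_{i,j=1}^n$ is the $n\times n$ Toeplitz matrix generated by $f$; $Y_n$ is the $n\times n$ exchange matrix, with entries $1$ on the main anti-diagonal ($i+j=n+1$) and $0$ elsewhere; $H_n(f)=Y_nT_n(f)$ is the flipped Toeplitz matrix generated by $f$. Eigenvalues are listed with multiplicity. "Even" means $f(-x)=f(x)$. The essential range of a measurable $f:\Omega\to\mathbb C$ is $\mathcal{ER}(f)=\{z\in\mathbb C:\ \mu\{|f-z|<\epsilon\}>0\text{ for all }\epsilon>0\}$, with $\mu$ the Lebesgue measure. Given $f:[a,b]\to\mathbb R$, a point $x_0\in[a,b]$ is a local maximum (resp. minimum) point for $f$ if $f(x_0)\ge f(x)$ (resp. $f(x_0)\le f(x)$) for all $x$ in a neighborhood of $x_0$ in $[a,b]$ (weak local extrema, so every point of an open interval of constancy is both). A grid is a finite sequence of points in $\mathbb R$. Given, for every $n$, a grid $\mathcal G_n=\{x_{i,n}\}_{i=1,\ldots,d_n}$ of $d_n$ points in $[a,b]$ with $d_n\to\infty$, the grid $\mathcal G_n$ (i.e. the family $(\mathcal G_n)_n$) is called asymptotically uniform (a.u.) in $[a,b]$ if $\lim_{n\to\infty}\max_{i=1,\ldots,d_n}\left|x_{i,n}-\left(a+i\frac{b-a}{d_n+1}\right)\right|=0$. Thus the theorem asserts the existence of a family of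 grids, one for each $n$, which is a.u. in $[0,\pi]$ with $d_n=n$ and satisfies the displayed relations for every $n$. *)

theory Defs
  imports
    "HOL-Analysis.Analysis"
    "Jordan_Normal_Form.Schur_Decomposition"
begin

definition fourier_coeff :: "(real \<Rightarrow> complex) \<Rightarrow> int \<Rightarrow> complex" where
  "fourier_coeff f k =
     1 / (2 * complex_of_real pi) *
     (LINT x:{-pi..pi}|lebesgue. f x * exp (- (\<i> * of_int k * complex_of_real x)))"

(* Rows and columns of matrices are numbered from 0, which leaves i - j unchanged and turns
   the anti-diagonal i + j = n + 1 into i + j + 1 = n. *)

definition toeplitz_mat :: "nat \<Rightarrow> (real \<Rightarrow> complex) \<Rightarrow> complex mat" where
  "toeplitz_mat n f = Matrix.mat n n (\<lambda>(i, j). fourier_coeff f (int i - int j))"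

definition exchange_mat :: "nat \<Rightarrow> complex mat" where
  "exchange_mat n = Matrix.mat n n (\<lambda>(i, j). if i + j + 1 = n then 1 else 0)"

definition flipped_toeplitz_mat :: "nat \<Rightarrow> (real \<Rightarrow> complex) \<Rightarrow> complex mat" where
  "flipped_toeplitz_mat n f = exchange_mat n * toeplitz_mat n f"

(* diag_{i=1..n} d_i, with the diagonal sequence numbered from 1 *)
definition diag_mat1 :: "nat \<Rightarrow> (nat \<Rightarrow> complex) \<Rightarrow> complex mat" where
  "diag_mat1 n d = mat_diag n (\<lambda>i. d (Suc i))"

definition unitary_mat :: "nat \<Rightarrow> complex mat \<Rightarrow> bool" where
  "unitary_mat n V \<longleftrightarrow>
     V \<in> carrier_mat n n \<and> V * mat_adjoint V = 1\<^sub>m n \<and> mat_adjoint V * V = 1\<^sub>m n"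

definition real_mat :: "complex mat \<Rightarrow> bool" where
  "real_mat V \<longleftrightarrow> elements_mat V \<subseteq> \<real>"

(* lam 1, ..., lam n is a listing of all eigenvalues of the n x n matrix A, each repeated
   according to its algebraic multiplicity *)
definition eigenvalue_ordering :: "nat \<Rightarrow> complex mat \<Rightarrow> (nat \<Rightarrow> complex) \<Rightarrow> bool" where
  "eigenvalue_ordering n A lam \<longleftrightarrow>
     A \<in> carrier_mat n n \<and> char_poly A = (\<Prod>i = 1..n. [:- lam i, 1:])"

definition essential_range :: "real set \<Rightarrow> (real \<Rightarrow> complex) \<Rightarrow> complex set" where
  "essential_range \<Omega> f =
     {z. \<forall>\<epsilon>>0. emeasure lebesgue {x \<in> \<Omega>. cmod (f x - z) < \<epsilon>} > 0}"

definition local_max_point :: "real \<Rightarrow> real \<Rightarrow> (real \<Rightarrow> real) \<Rightarrow> real \<Rightarrow> bool" where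
  "local_max_point a b f x0 \<longleftrightarrow>
     x0 \<in> {a..b} \<and> (\<exists>\<delta>>0. \<forall>x\<in>{a..b}. \<bar>x - x0\<bar> < \<delta> \<longrightarrow> f x \<le> f x0)"

definition local_min_point :: "real \<Rightarrow> real \<Rightarrow> (real \<Rightarrow> real) \<Rightarrow> real \<Rightarrow> bool" where
  "local_min_point a b f x0 \<longleftrightarrow>
     x0 \<in> {a..b} \<and> (\<exists>\<delta>>0. \<forall>x\<in>{a..b}. \<bar>x - x0\<bar> < \<delta> \<longrightarrow> f x0 \<le> f x)"

definition discontinuity_point :: "real \<Rightarrow> real \<Rightarrow> (real \<Rightarrow> real) \<Rightarrow> real \<Rightarrow> bool" where
  "discontinuity_point a b f x0 \<longleftrightarrow>
     x0 \<in> {a..b} \<and> \<not> continuous (at x0 within {a..b}) f"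

(* x n i is the i-th point (i = 1, ..., d n) of the n-th grid. For the finitely many n with
   d n = 0 the maximum is over the empty set; this does not affect the limit. *)
definition asymptotically_uniform ::
    "real \<Rightarrow> real \<Rightarrow> (nat \<Rightarrow> nat) \<Rightarrow> (nat \<Rightarrow> nat \<Rightarrow> real) \<Rightarrow> bool" where
  "asymptotically_uniform a b d x \<longleftrightarrow>
     (\<forall>n. \<forall>i\<in>{1..d n}. x n i \<in> {a..b}) \<and>
     filterlim d at_top sequentially \<and>
     (\<lambda>n. MAX i\<in>{1..d n}. \<bar>x n i - (a + real i * (b - a) / (real (d n) + 1))\<bar>)
        \<longlonglongrightarrow> 0"

end

theory Submission
  imports Defs "Jordan_Normal_Form.Spectral_Radius"
begin

text \<open>Since \<open>f\<close> is real and even, \<open>T\<^sub>n(f)\<close> is real symmetric and commutes with the flip. The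
  vectors of the discrete sine transform are alternately symmetric and skew-symmetric, so in this
  basis \<open>T\<^sub>n(f)\<close> splits into two blocks, and diagonalizing each block gives an orthonormal
  eigenbasis of alternating parity. Approximating \<open>f\<close> in \<open>L\<^sup>2\<close> by a cosine polynomial \<open>p\<close>, for
  which the sine transform diagonalizes \<open>T\<^sub>n(p)\<close> up to boundedly many corner entries, shows in mean
  square that the eigenvalues of each parity are distributed like the values of \<open>f\<close> on \<open>[0, \<pi>]\<close>.
  By the Rayleigh quotient all eigenvalues lie strictly between the infimum and the supremum of
  \<open>f\<close>, hence are values of \<open>f\<close>. Cutting \<open>[0, \<pi>]\<close> into short cells and assigning every eigenvalue
  to a cell on which it is attained, in such proportions that all cells receive nearly equally many
  eigenvalues, orders the eigenvalues of each parity along an asymptotically uniform grid;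
  interlacing the two orderings gives the result.\<close>

section \<open>Diagonalization of real symmetric matrices\<close>

text \<open>The sign \<open>(-1) ^ (i + 1)\<close> is tied to the position \<open>i\<close>, so an
  eigenvalue may only be moved between positions of its own flip parity. A limit law for the whole
  spectrum is therefore not enough: each parity class needs its own. Moreover \<open>f\<close> need
  be neither monotone nor continuous, so sorting eigenvalues against a rearrangement of
  \<open>f\<close> would not put them near points where \<open>f\<close> attains them; this is why
  the matching works with cells. The finiteness hypotheses act mainly through two facts: level sets
  of \<open>f\<close> are finite, and images of intervals have finite frontier. The first makes the
  Rayleigh bounds strict, as required since only the open interval between infimum and supremum is
  known to consist of values. Together they make the preimages of the relevant frontiers null, which
  upgrades convergence of Lipschitz averages to convergence of counts. Finally, closeness to the
  uniform grid is only available eventually for each \<open>\<epsilon>\<close>, while the relations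
  must hold for every \<open>n\<close>; a near-optimal grid for each \<open>n\<close> reconciles the
  two.\<close>

lemma symmetric_real_eigenvector:
  fixes A :: "nat \<Rightarrow> nat \<Rightarrow> real"
  assumes n: "0 < n" and sym: "\<And>i j. i < n \<Longrightarrow> j < n \<Longrightarrow> A i j = A j i"
  obtains v e where "(\<Sum>i<n. v i ^ 2) = 1" "v (n - 1) \<le> 0"
    "\<And>i. i < n \<Longrightarrow> (\<Sum>j<n. A i j * v j) = e * v i"
proof -
  define M where "M = Matrix.mat n n (\<lambda>(i, j). complex_of_real (A i j))"
  have M: "M \<in> carrier_mat n n" unfolding M_def by simp
  obtain mu where "mu \<in> spectrum M" using spectrum_non_empty[OF M n] by blast
  then obtain z where z: "z \<in> carrier_vec n" "z \<noteq> 0\<^sub>v n" "M *\<^sub>v z = mu \<cdot>\<^sub>v z"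
    using M unfolding spectrum_def eigenvalue_def eigenvector_def by auto
  have ez: "(\<Sum>j<n. complex_of_real (A i j) * z $ j) = mu * z $ i" if "i < n" for i
  proof -
    have "(M *\<^sub>v z) $ i = mu * z $ i" using that z by simp
    then show ?thesis using that z(1) unfolding M_def
      by (simp add: scalar_prod_def lessThan_atLeast0)
  qed
  define N where "N = (\<Sum>i<n. cnj (z $ i) * z $ i)"
  have "N = complex_of_real (\<Sum>i<n. (cmod (z $ i))\<^sup>2)"
    unfolding N_def of_real_sum
    by (rule sum.cong) (auto simp: complex_norm_square mult.commute simp del: of_real_power)
  moreover have "(\<Sum>i<n. (cmod (z $ i))\<^sup>2) \<noteq> 0"
  proof
    assume "(\<Sum>i<n. (cmod (z $ i))\<^sup>2) = 0"
    then have "\<forall>i<n. z $ i = 0" by (subst (asm) sum_nonneg_eq_0_iff) auto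
    then have "z = 0\<^sub>v n" using z(1) by (intro eq_vecI) auto
    with z(2) show False by simp
  qed
  ultimately have N0: "N \<noteq> 0" by (metis of_real_eq_0_iff)
  \<comment> \<open>The Hermitian form of \<open>M\<close> at \<open>z\<close>, evaluated in two
    ways: the eigenvalue equation gives \<open>mu * N\<close>, and symmetry makes it equal to its
    own conjugate. As \<open>N\<close> is real and nonzero, \<open>mu\<close> is real.\<close>
  define Q where "Q = (\<Sum>i<n. \<Sum>j<n. cnj (z $ i) * (complex_of_real (A i j) * z $ j))"
  have QN: "Q = mu * N"
  proof -
    have "Q = (\<Sum>i<n. cnj (z $ i) * (mu * z $ i))"
      unfolding Q_def sum_distrib_left[symmetric] by (rule sum.cong) (auto simp: ez)
    then show ?thesis unfolding N_def by (simp add: sum_distrib_left mult_ac)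
  qed
  have "cnj Q = (\<Sum>j<n. \<Sum>i<n. z $ i * (complex_of_real (A i j) * cnj (z $ j)))"
    unfolding Q_def by (subst sum.swap) simp
  also have "\<dots> = Q" unfolding Q_def
    by (intro sum.cong refl) (auto simp: sym mult_ac)
  finally have "cnj Q = Q" .
  moreover have "cnj N = N" unfolding N_def by (simp add: mult.commute)
  ultimately have "cnj mu = mu" using QN N0 by (metis complex_cnj_mult mult_right_cancel)
  then obtain e where mu: "mu = complex_of_real e"
    by (metis Reals_cnj_iff Reals_cases)
  have Re: "(\<Sum>j<n. A i j * Re (z $ j)) = e * Re (z $ i)" if "i < n" for i
    using arg_cong[OF ez[OF that], of Re] by (simp add: mu)
  have Im: "(\<Sum>j<n. A i j * Im (z $ j)) = e * Im (z $ i)" if "i < n" for i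
    using arg_cong[OF ez[OF that], of Im] by (simp add: mu)
  \<comment> \<open>For real \<open>mu\<close>, the real and the imaginary part of \<open>z\<close>
    both satisfy the eigenvalue equation, and at least one of them is nonzero.\<close>
  have "\<exists>u k. k < n \<and> u k \<noteq> 0 \<and> (\<forall>i<n. (\<Sum>j<n. A i j * u j) = e * u i)"
  proof -
    obtain k where k: "k < n" "z $ k \<noteq> 0"
      using z(1,2) by (metis carrier_vecD eq_vecI index_zero_vec)
    then have "Re (z $ k) \<noteq> 0 \<or> Im (z $ k) \<noteq> 0" by (simp add: complex_eq_iff)
    then show ?thesis
    proof
      assume "Re (z $ k) \<noteq> 0"
      then show ?thesis using k(1) Re by (intro exI[of _ "\<lambda>i. Re (z $ i)"] exI[of _ k]) auto
    next
      assume "Im (z $ k) \<noteq> 0"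
      then show ?thesis using k(1) Im by (intro exI[of _ "\<lambda>i. Im (z $ i)"] exI[of _ k]) auto
    qed
  qed
  then obtain u k where u: "k < n" "u k \<noteq> 0" "\<And>i. i < n \<Longrightarrow> (\<Sum>j<n. A i j * u j) = e * u i"
    by blast
  define s where "s = (\<Sum>i<n. u i ^ 2)"
  have "u k ^ 2 \<le> s" unfolding s_def using u(1) by (intro member_le_sum) auto
  moreover have "u k ^ 2 > 0" using u(2) by simp
  ultimately have s: "s > 0" by linarith
  define t where "t = (if u (n - 1) \<le> 0 then 1 else -1) / sqrt s"
  have t: "t ^ 2 * s = 1" unfolding t_def using s by (simp add: power_divide)
  have tu: "t * u (n - 1) \<le> 0"
    unfolding t_def using s by (auto simp: mult_nonneg_nonpos divide_simps)
  have 1: "(\<Sum>i<n. (t * u i) ^ 2) = 1"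
    using t unfolding s_def by (simp add: power_mult_distrib sum_distrib_left)
  have 2: "(\<Sum>j<n. A i j * (t * u j)) = e * (t * u i)" if "i < n" for i
  proof -
    have "(\<Sum>j<n. A i j * (t * u j)) = t * (\<Sum>j<n. A i j * u j)"
      by (simp add: sum_distrib_left mult_ac)
    then show ?thesis using u(3)[OF that] by simp
  qed
  show thesis by (rule that[of "\<lambda>i. t * u i" e]) (use 1 2 tu in auto)
qed

text \<open>Induction on the dimension: a Householder reflection that maps the last unit vector to a
  unit eigenvector splits off a one-dimensional block. Choosing the sign of the eigenvector so
  that its last entry is nonpositive keeps the denominator of the reflection positive.\<close>

lemma symmetric_mat_diagonalization:
  fixes A :: "real mat"
  assumes "A \<in> carrier_mat n n" and "A\<^sup>T = A"
  shows "\<exists>U l. U \<in> carrier_mat n n \<and> U\<^sup>T * U = 1\<^sub>m n \<and> A * U = U * mat_diag n l"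
  using assms
proof (induction n arbitrary: A)
  case 0
  then show ?case
    by (intro exI[of _ "1\<^sub>m 0"] exI[of _ "\<lambda>_. 0"]) (auto simp: mat_diag_def)
next
  case (Suc n)
  let ?m = "Suc n"
  note A = Suc.prems(1)
  have symA: "A $$ (i, j) = A $$ (j, i)" if "i < ?m" "j < ?m" for i j
    using that A Suc.prems(2) by (metis carrier_matD index_transpose_mat(1))
  obtain v e where v: "(\<Sum>i<?m. v i ^ 2) = 1" "v n \<le> 0"
    "\<And>i. i < ?m \<Longrightarrow> (\<Sum>j<?m. A $$ (i, j) * v j) = e * v i"
    using symmetric_real_eigenvector[of ?m "\<lambda>i j. A $$ (i, j)", OF zero_less_Suc symA]
    unfolding diff_Suc_1 by blast
  \<comment> \<open>With \<open>w\<close> equal to \<open>v\<close> minus the last unit vector, the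
    squared norm of \<open>w\<close> is \<open>2 * c\<close>. Hence \<open>H\<close> below is the
    reflection along \<open>w\<close>, which exchanges \<open>v\<close> and the last unit
    vector.\<close>
  define c where "c = 1 - v n"
  have c: "c > 0" using v(2) unfolding c_def by simp
  define w where "w i = v i - (if i = n then 1 else 0)" for i
  define H where "H = Matrix.mat ?m ?m (\<lambda>(i, j). (if i = j then 1 else 0) - w i * w j / c)"
  have H: "H \<in> carrier_mat ?m ?m" unfolding H_def by simp
  have HT: "H\<^sup>T = H" unfolding H_def by (intro eq_matI) auto
  have ww: "(\<Sum>i<?m. w i ^ 2) = 2 * c"
  proof -
    have "(\<Sum>i<?m. w i ^ 2) = (\<Sum>i<?m. v i ^ 2) - 2 * v n + 1"
      unfolding w_def by (simp add: power2_diff)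
    then show ?thesis using v(1) unfolding c_def by simp
  qed
  have HH: "H * H = 1\<^sub>m ?m"
  proof (rule eq_matI)
    fix i j assume ij: "i < dim_row (1\<^sub>m ?m)" "j < dim_col (1\<^sub>m ?m)"
    have "(H * H) $$ (i, j) = (\<Sum>k<?m. ((if i = k then 1 else 0) - w i * w k / c) *
        ((if k = j then 1 else 0) - w k * w j / c))"
      using ij unfolding H_def by (simp add: scalar_prod_def lessThan_atLeast0 del: sum.op_ivl_Suc)
    also have "\<dots> = (\<Sum>k<?m. (if k = i then (if i = j then 1 else 0) - w i * w j / c else 0)
        - (if k = j then w i * w j / c else 0) + w i * w j / c ^ 2 * w k ^ 2)"
      by (intro sum.cong refl) (auto simp: algebra_simps power2_eq_square)
    also have "\<dots> = (if i = j then 1 else 0) - w i * w j / c - w i * w j / c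
        + w i * w j / c ^ 2 * (\<Sum>k<?m. w k ^ 2)"
      using ij unfolding sum.distrib sum_subtractf sum_distrib_left[symmetric] by (simp del: sum.lessThan_Suc)
    also have "\<dots> = (if i = j then 1 else 0)"
      unfolding ww using c by (simp add: field_simps power2_eq_square)
    finally show "(H * H) $$ (i, j) = 1\<^sub>m ?m $$ (i, j)" using ij by simp
  qed (use H in auto)
  define vv where "vv = Matrix.vec ?m v"
  have vv: "vv \<in> carrier_vec ?m" unfolding vv_def by simp
  have colH: "col H n = vv"
    unfolding H_def vv_def by (rule eq_vecI) (use c in \<open>auto simp: w_def c_def field_simps\<close>)
  have Av: "A *\<^sub>v vv = e \<cdot>\<^sub>v vv"
    by (rule eq_vecI) (use A v(3) in \<open>auto simp: vv_def scalar_prod_def lessThan_atLeast0 simp del: sum.op_ivl_Suc\<close>)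
  have "H *\<^sub>v vv = unit_vec ?m n"
  proof -
    have "H *\<^sub>v col H n = col (H * H) n" using H by (intro col_mult2[symmetric]) auto
    then show ?thesis unfolding colH HH by simp
  qed
  then have Hev: "H *\<^sub>v (e \<cdot>\<^sub>v vv) = e \<cdot>\<^sub>v unit_vec ?m n"
    using H vv by (simp add: mult_mat_vec)
  define B where "B = H * (A * H)"
  have B: "B \<in> carrier_mat ?m ?m" unfolding B_def using A H by simp
  have "col B n = H *\<^sub>v col (A * H) n"
    unfolding B_def using A H by (intro col_mult2) auto
  also have "col (A * H) n = A *\<^sub>v col H n"
    using A H by (intro col_mult2) auto
  finally have "col B n = H *\<^sub>v (A *\<^sub>v col H n)" .
  then have colB: "col B n = e \<cdot>\<^sub>v unit_vec ?m n" unfolding colH Av Hev .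
  have BT: "B\<^sup>T = B"
    unfolding B_def using A H HT Suc.prems(2)
    by (simp add: transpose_mult[of _ ?m ?m _ ?m] assoc_mult_mat[of _ ?m ?m _ ?m _ ?m])
  have symB: "B $$ (i, j) = B $$ (j, i)" if "i < ?m" "j < ?m" for i j
    using that B BT by (metis carrier_matD index_transpose_mat(1))
  have Bn: "B $$ (i, n) = (if i = n then e else 0)" if "i < ?m" for i
  proof -
    have "B $$ (i, n) = col B n $ i" using that B by simp
    also have "\<dots> = (if i = n then e else 0)" unfolding colB using that by simp
    finally show ?thesis .
  qed
  define B1 where "B1 = Matrix.mat n n (\<lambda>(i, j). B $$ (i, j))"
  have B1: "B1 \<in> carrier_mat n n" "B1\<^sup>T = B1"
    unfolding B1_def using symB by (auto intro!: eq_matI)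
  obtain U l where U: "U \<in> carrier_mat n n" "U\<^sup>T * U = 1\<^sub>m n" "B1 * U = U * mat_diag n l"
    using Suc.IH[OF B1] by blast
  have Bblock: "B = four_block_mat B1 (0\<^sub>m n 1) (0\<^sub>m 1 n) (Matrix.mat 1 1 (\<lambda>_. e))"
  proof (rule eq_matI)
    fix i j
    assume "i < dim_row (four_block_mat B1 (0\<^sub>m n 1) (0\<^sub>m 1 n) (Matrix.mat 1 1 (\<lambda>_. e)))"
      "j < dim_col (four_block_mat B1 (0\<^sub>m n 1) (0\<^sub>m 1 n) (Matrix.mat 1 1 (\<lambda>_. e)))"
    then have ij: "i < ?m" "j < ?m" using B1 by auto
    show "B $$ (i, j) = four_block_mat B1 (0\<^sub>m n 1) (0\<^sub>m 1 n) (Matrix.mat 1 1 (\<lambda>_. e)) $$ (i, j)"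
      using ij Bn[OF ij(1)] Bn[OF ij(2)] symB[OF ij] B1(1)
      by (cases "i < n"; cases "j < n") (auto simp: B1_def less_Suc_eq)
  qed (use B B1 in auto)
  define U2 where "U2 = four_block_mat U (0\<^sub>m n 1) (0\<^sub>m 1 n) (1\<^sub>m 1)"
  define l2 where "l2 = (\<lambda>i. if i < n then l i else e)"
  have U2: "U2 \<in> carrier_mat ?m ?m" unfolding U2_def using U(1) by auto
  have U2U2: "U2\<^sup>T * U2 = 1\<^sub>m ?m"
  proof -
    have "U2\<^sup>T = four_block_mat U\<^sup>T (0\<^sub>m n 1) (0\<^sub>m 1 n) (1\<^sub>m 1)"
      unfolding U2_def by (subst transpose_four_block_mat[of _ n n _ 1 _ 1]) (use U in auto)
    then have "U2\<^sup>T * U2 = four_block_mat U\<^sup>T (0\<^sub>m n 1) (0\<^sub>m 1 n) (1\<^sub>m 1)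
        * four_block_mat U (0\<^sub>m n 1) (0\<^sub>m 1 n) (1\<^sub>m 1)"
      by (simp add: U2_def)
    also have "\<dots> = four_block_mat (1\<^sub>m n) (0\<^sub>m n 1) (0\<^sub>m 1 n) (1\<^sub>m 1)"
      using U by (subst mult_four_block_mat[of _ n n _ 1 _ 1 _ _ n _ 1]) auto
    finally show ?thesis by (simp add: four_block_one_mat)
  qed
  have diag: "mat_diag ?m l2 = four_block_mat (mat_diag n l) (0\<^sub>m n 1) (0\<^sub>m 1 n) (Matrix.mat 1 1 (\<lambda>_. e))"
    unfolding mat_diag_def l2_def by (rule eq_matI) auto
  have BU2: "B * U2 = U2 * mat_diag ?m l2"
    unfolding Bblock diag unfolding U2_def using U(1) B1(1)
    by (subst (1 2) mult_four_block_mat[of _ n n _ 1 _ 1 _ _ n _ 1]) (auto simp: U(3) left_mult_zero_mat[of "mat_diag n l" n n])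
  define W where "W = H * U2"
  have W: "W \<in> carrier_mat ?m ?m" unfolding W_def using H U2 by simp
  have "W\<^sup>T * W = U2\<^sup>T * (H * H) * U2"
    unfolding W_def using H U2 HT
    by (simp add: transpose_mult[of _ ?m ?m _ ?m] assoc_mult_mat[of _ ?m ?m _ ?m _ ?m])
  then have WW: "W\<^sup>T * W = 1\<^sub>m ?m" unfolding HH using U2 U2U2 by simp
  have "A * W = (H * H) * (A * W)" unfolding HH using A W by simp
  also have "\<dots> = H * (B * U2)"
    unfolding W_def B_def using A H U2
    by (simp add: assoc_mult_mat[of _ ?m ?m _ ?m _ ?m])
  also have "\<dots> = W * mat_diag ?m l2"
    unfolding BU2 W_def using H U2 by (simp add: assoc_mult_mat[of _ ?m ?m _ ?m _ ?m])
  finally show ?case using W WW by blast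
qed

text \<open>Transport along a bijection with an initial segment. Arbitrary finite index sets are
  allowed so that the even and the odd indices can be treated separately while keeping their
  names.\<close>

lemma symmetric_diagonalization:
  fixes A :: "'a \<Rightarrow> 'a \<Rightarrow> real"
  assumes "finite I" and sym: "\<And>i j. i \<in> I \<Longrightarrow> j \<in> I \<Longrightarrow> A i j = A j i"
  obtains U :: "'a \<Rightarrow> 'a \<Rightarrow> real" and l where
    "\<And>j k. j \<in> I \<Longrightarrow> k \<in> I \<Longrightarrow> (\<Sum>i\<in>I. U i j * U i k) = (if j = k then 1 else 0)"
    "\<And>i j. i \<in> I \<Longrightarrow> j \<in> I \<Longrightarrow> (\<Sum>k\<in>I. U i k * U j k) = (if i = j then 1 else 0)"
    "\<And>i k. i \<in> I \<Longrightarrow> k \<in> I \<Longrightarrow> (\<Sum>j\<in>I. A i j * U j k) = l k * U i k"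
proof -
  define n where "n = card I"
  obtain h where h: "bij_betw h {..<n} I"
    using ex_bij_betw_nat_finite[OF assms(1)] unfolding n_def lessThan_atLeast0 by blast
  define r where "r = the_inv_into {..<n} h"
  have hr: "h (r i) = i" "r i < n" if "i \<in> I" for i
    using h that unfolding r_def
    by (auto simp: bij_betw_def f_the_inv_into_f dest: the_inv_into_into)
  have rinj: "r i = r j \<longleftrightarrow> i = j" if "i \<in> I" "j \<in> I" for i j
    using hr that by metis
  have hI: "h i \<in> I" if "i < n" for i using h that by (auto simp: bij_betw_def)
  have rh: "r (h i) = i" if "i < n" for i
    using h that hr hI by (metis bij_betw_imp_inj_on inj_onD lessThan_iff)
  have sumI: "(\<Sum>i\<in>I. g i) = (\<Sum>i<n. g (h i))" for g :: "'a \<Rightarrow> real"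
    using sum.reindex_bij_betw[OF h] by metis
  define M where "M = Matrix.mat n n (\<lambda>(i, j). A (h i) (h j))"
  have M: "M \<in> carrier_mat n n" "M\<^sup>T = M"
    unfolding M_def using sym hI by (auto intro!: eq_matI)
  obtain W m where W: "W \<in> carrier_mat n n" "W\<^sup>T * W = 1\<^sub>m n" "M * W = W * mat_diag n m"
    using symmetric_mat_diagonalization[OF M] by blast
  have W2: "W * W\<^sup>T = 1\<^sub>m n"
    using W(1,2) by (intro mat_mult_left_right_inverse[of "W\<^sup>T" n W]) auto
  define U where "U i k = W $$ (r i, r k)" for i k
  show thesis
  proof (rule that[of U "\<lambda>k. m (r k)"])
    fix j k assume jk: "j \<in> I" "k \<in> I"
    have "(\<Sum>i\<in>I. U i j * U i k) = (W\<^sup>T * W) $$ (r j, r k)"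
      unfolding sumI U_def using W(1) hr jk
      by (simp add: rh scalar_prod_def lessThan_atLeast0)
    then show "(\<Sum>i\<in>I. U i j * U i k) = (if j = k then 1 else 0)"
      unfolding W(2) using hr jk by (simp add: rinj)
    have "(\<Sum>i\<in>I. U j i * U k i) = (W * W\<^sup>T) $$ (r j, r k)"
      unfolding sumI U_def using W(1) hr jk
      by (simp add: rh scalar_prod_def lessThan_atLeast0)
    then show "(\<Sum>i\<in>I. U j i * U k i) = (if j = k then 1 else 0)"
      unfolding W2 using hr jk by (simp add: rinj)
    have "(\<Sum>i\<in>I. A j i * U i k) = (M * W) $$ (r j, r k)"
      unfolding sumI U_def M_def using W(1) hr jk
      by (simp add: rh scalar_prod_def lessThan_atLeast0)
    also have "\<dots> = U j k * m (r k)"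
      unfolding W(3) mat_diag_mult_right[OF W(1)] U_def using hr jk by simp
    finally show "(\<Sum>i\<in>I. A j i * U i k) = m (r k) * U j k" by (simp add: mult.commute)
  qed
qed

text \<open>Entries vanish unless the two indices have equal parity, so \<open>A\<close> is a direct
  sum of an even and an odd block. Each block is diagonalized on its own index set, which labels
  every eigenvector by an index of the parity of its support.\<close>

lemma parity_block_diagonalization:
  fixes A :: "nat \<Rightarrow> nat \<Rightarrow> real"
  assumes sym: "\<And>i j. i < n \<Longrightarrow> j < n \<Longrightarrow> A i j = A j i"
    and par: "\<And>i j. i < n \<Longrightarrow> j < n \<Longrightarrow> odd (i + j) \<Longrightarrow> A i j = 0"
  obtains U :: "nat \<Rightarrow> nat \<Rightarrow> real" and l where
    "\<And>j k. j < n \<Longrightarrow> k < n \<Longrightarrow> (\<Sum>i<n. U i j * U i k) = (if j = k then 1 else 0)"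
    "\<And>i j. i < n \<Longrightarrow> j < n \<Longrightarrow> (\<Sum>k<n. U i k * U j k) = (if i = j then 1 else 0)"
    "\<And>i k. i < n \<Longrightarrow> k < n \<Longrightarrow> (\<Sum>j<n. A i j * U j k) = l k * U i k"
    "\<And>i k. odd (i + k) \<Longrightarrow> U i k = 0"
proof -
  define I where "I e = {i. i < n \<and> i mod 2 = e}" for e :: nat
  have finI: "finite (I e)" for e unfolding I_def by simp
  define P where "P e U l \<longleftrightarrow>
    (\<forall>j k. j \<in> I e \<longrightarrow> k \<in> I e \<longrightarrow> (\<Sum>i\<in>I e. U i j * U i k) = (if j = k then 1 else 0)) \<and>
    (\<forall>i j. i \<in> I e \<longrightarrow> j \<in> I e \<longrightarrow> (\<Sum>k\<in>I e. U i k * U j k) = (if i = j then 1 else 0)) \<and>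
    (\<forall>i k. i \<in> I e \<longrightarrow> k \<in> I e \<longrightarrow> (\<Sum>j\<in>I e. A i j * U j k) = l k * U i k)"
    for e and U :: "nat \<Rightarrow> nat \<Rightarrow> real" and l
  have "\<exists>U l. P e U l" for e
  proof -
    have symI: "A i j = A j i" if "i \<in> I e" "j \<in> I e" for i j
      using sym that by (auto simp: I_def)
    show ?thesis
    proof (rule symmetric_diagonalization[of "I e" A, OF finI symI], assumption, assumption)
      fix U l
      assume "\<And>j k. j \<in> I e \<Longrightarrow> k \<in> I e \<Longrightarrow> (\<Sum>i\<in>I e. U i j * U i k) = (if j = k then 1 else 0)"
        "\<And>i j. i \<in> I e \<Longrightarrow> j \<in> I e \<Longrightarrow> (\<Sum>k\<in>I e. U i k * U j k) = (if i = j then 1 else 0)"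
        "\<And>i k. i \<in> I e \<Longrightarrow> k \<in> I e \<Longrightarrow> (\<Sum>j\<in>I e. A i j * U j k) = l k * U i k"
      then have "P e U l" unfolding P_def by blast
      then show "\<exists>U l. P e U l" by blast
    qed
  qed
  then obtain U l where "\<And>e. P e (U e) (l e)" by metis
  then have
    U1: "\<And>e j k. j \<in> I e \<Longrightarrow> k \<in> I e \<Longrightarrow> (\<Sum>i\<in>I e. U e i j * U e i k) = (if j = k then 1 else 0)" and
    U2: "\<And>e i j. i \<in> I e \<Longrightarrow> j \<in> I e \<Longrightarrow> (\<Sum>k\<in>I e. U e i k * U e j k) = (if i = j then 1 else 0)" and
    U3: "\<And>e i k. i \<in> I e \<Longrightarrow> k \<in> I e \<Longrightarrow> (\<Sum>j\<in>I e. A i j * U e j k) = l e k * U e i k"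
    unfolding P_def by auto
  define V where "V i k = (if i mod 2 = k mod 2 then U (k mod 2) i k else 0)" for i k
  have restr: "(\<Sum>i<n. g i) = (\<Sum>i\<in>I e. g i)" if "\<And>i. i < n \<Longrightarrow> i mod 2 \<noteq> e \<Longrightarrow> g i = 0"
    for g :: "nat \<Rightarrow> real" and e
    using that unfolding I_def by (intro sum.mono_neutral_right) auto
  show thesis
  proof (rule that[of V "\<lambda>k. l (k mod 2) k"])
    fix j k assume jk: "j < n" "k < n"
    have jkI: "j \<in> I (j mod 2)" "k \<in> I (k mod 2)" using jk by (auto simp: I_def)
    show "(\<Sum>i<n. V i j * V i k) = (if j = k then 1 else 0)"
    proof (cases "j mod 2 = k mod 2")
      case True
      have "(\<Sum>i<n. V i j * V i k) = (\<Sum>i\<in>I (k mod 2). U (k mod 2) i j * U (k mod 2) i k)"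
        by (subst restr[of "k mod 2"]) (auto simp: V_def True I_def intro!: sum.cong)
      then show ?thesis using U1[of j "k mod 2" k] jkI True by simp
    next
      case False
      then have "(\<Sum>i<n. V i j * V i k) = 0" by (intro sum.neutral) (auto simp: V_def)
      then show ?thesis using False by auto
    qed
    show "(\<Sum>i<n. V j i * V k i) = (if j = k then 1 else 0)"
    proof (cases "j mod 2 = k mod 2")
      case True
      have "(\<Sum>i<n. V j i * V k i) = (\<Sum>i\<in>I (k mod 2). U (k mod 2) j i * U (k mod 2) k i)"
        by (subst restr[of "k mod 2"]) (auto simp: V_def True I_def intro!: sum.cong)
      then show ?thesis using U2[of j "k mod 2" k] jkI True by simp
    next
      case False
      then have "(\<Sum>i<n. V j i * V k i) = 0" by (intro sum.neutral) (auto simp: V_def)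
      then show ?thesis using False by auto
    qed
    show "(\<Sum>i<n. A j i * V i k) = l (k mod 2) k * V j k"
    proof (cases "j mod 2 = k mod 2")
      case True
      have "(\<Sum>i<n. A j i * V i k) = (\<Sum>i\<in>I (k mod 2). A j i * U (k mod 2) i k)"
        by (subst restr[of "k mod 2"]) (auto simp: V_def True I_def intro!: sum.cong)
      then show ?thesis using U3[of j "k mod 2" k] jkI True by (simp add: V_def)
    next
      case False
      have "A j i * V i k = 0" if "i < n" for i
      proof (cases "i mod 2 = k mod 2")
        case True
        then have "odd (j + i)" using False by (auto simp: mod2_eq_if split: if_splits)
        then show ?thesis using par[OF jk(1) that] by simp
      qed (simp add: V_def)
      then have "(\<Sum>i<n. A j i * V i k) = 0" by (intro sum.neutral) auto
      then show ?thesis using False by (simp add: V_def)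
    qed
  next
    fix i k :: nat assume "odd (i + k)"
    then have "i mod 2 \<noteq> k mod 2" by (auto simp: mod2_eq_if)
    then show "V i k = 0" by (simp add: V_def)
  qed
qed

section \<open>Sine transform and cosine coefficients\<close>

text \<open>This is the Dirichlet kernel, multiplied out so that no division by
  \<open>sin (x / 2)\<close> occurs; the product formula makes the left side telescope.\<close>

lemma sum_cos_telescope:
  fixes x :: real
  shows "2 * sin (x / 2) * (\<Sum>i\<le>n. cos (real i * x)) = sin (real n * x + x / 2) + sin (x / 2)"
proof (induction n)
  case (Suc n)
  have "2 * sin (x / 2) * cos (real (Suc n) * x)
      = sin (real (Suc n) * x + x / 2) - sin (real (Suc n) * x - x / 2)"
    by (simp add: sin_add sin_diff)
  moreover have "real (Suc n) * x - x / 2 = real n * x + x / 2" by (simp add: field_simps)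
  ultimately show ?case using Suc by (simp only: sum.atMost_Suc distrib_left)
qed simp

text \<open>At these angles \<open>n * x + x / 2\<close> is \<open>m * pi - x / 2\<close>, so the
  kernel collapses to a sign. The range of \<open>m\<close> places \<open>x / 2\<close> strictly
  between 0 and \<open>pi\<close>, where the sine can be cancelled.\<close>

lemma sum_cos_grid:
  assumes "0 < m" "m < 2 * (n + 1)"
  shows "(\<Sum>i\<le>n. cos (real i * (real m * (pi / (real n + 1))))) = (1 - (-1) ^ m) / 2"
proof -
  define x where "x = real m * (pi / (real n + 1))"
  have "0 < x / 2" using assms unfolding x_def by simp
  moreover have "x / 2 < pi"
  proof -
    have "real m < real (2 * (n + 1))" using assms(2) by (simp only: of_nat_less_iff)
    then have "real m < 2 * (real n + 1)" by simp
    then have "real m * pi < 2 * (real n + 1) * pi" by (intro mult_strict_right_mono) auto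
    then show ?thesis unfolding x_def by (simp add: field_simps)
  qed
  ultimately have s: "sin (x / 2) > 0" by (rule sin_gt_zero)
  have arg: "real n * x + x / 2 = real m * pi - x / 2"
  proof -
    have "(real n + 1) * x = real m * pi" unfolding x_def by simp
    then show ?thesis by (simp add: algebra_simps)
  qed
  have "sin (real n * x + x / 2) = - ((-1) ^ m * sin (x / 2))"
    unfolding arg by (simp add: sin_diff)
  with sum_cos_telescope[of x n]
  have "sin (x / 2) * (2 * (\<Sum>i\<le>n. cos (real i * x))) = sin (x / 2) * (1 - (-1) ^ m)"
    by (simp add: algebra_simps)
  then have "2 * (\<Sum>i\<le>n. cos (real i * x)) = 1 - (-1) ^ m" using s by simp
  then show ?thesis unfolding x_def[symmetric] by (intro eq_divide_imp) (simp_all add: mult.commute[of _ 2])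
qed

text \<open>The symmetric orthogonal matrix of the type I discrete sine transform. Indices start at
  0, hence the shifts by one; column \<open>j\<close> samples the sine of frequency
  \<open>j + 1\<close> at the multiples of \<open>pi / (n + 1)\<close>.\<close>

definition dst :: "nat \<Rightarrow> nat \<Rightarrow> nat \<Rightarrow> real" where
  "dst n i j = sqrt (2 / (real n + 1)) * sin (real (i + 1) * (real (j + 1) * (pi / (real n + 1))))"

lemma dst_sym: "dst n i j = dst n j i"
  unfolding dst_def by (simp add: mult_ac)

text \<open>The product of sines is half a difference of cosines with frequencies
  \<open>k - j\<close> and \<open>j + k + 2\<close>. These have the same parity, so by
  \<open>sum_cos_grid\<close> the two sums cancel unless \<open>k - j = 0\<close>. Ordering the
  indices avoids truncated subtraction.\<close>

lemma dst_orthonormal: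
  assumes "j < n" "k < n"
  shows "(\<Sum>i<n. dst n i j * dst n i k) = (if j = k then 1 else 0)"
  using assms
proof (induction j k rule: linorder_wlog)
  case (le j k)
  define t where "t = pi / (real n + 1)"
  define C where "C m = (\<Sum>i\<le>n. cos (real i * (real m * t)))" for m
  have "(\<Sum>i<n. dst n i j * dst n i k)
      = 2 / (real n + 1) * (\<Sum>i<n. sin (real (i + 1) * (real (j + 1) * t)) * sin (real (i + 1) * (real (k + 1) * t)))"
  proof -
    have "dst n i j * dst n i k
        = 2 / (real n + 1) * (sin (real (i + 1) * (real (j + 1) * t)) * sin (real (i + 1) * (real (k + 1) * t)))" for i
    proof -
      have "(c * a) * (c * b) = (c * c) * (a * b)" for a b c :: real by simp
      then have "(c * a) * (c * b) = e * (a * b)" if "c * c = e" for a b c e :: real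
        using that by metis
      then show ?thesis unfolding dst_def t_def by this simp
    qed
    then show ?thesis by (simp add: sum_distrib_left)
  qed
  also have "(\<Sum>i<n. sin (real (i + 1) * (real (j + 1) * t)) * sin (real (i + 1) * (real (k + 1) * t)))
      = (\<Sum>i\<le>n. sin (real i * (real (j + 1) * t)) * sin (real i * (real (k + 1) * t)))"
    by (simp only: lessThan_Suc_atMost[symmetric] sum.lessThan_Suc_shift) simp
  also have "\<dots> = (\<Sum>i\<le>n. (cos (real i * (real (k - j) * t)) - cos (real i * (real (j + k + 2) * t))) / 2)"
  proof (rule sum.cong[OF refl])
    fix i
    have "real i * (real (k - j) * t) = real i * (real (k + 1) * t) - real i * (real (j + 1) * t)"
      using le(1) by (simp add: algebra_simps of_nat_diff)
    moreover have "real i * (real (j + k + 2) * t) = real i * (real (k + 1) * t) + real i * (real (j + 1) * t)"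
      by (simp add: algebra_simps)
    ultimately show "sin (real i * (real (j + 1) * t)) * sin (real i * (real (k + 1) * t)) =
      (cos (real i * (real (k - j) * t)) - cos (real i * (real (j + k + 2) * t))) / 2"
      by (simp add: cos_add cos_diff)
  qed
  also have "\<dots> = (C (k - j) - C (j + k + 2)) / 2"
    unfolding C_def by (simp only: sum_divide_distrib[symmetric] sum_subtractf)
  finally have *: "(\<Sum>i<n. dst n i j * dst n i k) = 2 / (real n + 1) * ((C (k - j) - C (j + k + 2)) / 2)" .
  have C: "C m = (1 - (-1) ^ m) / 2" if "0 < m" "m < 2 * (n + 1)" for m
    using sum_cos_grid[OF that] unfolding C_def t_def .
  have Cs: "C (j + k + 2) = (1 - (-1) ^ (j + k)) / 2" using C[of "j + k + 2"] le by simp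
  show ?case
  proof (cases "j = k")
    case True
    have "C 0 = real n + 1" unfolding C_def by simp
    moreover have "C (j + k + 2) = 0" unfolding Cs using True by (simp add: power_add[symmetric] flip: mult_2)
    ultimately show ?thesis unfolding * using True by (simp del: of_nat_add)
  next
    case False
    have "(-1 :: real) ^ (k - j) = (-1) ^ (j + k)"
      using le(1) by (metis even_diff_nat even_add minus_one_power_iff add.commute linorder_not_less)
    moreover have "C (k - j) = (1 - (-1) ^ (k - j)) / 2"
      by (rule C) (use le False in auto)
    ultimately have "C (k - j) = C (j + k + 2)" using Cs by simp
    then show ?thesis unfolding * using False by simp
  qed
next
  case (sym j k)
  then show ?case by (cases "j = k") (simp_all add: mult.commute)
qed

text \<open>Reflecting the row index replaces the angle by \<open>(j + 1) * pi\<close> minus the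
  angle.\<close>

lemma dst_flip:
  assumes "i < n"
  shows "dst n (n - 1 - i) j = (-1) ^ j * dst n i j"
proof -
  define t where "t = pi / (real n + 1)"
  have "real (n - 1 - i + 1) * (real (j + 1) * t) = real (j + 1) * pi - real (i + 1) * (real (j + 1) * t)"
  proof -
    have "real (n - 1 - i + 1) = (real n + 1) - real (i + 1)" using assms by (simp add: of_nat_diff)
    then have "real (n - 1 - i + 1) * (real (j + 1) * t)
        = real (j + 1) * ((real n + 1) * t) - real (i + 1) * (real (j + 1) * t)"
      by (simp only: left_diff_distrib) (simp only: mult_ac)
    moreover have "(real n + 1) * t = pi" unfolding t_def by simp
    ultimately show ?thesis by simp
  qed
  moreover have "sin (real (j + 1) * pi - y) = (-1) ^ j * sin y" for y
    using sin_npi[of "j + 1"] cos_npi[of "j + 1"] by (simp add: sin_diff del: of_nat_add)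
  ultimately show ?thesis unfolding dst_def t_def[symmetric] by (simp only: mult_ac)
qed

text \<open>The coefficient of the even extension of \<open>g\<close> with respect to
  \<open>exp (i k x)\<close>, folded to the half period. It therefore carries no factor 2, and
  \<open>k\<close> ranges over all integers.\<close>

definition cos_coeff :: "(real \<Rightarrow> real) \<Rightarrow> int \<Rightarrow> real" where
  "cos_coeff g k = (LINT x|lebesgue_on {0..pi}. g x * cos (of_int k * x)) / pi"

lemma integrable_continuous_0pi:
  fixes g :: "real \<Rightarrow> real"
  assumes "continuous_on {0..pi} g"
  shows "integrable (lebesgue_on {0..pi}) g"
  using assms continuous_imp_integrable_real by blast

lemma integral_cos_0pi:
  "(LINT x|lebesgue_on {0..pi}. cos (of_int k * x)) = (if k = 0 then pi else 0)"
proof (cases "k = 0")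
  case False
  have "((\<lambda>x. cos (of_int k * x)) has_integral (sin (of_int k * pi) / of_int k - sin (of_int k * 0) / of_int k)) {0..pi}"
    by (rule fundamental_theorem_of_calculus)
      (auto simp: has_real_derivative_iff_has_vector_derivative[symmetric] False intro!: derivative_eq_intros)
  then have "integral {0..pi} (\<lambda>x. cos (of_int k * x)) = 0"
    by (simp add: sin_zero_iff_int2 integral_unique)
  moreover have "integrable (lebesgue_on {0..pi}) (\<lambda>x. cos (of_int k * x))"
    by (intro integrable_continuous_0pi continuous_intros)
  ultimately show ?thesis using False by (simp add: lebesgue_integral_eq_integral)
next
  case True
  then show ?thesis by (simp add: measure_restrict_space)
qed

text \<open>Written as a sum of two indicators since both fire for \<open>m = 0\<close>, which
  yields the coefficient 1 of the constant without a separate case.\<close>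

lemma cos_coeff_cos:
  "cos_coeff (\<lambda>x. cos (real m * x)) k = ((if k = int m then 1 else 0) + (if k = - int m then 1 else 0)) / 2"
proof -
  have "(\<lambda>x. cos (real m * x) * cos (of_int k * x)) =
      (\<lambda>x. (cos (of_int (k - int m) * x) + cos (of_int (k + int m) * x)) / 2)"
    by (rule ext) (simp add: cos_add cos_diff algebra_simps)
  moreover have "integrable (lebesgue_on {0..pi}) (\<lambda>x. cos (of_int j * x))" for j
    by (intro integrable_continuous_0pi continuous_intros)
  ultimately have "cos_coeff (\<lambda>x. cos (real m * x)) k =
      ((if k - int m = 0 then pi else 0) + (if k + int m = 0 then pi else 0)) / 2 / pi"
    unfolding cos_coeff_def by (simp only: integral_divide_zero Bochner_Integration.integral_add integral_cos_0pi)
  then show ?thesis by (auto simp: eq_neg_iff_add_eq_0)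
qed

definition cos_poly :: "nat \<Rightarrow> (nat \<Rightarrow> real) \<Rightarrow> real \<Rightarrow> real" where
  "cos_poly d a x = (\<Sum>m\<le>d. a m * cos (real m * x))"

lemma cos_coeff_cos_poly:
  "cos_coeff (cos_poly d a) k = (\<Sum>m\<le>d. a m * cos_coeff (\<lambda>x. cos (real m * x)) k)"
proof -
  have int: "integrable (lebesgue_on {0..pi}) (\<lambda>x. a m * (cos (real m * x) * cos (of_int k * x)))" for m
    by (intro integrable_continuous_0pi continuous_intros)
  have "(LINT x|lebesgue_on {0..pi}. cos_poly d a x * cos (of_int k * x))
      = (LINT x|lebesgue_on {0..pi}. (\<Sum>m\<le>d. a m * (cos (real m * x) * cos (of_int k * x))))"
    unfolding cos_poly_def by (simp add: sum_distrib_right mult.assoc)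
  also have "\<dots> = (\<Sum>m\<le>d. a m * (LINT x|lebesgue_on {0..pi}. cos (real m * x) * cos (of_int k * x)))"
    using int by (subst Bochner_Integration.integral_sum) auto
  finally show ?thesis unfolding cos_coeff_def by (simp add: sum_divide_distrib)
qed

text \<open>Off the first and last \<open>d\<close> rows, sampled sines are exact eigenvectors of the banded Toeplitz
  matrix generated by a cosine polynomial of degree \<open>d\<close>.\<close>

lemma dst_residual_cos:
  fixes j :: nat
  assumes "i < n"
  defines "\<theta> \<equiv> real (j + 1) * (pi / (real n + 1))"
  shows "\<bar>(\<Sum>b<n. cos_coeff (\<lambda>x. cos (real m * x)) (int i - int b) * dst n b j) - cos (real m * \<theta>) * dst n i j\<bar>
    \<le> (if i < m \<or> n \<le> i + m then sqrt (2 / (real n + 1)) else 0)"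
proof -
  define c where "c = sqrt (2 / (real n + 1))"
  have c: "c \<ge> 0" unfolding c_def by simp
  \<comment> \<open>The sine column continued to all integers. There half the sum of
    \<open>s (q - m)\<close> and \<open>s (q + m)\<close> is exactly
    \<open>cos (m * \<theta>) * s q\<close>, so the residual consists of those of the two neighbours
    that fall outside the matrix, each at most \<open>c / 2\<close>.\<close>
  define s where "s q = c * sin (of_int (q + 1) * \<theta>)" for q :: int
  have sc: "\<bar>s q\<bar> \<le> c" for q unfolding s_def using c by (simp add: abs_mult mult_left_le)
  have dst: "dst n b j = s (int b)" for b unfolding dst_def s_def c_def \<theta>_def by (simp add: add.commute)
  have "(\<Sum>b<n. cos_coeff (\<lambda>x. cos (real m * x)) (int i - int b) * dst n b j)
      = (\<Sum>b<n. (if int b = int i - int m then s (int i - int m) / 2 else 0)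
          + (if int b = int i + int m then s (int i + int m) / 2 else 0))"
    unfolding cos_coeff_cos dst
  proof (intro sum.cong refl)
    fix b
    have "(int i - int b = int m) = (int b = int i - int m)"
      "(int i - int b = - int m) = (int b = int i + int m)" by linarith+
    moreover have "((if z = u then 1 else 0) + (if z = v then 1 else 0)) / 2 * s z
      = (if z = u then s u / 2 else 0) + (if z = v then s v / 2 else 0)" for z u v by auto
    ultimately show "((if int i - int b = int m then 1 else 0) + (if int i - int b = - int m then 1 else 0)) / 2 * s (int b)
      = (if int b = int i - int m then s (int i - int m) / 2 else 0)
          + (if int b = int i + int m then s (int i + int m) / 2 else 0)"
      by (simp only:)
  qed
  also have "\<dots> = (\<Sum>b<n. if int b = int i - int m then s (int i - int m) / 2 else 0)
      + (\<Sum>b<n. if int b = int i + int m then s (int i + int m) / 2 else 0)"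
    by (rule sum.distrib)
  also have "(\<Sum>b<n. if int b = int i - int m then s (int i - int m) / 2 else 0)
      = (if i < m then 0 else s (int i - int m) / 2)"
  proof (cases "i < m")
    case False
    then have "(int b = int i - int m) = (b = i - m)" for b by auto
    then show ?thesis using False assms(1) by simp
  qed (auto intro!: sum.neutral)
  also have "(\<Sum>b<n. if int b = int i + int m then s (int i + int m) / 2 else 0)
      = (if n \<le> i + m then 0 else s (int i + int m) / 2)"
  proof -
    have "(int b = int i + int m) = (b = i + m)" for b by auto
    then show ?thesis by simp
  qed
  finally have 1: "(\<Sum>b<n. cos_coeff (\<lambda>x. cos (real m * x)) (int i - int b) * dst n b j)
      = (if i < m then 0 else s (int i - int m) / 2) + (if n \<le> i + m then 0 else s (int i + int m) / 2)" .
  have 2: "cos (real m * \<theta>) * dst n i j = s (int i - int m) / 2 + s (int i + int m) / 2"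
  proof -
    have e1: "of_int (int i - int m + 1) * \<theta> = real (i + 1) * \<theta> - real m * \<theta>"
      by (simp add: algebra_simps)
    have e2: "of_int (int i + int m + 1) * \<theta> = real (i + 1) * \<theta> + real m * \<theta>"
      by (simp add: algebra_simps)
    have e3: "of_int (int i + 1) * \<theta> = real (i + 1) * \<theta>" by simp
    show ?thesis unfolding dst s_def e1 e2 e3 by (simp only: sin_add sin_diff) (simp add: field_simps)
  qed
  show ?thesis unfolding 1 2 c_def[symmetric] using sc[of "int i - int m"] sc[of "int i + int m"] c by auto
qed

lemma dst_residual_cos_poly:
  fixes j :: nat
  assumes "i < n"
  defines "\<theta> \<equiv> real (j + 1) * (pi / (real n + 1))"
  shows "\<bar>(\<Sum>b<n. cos_coeff (cos_poly d a) (int i - int b) * dst n b j) - cos_poly d a \<theta> * dst n i j\<bar>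
    \<le> (if i < d \<or> n \<le> i + d then (\<Sum>m\<le>d. \<bar>a m\<bar>) * sqrt (2 / (real n + 1)) else 0)"
proof -
  define r where "r m = (\<Sum>b<n. cos_coeff (\<lambda>x. cos (real m * x)) (int i - int b) * dst n b j) - cos (real m * \<theta>) * dst n i j" for m
  have r: "\<bar>r m\<bar> \<le> (if i < d \<or> n \<le> i + d then sqrt (2 / (real n + 1)) else 0)" if "m \<le> d" for m
    using dst_residual_cos[OF assms(1), of m j] that unfolding r_def \<theta>_def
    by (cases "i < m"; cases "n \<le> i + m"; auto intro: order_trans)
  have "(\<Sum>b<n. cos_coeff (cos_poly d a) (int i - int b) * dst n b j) - cos_poly d a \<theta> * dst n i j
      = (\<Sum>m\<le>d. a m * r m)"
    unfolding r_def cos_coeff_cos_poly cos_poly_def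
    by (simp add: sum_distrib_left sum_distrib_right right_diff_distrib sum_subtractf mult.assoc)
      (subst sum.swap, simp)
  also have "\<bar>\<dots>\<bar> \<le> (\<Sum>m\<le>d. \<bar>a m\<bar> * (if i < d \<or> n \<le> i + d then sqrt (2 / (real n + 1)) else 0))"
    by (rule order_trans[OF sum_abs]) (intro sum_mono, use r in \<open>auto simp: abs_mult intro!: mult_left_mono\<close>)
  finally show ?thesis by (auto simp: sum_distrib_right)
qed

text \<open>At most \<open>2 * d\<close> rows contribute, with squared entries of order
  \<open>1 / n\<close> in each of \<open>n\<close> columns. The bound is thus independent of
  \<open>n\<close> and negligible against the number of eigenvalues.\<close>

lemma sum_dst_residual_cos_poly:
  "(\<Sum>j<n. \<Sum>i<n. ((\<Sum>b<n. cos_coeff (cos_poly d a) (int i - int b) * dst n b j)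
      - cos_poly d a (real (j + 1) * (pi / (real n + 1))) * dst n i j)\<^sup>2)
    \<le> 4 * real d * (\<Sum>m\<le>d. \<bar>a m\<bar>)\<^sup>2" (is "(\<Sum>j<n. \<Sum>i<n. (?r i j)\<^sup>2) \<le> _")
proof -
  define P where "P = (\<Sum>m\<le>d. \<bar>a m\<bar>)"
  have r: "(?r i j)\<^sup>2 \<le> (if i < d \<or> n \<le> i + d then P\<^sup>2 * (2 / (real n + 1)) else 0)" if "i < n" for i j
  proof -
    have "\<bar>?r i j\<bar>\<^sup>2 \<le> (if i < d \<or> n \<le> i + d then P * sqrt (2 / (real n + 1)) else 0)\<^sup>2"
      using dst_residual_cos_poly[OF that, of d a j] unfolding P_def by (intro power_mono) auto
    then show ?thesis by (auto simp: power_mult_distrib split: if_splits)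
  qed
  have card: "real (card {i. i < n \<and> (i < d \<or> n \<le> i + d)}) \<le> 2 * real d"
  proof -
    have "card {i. i < n \<and> (i < d \<or> n \<le> i + d)} \<le> card ({..<d} \<union> {n - d..<n})"
      by (intro card_mono) auto
    also have "\<dots> \<le> card {..<d} + card {n - d..<n}" by (rule card_Un_le)
    also have "\<dots> \<le> 2 * d" by simp
    finally show ?thesis by linarith
  qed
  have "(\<Sum>i<n. (?r i j)\<^sup>2) \<le> 2 * real d * (P\<^sup>2 * (2 / (real n + 1)))" for j
  proof -
    have "(\<Sum>i<n. (?r i j)\<^sup>2) \<le> (\<Sum>i<n. if i < d \<or> n \<le> i + d then P\<^sup>2 * (2 / (real n + 1)) else 0)"
      using r by (intro sum_mono) auto
    also have "\<dots> = real (card {i. i < n \<and> (i < d \<or> n \<le> i + d)}) * (P\<^sup>2 * (2 / (real n + 1)))"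
      by (subst sum.inter_filter[symmetric]) auto
    also have "\<dots> \<le> 2 * real d * (P\<^sup>2 * (2 / (real n + 1)))"
      by (intro mult_right_mono card) auto
    finally show ?thesis .
  qed
  then have "(\<Sum>j<n. \<Sum>i<n. (?r i j)\<^sup>2) \<le> (\<Sum>j<n. 2 * real d * (P\<^sup>2 * (2 / (real n + 1))))"
    by (intro sum_mono)
  also have "\<dots> = 4 * real d * P\<^sup>2 * (real n / (real n + 1))" by simp
  also have "\<dots> \<le> 4 * real d * P\<^sup>2 * 1" by (intro mult_left_mono) auto
  finally show ?thesis unfolding P_def by simp
qed

section \<open>Eigenbases of alternating parity for symmetric Toeplitz matrices\<close>

lemma orthonormal_inner:
  fixes S :: "nat \<Rightarrow> nat \<Rightarrow> real"
  assumes "\<And>a b. a < n \<Longrightarrow> b < n \<Longrightarrow> (\<Sum>i<n. S i a * S i b) = (if a = b then 1 else 0)"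
  shows "(\<Sum>i<n. (\<Sum>a<n. S i a * x a) * (\<Sum>b<n. S i b * y b)) = (\<Sum>a<n. x a * y a)"
proof -
  have "(\<Sum>i<n. (\<Sum>a<n. S i a * x a) * (\<Sum>b<n. S i b * y b))
      = (\<Sum>i<n. \<Sum>a<n. \<Sum>b<n. x a * y b * (S i a * S i b))"
    unfolding sum_product by (intro sum.cong refl) (simp add: mult_ac)
  also have "\<dots> = (\<Sum>a<n. \<Sum>i<n. \<Sum>b<n. x a * y b * (S i a * S i b))"
    by (rule sum.swap)
  also have "\<dots> = (\<Sum>a<n. \<Sum>b<n. \<Sum>i<n. x a * y b * (S i a * S i b))"
    by (rule sum.cong[OF refl], rule sum.swap)
  also have "\<dots> = (\<Sum>a<n. \<Sum>b<n. if b = a then x a * y b else 0)"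
    unfolding sum_distrib_left[symmetric] by (intro sum.cong refl) (simp add: assms)
  also have "\<dots> = (\<Sum>a<n. x a * y a)" by simp
  finally show ?thesis .
qed

lemma dst_orthonormal_rows:
  assumes "i < n" "k < n"
  shows "(\<Sum>j<n. dst n i j * dst n k j) = (if i = k then 1 else 0)"
  using dst_orthonormal[OF assms] by (simp add: dst_sym[of n i] dst_sym[of n k])

lemma dst_expand:
  assumes "i < n"
  shows "(\<Sum>b<n. dst n i b * (\<Sum>a<n. dst n a b * x a)) = x i"
proof -
  have "(\<Sum>b<n. dst n i b * (\<Sum>a<n. dst n a b * x a)) = (\<Sum>b<n. \<Sum>a<n. dst n i b * dst n a b * x a)"
    by (simp add: sum_distrib_left mult.assoc)
  also have "\<dots> = (\<Sum>a<n. (\<Sum>b<n. dst n i b * dst n a b) * x a)"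
    unfolding sum_distrib_right by (rule sum.swap)
  also have "\<dots> = (\<Sum>a<n. if a = i then x a else 0)"
    using assms by (intro sum.cong refl) (auto simp: dst_orthonormal_rows)
  also have "\<dots> = x i" using assms by simp
  finally show ?thesis .
qed

lemma sum_flip: "(\<Sum>i<n. g (n - 1 - i)) = (\<Sum>i<n. g i)" for n :: nat
  by (rule sum.reindex_bij_witness[of _ "\<lambda>i. n - 1 - i" "\<lambda>i. n - 1 - i"]) auto

text \<open>\<open>B\<close> is the Toeplitz matrix in the sine basis, \<open>U\<close> an
  eigenbasis of \<open>B\<close>, and \<open>V\<close> is \<open>U\<close> mapped back. The matrix
  \<open>U\<close> is exported because its squared entries later serve as weights: by the last
  identity, the weighted squared distance between eigenvalues and any numbers \<open>q j\<close> is
  the total residual of the sine columns as approximate eigenvectors.\<close>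

lemma toeplitz_parity_eigenbasis:
  fixes c :: "int \<Rightarrow> real"
  assumes c: "\<And>k. c (- k) = c k"
  obtains V U :: "nat \<Rightarrow> nat \<Rightarrow> real" and l :: "nat \<Rightarrow> real" where
    "\<And>j k. j < n \<Longrightarrow> k < n \<Longrightarrow> (\<Sum>i<n. V i j * V i k) = (if j = k then 1 else 0)"
    "\<And>i j. i < n \<Longrightarrow> j < n \<Longrightarrow> (\<Sum>k<n. V i k * V j k) = (if i = j then 1 else 0)"
    "\<And>i k. i < n \<Longrightarrow> k < n \<Longrightarrow> (\<Sum>j<n. c (int i - int j) * V j k) = l k * V i k"
    "\<And>i k. i < n \<Longrightarrow> k < n \<Longrightarrow> V (n - 1 - i) k = (-1) ^ k * V i k"
    "\<And>j. j < n \<Longrightarrow> (\<Sum>k<n. (U j k)\<^sup>2) = 1"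
    "\<And>k. k < n \<Longrightarrow> (\<Sum>j<n. (U j k)\<^sup>2) = 1"
    "\<And>j k. odd (j + k) \<Longrightarrow> U j k = 0"
    "\<And>q. (\<Sum>j<n. \<Sum>k<n. (U j k)\<^sup>2 * (l k - q j)\<^sup>2) =
      (\<Sum>j<n. \<Sum>i<n. ((\<Sum>b<n. c (int i - int b) * dst n b j) - q j * dst n i j)\<^sup>2)"
proof -
  define X where "X i j = (\<Sum>b<n. c (int i - int b) * dst n b j)" for i j
  define B where "B i j = (\<Sum>a<n. dst n a i * X a j)" for i j
  have B2: "B i j = (\<Sum>a<n. \<Sum>b<n. dst n a i * c (int a - int b) * dst n b j)" for i j
    unfolding B_def X_def by (simp add: sum_distrib_left mult.assoc)
  have Bsym: "B i j = B j i" for i j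
  proof -
    have "c (int a - int b) = c (int b - int a)" for a b using c[of "int b - int a"] by simp
    then show ?thesis unfolding B2 by (subst sum.swap) (simp only: mult_ac)
  qed
  \<comment> \<open>Reversing both summation indices leaves the Toeplitz entry unchanged, since
    \<open>c\<close> is even, and multiplies the two sine columns by
    \<open>(-1) ^ (i + j)\<close>.\<close>
  have Bpar: "B i j = 0" if "odd (i + j)" for i j
  proof -
    have "B i j = (\<Sum>a<n. \<Sum>b<n. dst n (n - 1 - a) i * c (int (n - 1 - a) - int (n - 1 - b)) * dst n (n - 1 - b) j)"
    proof -
      define h where "h a = (\<Sum>b<n. dst n a i * c (int a - int b) * dst n b j)" for a
      have "h a = (\<Sum>b<n. dst n a i * c (int a - int (n - 1 - b)) * dst n (n - 1 - b) j)" for a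
        unfolding h_def by (rule sum_flip[symmetric])
      moreover have "B i j = (\<Sum>a<n. h (n - 1 - a))"
        unfolding B2 h_def[symmetric] by (rule sum_flip[symmetric])
      ultimately show ?thesis by simp
    qed
    also have "\<dots> = (\<Sum>a<n. \<Sum>b<n. - (dst n a i * c (int a - int b) * dst n b j))"
    proof (intro sum.cong refl)
      fix a b assume ab: "a \<in> {..<n}" "b \<in> {..<n}"
      then have "int (n - 1 - a) - int (n - 1 - b) = - (int a - int b)" by auto
      then have cc: "c (int (n - 1 - a) - int (n - 1 - b)) = c (int a - int b)" by (simp only: c)
      have "(-1 :: real) ^ i * (-1) ^ j = -1" using that by (simp flip: power_add)
      then show "dst n (n - 1 - a) i * c (int (n - 1 - a) - int (n - 1 - b)) * dst n (n - 1 - b) j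
          = - (dst n a i * c (int a - int b) * dst n b j)"
      proof -
        have "(s * x) * z * (t * y) = (s * t) * (x * z * y)" for s t x y z :: real by simp
        then show ?thesis unfolding cc using ab dst_flip[of a n i] dst_flip[of b n j] \<open>(-1) ^ i * (-1) ^ j = -1\<close>
          by (simp only: lessThan_iff)
      qed
    qed
    also have "\<dots> = - B i j" unfolding B2 by (simp add: sum_negf)
    finally show ?thesis by simp
  qed
  obtain U l where U:
    "\<And>j k. j < n \<Longrightarrow> k < n \<Longrightarrow> (\<Sum>i<n. U i j * U i k) = (if j = k then 1 else 0)"
    "\<And>i j. i < n \<Longrightarrow> j < n \<Longrightarrow> (\<Sum>k<n. U i k * U j k) = (if i = j then 1 else 0)"
    "\<And>i k. i < n \<Longrightarrow> k < n \<Longrightarrow> (\<Sum>j<n. B i j * U j k) = l k * U i k"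
    "\<And>i k. odd (i + k) \<Longrightarrow> U i k = 0"
    using parity_block_diagonalization[of n B, OF Bsym Bpar] by blast
  define V where "V i k = (\<Sum>a<n. dst n i a * U a k)" for i k
  have XB: "X i j = (\<Sum>b<n. dst n i b * B b j)" if "i < n" for i j
    unfolding B_def by (rule dst_expand[OF that, symmetric])
  show thesis
  proof (rule that[of V l U])
    fix j k assume jk: "j < n" "k < n"
    show "(\<Sum>i<n. V i j * V i k) = (if j = k then 1 else 0)"
      unfolding V_def by (subst orthonormal_inner) (use dst_orthonormal U(1) jk in auto)
    have "(\<Sum>i<n. V j i * V k i) = (\<Sum>i<n. (\<Sum>a<n. U a i * dst n j a) * (\<Sum>a<n. U a i * dst n k a))"
      unfolding V_def by (simp add: mult.commute)
    also have "\<dots> = (\<Sum>a<n. dst n j a * dst n k a)"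
      by (rule orthonormal_inner) (use U(2) in auto)
    finally show "(\<Sum>i<n. V j i * V k i) = (if j = k then 1 else 0)"
      using dst_orthonormal_rows[OF jk] by simp
    have "(\<Sum>i<n. c (int j - int i) * V i k) = (\<Sum>i<n. \<Sum>a<n. c (int j - int i) * dst n i a * U a k)"
      unfolding V_def by (simp add: sum_distrib_left mult.assoc)
    also have "\<dots> = (\<Sum>a<n. X j a * U a k)"
      unfolding X_def sum_distrib_right by (rule sum.swap)
    also have "\<dots> = (\<Sum>a<n. \<Sum>b<n. dst n j b * (B b a * U a k))"
      by (simp add: XB[OF jk(1)] sum_distrib_right mult.assoc)
    also have "\<dots> = (\<Sum>b<n. dst n j b * (\<Sum>a<n. B b a * U a k))"
      unfolding sum_distrib_left by (rule sum.swap)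
    also have "\<dots> = (\<Sum>b<n. l k * (dst n j b * U b k))"
      using jk by (intro sum.cong refl) (simp add: U(3))
    finally show "(\<Sum>i<n. c (int j - int i) * V i k) = l k * V j k"
      unfolding V_def by (simp add: sum_distrib_left)
    \<comment> \<open>Only sine columns \<open>a\<close> of the parity of \<open>k\<close> enter
      column \<open>k\<close> of \<open>V\<close>, so all of them acquire the same sign.\<close>
    have "dst n (n - 1 - j) a * U a k = (-1) ^ k * (dst n j a * U a k)" for a
    proof (cases "odd (a + k)")
      case False
      then have "(-1 :: real) ^ a = (-1) ^ k" by (simp add: minus_one_power_iff)
      then show ?thesis using dst_flip[OF jk(1), of a] by simp
    qed (simp add: U(4))
    then show "V (n - 1 - j) k = (-1) ^ k * V j k" by (simp only: V_def sum_distrib_left)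
  next
    fix j assume "j < n"
    then show "(\<Sum>k<n. (U j k)\<^sup>2) = 1" "(\<Sum>i<n. (U i j)\<^sup>2) = 1"
      using U(1)[of j j] U(2)[of j j] by (auto simp: power2_eq_square)
  next
    fix q :: "nat \<Rightarrow> real"
    show "(\<Sum>j<n. \<Sum>k<n. (U j k)\<^sup>2 * (l k - q j)\<^sup>2) =
      (\<Sum>j<n. \<Sum>i<n. ((\<Sum>b<n. c (int i - int b) * dst n b j) - q j * dst n i j)\<^sup>2)"
    proof (rule sum.cong[OF refl])
      fix j assume "j \<in> {..<n}"
      then have j: "j < n" by simp
      \<comment> \<open>Column \<open>j\<close> of \<open>B - q j\<close>, seen in two orthonormal
        bases: in the basis \<open>U\<close> its coordinates are \<open>U j k * (l k - q j)\<close>,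
        and mapped back by the sine transform it is the residual of sine column \<open>j\<close>.
        Comparing norms gives the identity.\<close>
      define D where "D a = B j a - q j * (if a = j then 1 else 0)" for a
      have "(U j k)\<^sup>2 * (l k - q j)\<^sup>2 = (\<Sum>a<n. U a k * D a) * (\<Sum>a<n. U a k * D a)" if "k < n" for k
      proof -
        have "(\<Sum>a<n. U a k * D a) = (\<Sum>a<n. B j a * U a k) - (\<Sum>a<n. if a = j then q j * U a k else 0)"
          unfolding sum_subtractf[symmetric] D_def by (intro sum.cong refl) (simp add: algebra_simps)
        also have "\<dots> = U j k * (l k - q j)" using j that by (simp add: U(3) algebra_simps)
        finally show ?thesis by (simp add: power2_eq_square)
      qed
      then have "(\<Sum>k<n. (U j k)\<^sup>2 * (l k - q j)\<^sup>2) = (\<Sum>k<n. (\<Sum>a<n. U a k * D a) * (\<Sum>a<n. U a k * D a))"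
        by simp
      also have "\<dots> = (\<Sum>a<n. D a * D a)"
        by (rule orthonormal_inner) (use U(2) in auto)
      also have "\<dots> = (\<Sum>a<n. (\<Sum>i<n. dst n i a * (X i j - q j * dst n i j)) * (\<Sum>i<n. dst n i a * (X i j - q j * dst n i j)))"
      proof (rule sum.cong[OF refl])
        fix a assume "a \<in> {..<n}"
        then have "(\<Sum>i<n. dst n i a * (X i j - q j * dst n i j)) = B a j - q j * (if a = j then 1 else 0)"
          using dst_orthonormal[of a n j] j unfolding B_def
          by (simp only: right_diff_distrib sum_subtractf mult.left_commute[of _ "q j"] sum_distrib_left[symmetric]) simp
        then show "D a * D a = (\<Sum>i<n. dst n i a * (X i j - q j * dst n i j)) * (\<Sum>i<n. dst n i a * (X i j - q j * dst n i j))"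
          unfolding D_def by (simp add: Bsym[of j])
      qed
      also have "\<dots> = (\<Sum>i<n. (X i j - q j * dst n i j) * (X i j - q j * dst n i j))"
        by (rule orthonormal_inner) (use dst_orthonormal_rows in auto)
      finally show "(\<Sum>k<n. (U j k)\<^sup>2 * (l k - q j)\<^sup>2) =
          (\<Sum>i<n. ((\<Sum>b<n. c (int i - int b) * dst n b j) - q j * dst n i j)\<^sup>2)"
        unfolding X_def by (simp add: power2_eq_square)
    qed
  qed (use U(4) in auto)
qed

section \<open>Bessel's inequality and Frobenius norms of Toeplitz matrices\<close>

abbreviation "leb0pi \<equiv> lebesgue_on {0..pi}"

lemma finite_measure_leb0pi: "finite_measure leb0pi"
  by (intro finite_measureI) (simp add: emeasure_restrict_space space_restrict_space)

lemma integrable_bounded_leb0pi: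
  fixes g :: "real \<Rightarrow> real"
  assumes "g \<in> borel_measurable leb0pi" "\<And>x. x \<in> {0..pi} \<Longrightarrow> \<bar>g x\<bar> \<le> K"
  shows "integrable leb0pi g"
  using assms by (intro finite_measure.integrable_const_bound[OF finite_measure_leb0pi, of g K])
    (auto intro!: AE_I2 simp: space_restrict_space)

lemma continuous_borel_measurable_leb0pi:
  fixes g :: "real \<Rightarrow> real"
  assumes "continuous_on UNIV g"
  shows "g \<in> borel_measurable leb0pi"
  using assms by (intro continuous_imp_measurable_on_sets_lebesgue) (auto intro: continuous_on_subset)

text \<open>Bessel's inequality for the system \<open>exp (i k x)\<close>, written with real and imaginary parts.\<close>

lemma cos_coeff_bessel:
  fixes g :: "real \<Rightarrow> real"
  assumes g: "g \<in> borel_measurable leb0pi" "\<And>x. x \<in> {0..pi} \<Longrightarrow> \<bar>g x\<bar> \<le> K"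
    and J: "finite J"
  shows "(\<Sum>k\<in>J. (cos_coeff g k)\<^sup>2) \<le> (LINT x|leb0pi. (g x)\<^sup>2) / pi"
proof -
  define c where "c = cos_coeff g"
  define h1 where "h1 x = (\<Sum>k\<in>J. c k * cos (of_int k * x))" for x
  \<comment> \<open>The sine part turns the products into \<open>cos ((k - m) * x)\<close>, which
    integrates to 0 over \<open>[0, pi]\<close> for \<open>k \<noteq> m\<close>. Cosines alone would
    not do, as \<open>k\<close> and \<open>-k\<close> may both lie in \<open>J\<close>.\<close>
  define h2 where "h2 x = (\<Sum>k\<in>J. c k * sin (of_int k * x))" for x
  have K: "K \<ge> 0" using g(2)[of 0] by simp
  have i1: "integrable leb0pi (\<lambda>x. (g x)\<^sup>2)"
  proof (rule integrable_bounded_leb0pi[of _ "K\<^sup>2"])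
    show "(\<lambda>x. (g x)\<^sup>2) \<in> borel_measurable leb0pi" using g(1) by measurable
    show "\<bar>(g x)\<^sup>2\<bar> \<le> K\<^sup>2" if "x \<in> {0..pi}" for x
      using power_mono[OF g(2)[OF that], of 2] by simp
  qed
  have cm: "(\<lambda>x. cos (of_int k * x)) \<in> borel_measurable leb0pi" for k
    by (intro continuous_borel_measurable_leb0pi continuous_intros)
  have i2: "integrable leb0pi (\<lambda>x. g x * cos (of_int k * x))" for k
  proof (rule integrable_bounded_leb0pi[of _ K])
    show "(\<lambda>x. g x * cos (of_int k * x)) \<in> borel_measurable leb0pi" using g(1) cm by measurable
    fix x :: real assume "x \<in> {0..pi}"
    then have "\<bar>g x\<bar> * \<bar>cos (of_int k * x)\<bar> \<le> K * 1" using g(2) K by (intro mult_mono) auto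
    then show "\<bar>g x * cos (of_int k * x)\<bar> \<le> K" by (simp add: abs_mult)
  qed
  have i3: "integrable leb0pi (\<lambda>x. cos (of_int k * x))" for k
    by (intro integrable_continuous_0pi continuous_intros)
  have "(g x - h1 x)\<^sup>2 + (h2 x)\<^sup>2 = (g x)\<^sup>2 - (\<Sum>k\<in>J. 2 * c k * (g x * cos (of_int k * x)))
     + (\<Sum>k\<in>J. \<Sum>m\<in>J. c k * c m * cos (of_int (k - m) * x))" for x
  proof -
    have "(h1 x)\<^sup>2 + (h2 x)\<^sup>2 = (\<Sum>k\<in>J. \<Sum>m\<in>J. c k * c m * cos (of_int (k - m) * x))"
      unfolding h1_def h2_def power2_eq_square sum_product sum.distrib[symmetric]
      by (intro sum.cong refl) (simp add: left_diff_distrib cos_diff algebra_simps)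
    moreover have "2 * (g x * h1 x) = (\<Sum>k\<in>J. 2 * c k * (g x * cos (of_int k * x)))"
      unfolding h1_def by (simp add: sum_distrib_left mult_ac)
    ultimately show ?thesis by (simp add: power2_diff algebra_simps)
  qed
  then have "(LINT x|leb0pi. (g x - h1 x)\<^sup>2 + (h2 x)\<^sup>2)
     = (LINT x|leb0pi. (g x)\<^sup>2 - (\<Sum>k\<in>J. 2 * c k * (g x * cos (of_int k * x)))
     + (\<Sum>k\<in>J. \<Sum>m\<in>J. c k * c m * cos (of_int (k - m) * x)))" by simp
  also have "\<dots> = (LINT x|leb0pi. (g x)\<^sup>2) - (\<Sum>k\<in>J. 2 * c k * (LINT x|leb0pi. g x * cos (of_int k * x)))
     + (\<Sum>k\<in>J. \<Sum>m\<in>J. c k * c m * (LINT x|leb0pi. cos (of_int (k - m) * x)))"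
    using i1 i2 i3 by (simp add: Bochner_Integration.integral_sum del: of_int_diff)
  also have "\<dots> = (LINT x|leb0pi. (g x)\<^sup>2) - (\<Sum>k\<in>J. 2 * pi * (c k)\<^sup>2) + (\<Sum>k\<in>J. pi * (c k)\<^sup>2)"
  proof -
    have "(LINT x|leb0pi. g x * cos (of_int k * x)) = pi * c k" for k
      unfolding c_def cos_coeff_def by simp
    moreover have "(\<Sum>m\<in>J. c k * c m * (LINT x|leb0pi. cos (of_int (k - m) * x))) = pi * (c k)\<^sup>2" if "k \<in> J" for k
    proof -
      have "(\<Sum>m\<in>J. c k * c m * (LINT x|leb0pi. cos (of_int (k - m) * x))) = (\<Sum>m\<in>J. if m = k then pi * (c k)\<^sup>2 else 0)"
        unfolding integral_cos_0pi by (intro sum.cong refl) (auto simp: power2_eq_square)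
      then show ?thesis using that J by simp
    qed
    ultimately show ?thesis by (simp add: power2_eq_square mult_ac)
  qed
  finally have "(LINT x|leb0pi. (g x - h1 x)\<^sup>2 + (h2 x)\<^sup>2) = (LINT x|leb0pi. (g x)\<^sup>2) - pi * (\<Sum>k\<in>J. (c k)\<^sup>2)"
    by (simp add: sum_distrib_left mult.assoc flip: sum_distrib_left)
  moreover have "0 \<le> (LINT x|leb0pi. (g x - h1 x)\<^sup>2 + (h2 x)\<^sup>2)" by simp
  ultimately have "pi * (\<Sum>k\<in>J. (c k)\<^sup>2) \<le> (LINT x|leb0pi. (g x)\<^sup>2)" by linarith
  then show ?thesis unfolding c_def by (simp add: field_simps)
qed

lemma cos_coeff_minus [simp]: "cos_coeff g (- k) = cos_coeff g k"
  unfolding cos_coeff_def by simp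

text \<open>Within one row the coefficients have distinct indices, so Bessel's inequality bounds
  each row separately.\<close>

lemma toeplitz_frobenius_le:
  fixes g :: "real \<Rightarrow> real"
  assumes g: "g \<in> borel_measurable leb0pi" "\<And>x. x \<in> {0..pi} \<Longrightarrow> \<bar>g x\<bar> \<le> K"
  shows "(\<Sum>i<n. \<Sum>j<n. (cos_coeff g (int i - int j))\<^sup>2) \<le> real n * ((LINT x|leb0pi. (g x)\<^sup>2) / pi)"
proof -
  have "(\<Sum>j<n. (cos_coeff g (int i - int j))\<^sup>2) \<le> (LINT x|leb0pi. (g x)\<^sup>2) / pi" for i
  proof -
    have "inj_on (\<lambda>j. int i - int j) {..<n}" by (auto simp: inj_on_def)
    then have "(\<Sum>j<n. (cos_coeff g (int i - int j))\<^sup>2) = (\<Sum>k\<in>(\<lambda>j. int i - int j) ` {..<n}. (cos_coeff g k)\<^sup>2)"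
      by (simp add: sum.reindex)
    also have "\<dots> \<le> (LINT x|leb0pi. (g x)\<^sup>2) / pi" by (rule cos_coeff_bessel[OF g]) auto
    finally show ?thesis .
  qed
  then have "(\<Sum>i<n. \<Sum>j<n. (cos_coeff g (int i - int j))\<^sup>2) \<le> (\<Sum>i<n. (LINT x|leb0pi. (g x)\<^sup>2) / pi)"
    by (intro sum_mono)
  then show ?thesis by simp
qed

section \<open>Uniform approximation by cosine polynomials\<close>

lemma continuous_on_cos_poly [continuous_intros]: "continuous_on S (cos_poly d a)"
  unfolding cos_poly_def by (intro continuous_intros)

lemma cos_power_cos_poly: "\<exists>d a. \<forall>x. cos x ^ k = cos_poly d a x"
proof (induction k)
  case 0
  show ?case by (intro exI[of _ 0] exI[of _ "\<lambda>_. 1"]) (simp add: cos_poly_def)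
next
  case (Suc k)
  then obtain d a where da: "\<And>x. cos x ^ k = cos_poly d a x" by blast
  \<comment> \<open>Multiplication by \<open>cos x\<close> sends half of each coefficient to either
    neighbouring frequency. The constant term goes entirely to frequency 1; the last summand
    supplies its second half.\<close>
  define b where "b m = (if m = 0 then 0 else a (m - 1) / 2) + (if m < d then a (Suc m) / 2 else 0)
    + (if m = 1 then a 0 / 2 else 0)" for m
  have step: "cos x * cos (real m * x) = cos (real (Suc m) * x) / 2 + cos (real (m - 1) * x) / 2" if "m > 0" for m x
  proof -
    have "real (Suc m) * x = real m * x + x" "real (m - 1) * x = real m * x - x"
      using that by (simp_all add: of_nat_diff algebra_simps)
    then show ?thesis by (simp only: cos_add cos_diff) (simp add: field_simps)
  qed
  have "cos x ^ Suc k = cos_poly (Suc d) b x" for x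
  proof -
    have "cos x ^ Suc k = (\<Sum>m\<le>d. a m * (cos x * cos (real m * x)))"
      by (simp add: da cos_poly_def sum_distrib_left mult_ac)
    also have "\<dots> = (\<Sum>m\<le>d. a m / 2 * cos (real (Suc m) * x)) +
       (\<Sum>m\<le>d. a m / 2 * cos (if m = 0 then x else real (m - 1) * x))"
      unfolding sum.distrib[symmetric]
    proof (intro sum.cong refl)
      fix m
      show "a m * (cos x * cos (real m * x)) = a m / 2 * cos (real (Suc m) * x) + a m / 2 * cos (if m = 0 then x else real (m - 1) * x)"
      proof (cases "m = 0")
        case False
        then show ?thesis by (simp add: step distrib_left del: of_nat_Suc)
      qed simp
    qed
    also have "(\<Sum>m\<le>d. a m / 2 * cos (real (Suc m) * x)) =
       (\<Sum>m\<le>Suc d. (if m = 0 then 0 else a (m - 1) / 2) * cos (real m * x))"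
      by (simp only: sum.atMost_Suc_shift) simp
    also have "(\<Sum>m\<le>d. a m / 2 * cos (if m = 0 then x else real (m - 1) * x)) =
       (\<Sum>m\<le>Suc d. ((if m < d then a (Suc m) / 2 else 0) + (if m = 1 then a 0 / 2 else 0)) * cos (real m * x))"
    proof -
      have "(\<Sum>m\<le>d. a m / 2 * cos (if m = 0 then x else real (m - 1) * x))
         = a 0 / 2 * cos x + (\<Sum>m<d. a (Suc m) / 2 * cos (real m * x))"
        by (simp only: lessThan_Suc_atMost[symmetric] sum.lessThan_Suc_shift) simp
      moreover have "(\<Sum>m\<le>Suc d. (if m < d then a (Suc m) / 2 else 0) * cos (real m * x)) = (\<Sum>m<d. a (Suc m) / 2 * cos (real m * x))"
        by (rule sum.mono_neutral_cong_right) auto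
      moreover have "(\<Sum>m\<le>Suc d. (if m = 1 then a 0 / 2 else 0) * cos (real m * x)) = a 0 / 2 * cos x"
      proof -
        have "(\<Sum>m\<le>Suc d. (if m = 1 then a 0 / 2 else 0) * cos (real m * x)) = (\<Sum>m\<le>Suc d. if m = 1 then a 0 / 2 * cos x else 0)"
          by (intro sum.cong refl) auto
        then show ?thesis by simp
      qed
      ultimately show ?thesis by (simp only: distrib_right sum.distrib)
    qed
    finally show ?thesis unfolding cos_poly_def b_def by (simp only: distrib_right sum.distrib add.assoc)
  qed
  then show ?case by blast
qed

lemma cos_poly_add:
  "cos_poly d a x + cos_poly e b x
    = cos_poly (max d e) (\<lambda>m. (if m \<le> d then a m else 0) + (if m \<le> e then b m else 0)) x"
proof -
  have "(\<Sum>m\<le>max d e. (if m \<le> d then a m else 0) * cos (real m * x)) = (\<Sum>m\<le>d. a m * cos (real m * x))"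
    "(\<Sum>m\<le>max d e. (if m \<le> e then b m else 0) * cos (real m * x)) = (\<Sum>m\<le>e. b m * cos (real m * x))"
    by (rule sum.mono_neutral_cong_right; auto)+
  then show ?thesis unfolding cos_poly_def by (simp only: distrib_right sum.distrib)
qed

lemma cos_poly_scale: "c * cos_poly d a x = cos_poly d (\<lambda>m. c * a m) x"
  unfolding cos_poly_def by (simp add: sum_distrib_left mult_ac)

lemma polynomial_of_cos_cos_poly: "\<exists>d a. \<forall>x. (\<Sum>i\<le>k. q i * cos x ^ i) = cos_poly d a x"
proof (induction k)
  case 0
  show ?case by (intro exI[of _ 0] exI[of _ q]) (simp add: cos_poly_def)
next
  case (Suc k)
  then obtain d a where 1: "\<And>x. (\<Sum>i\<le>k. q i * cos x ^ i) = cos_poly d a x" by blast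
  obtain e b where 2: "\<And>x. cos x ^ Suc k = cos_poly e b x" using cos_power_cos_poly[of "Suc k"] by blast
  show ?case unfolding sum.atMost_Suc 1 2 cos_poly_scale cos_poly_add by blast
qed

text \<open>The substitution \<open>t = cos x\<close> reduces the approximation to the algebraic Weierstrass theorem.\<close>

lemma cos_poly_dense:
  fixes h :: "real \<Rightarrow> real"
  assumes h: "continuous_on {0..pi} h" and e: "e > 0"
  obtains d a where "\<And>x. x \<in> {0..pi} \<Longrightarrow> \<bar>h x - cos_poly d a x\<bar> < e"
proof -
  have "continuous_on {-1..1} (\<lambda>t. h (arccos t))"
    by (rule continuous_on_compose2[OF h continuous_on_arccos']) (auto intro: arccos_lbound arccos_ubound)
  then obtain q :: "real \<Rightarrow> real" where q: "polynomial_function q" "\<And>t. t \<in> {-1..1} \<Longrightarrow> \<bar>h (arccos t) - q t\<bar> < e"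
    using Stone_Weierstrass_polynomial_function[of "{-1..1}" "\<lambda>t. h (arccos t)" e] e by auto
  obtain c k where c: "q = (\<lambda>t. \<Sum>i\<le>k. c i * t ^ i)"
    using q(1) by (auto simp: real_polynomial_function_eq[symmetric] real_polynomial_function_iff_sum)
  obtain d a where da: "\<And>x. (\<Sum>i\<le>k. c i * cos x ^ i) = cos_poly d a x"
    using polynomial_of_cos_cos_poly by metis
  show thesis
  proof (rule that)
    fix x assume "x \<in> {0..pi}"
    then show "\<bar>h x - cos_poly d a x\<bar> < e" using q(2)[of "cos x"] by (simp add: c da arccos_cos)
  qed
qed

section \<open>The symbol and the spectral bounds\<close>

text \<open>A Rolle argument: without exceptional points \<open>f\<close> is continuous on
  \<open>{x..y}\<close> and attains its extrema there, and an extremum at an interior point would be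
  a local one.\<close>

lemma equal_values_separated:
  fixes f :: "real \<Rightarrow> real" and a b :: real
  defines "X \<equiv> {x. local_max_point a b f x} \<union> {x. local_min_point a b f x} \<union> {x. discontinuity_point a b f x}"
  assumes xy: "a \<le> x" "x < y" "y \<le> b" "f x = f y"
  shows "X \<inter> {x..y} \<noteq> {}"
proof
  assume no: "X \<inter> {x..y} = {}"
  have "continuous_on {x..y} f"
    unfolding continuous_on_eq_continuous_within
  proof
    fix z assume z: "z \<in> {x..y}"
    then have "\<not> discontinuity_point a b f z" using no unfolding X_def by blast
    then have "continuous (at z within {a..b}) f" using z xy unfolding discontinuity_point_def by auto
    then show "continuous (at z within {x..y}) f"
      by (rule continuous_within_subset) (use xy in auto)
  qed
  then obtain p q where p: "p \<in> {x..y}" "\<And>z. z \<in> {x..y} \<Longrightarrow> f z \<le> f p"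
    and q: "q \<in> {x..y}" "\<And>z. z \<in> {x..y} \<Longrightarrow> f q \<le> f z"
    using continuous_attains_sup[of "{x..y}" f] continuous_attains_inf[of "{x..y}" f] xy by auto
  have max: "local_max_point a b f z" if "x < z" "z < y" "\<And>w. w \<in> {x..y} \<Longrightarrow> f w \<le> f z" for z
    unfolding local_max_point_def
  proof (intro conjI exI[of _ "min (z - x) (y - z)"] ballI impI)
    fix w assume "\<bar>w - z\<bar> < min (z - x) (y - z)"
    then have "w \<in> {x..y}" by (auto simp: abs_less_iff)
    then show "f w \<le> f z" by (rule that(3))
  qed (use that xy in auto)
  have min: "local_min_point a b f z" if "x < z" "z < y" "\<And>w. w \<in> {x..y} \<Longrightarrow> f z \<le> f w" for z
    unfolding local_min_point_def
  proof (intro conjI exI[of _ "min (z - x) (y - z)"] ballI impI)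
    fix w assume "\<bar>w - z\<bar> < min (z - x) (y - z)"
    then have "w \<in> {x..y}" by (auto simp: abs_less_iff)
    then show "f z \<le> f w" by (rule that(3))
  qed (use that xy in auto)
  have "\<not> (x < p \<and> p < y)" "\<not> (x < q \<and> q < y)"
    using max[of p] min[of q] p q no unfolding X_def by auto
  then have "p = x \<or> p = y" "q = x \<or> q = y" using p(1) q(1) by auto
  then have "f p = f x" "f q = f x" using xy(4) by auto
  \<comment> \<open>Both extrema sit at endpoints, where \<open>f\<close> takes one common value, so
    \<open>f\<close> is constant and the midpoint is a weak local maximum.\<close>
  then have "f w \<le> f ((x + y) / 2)" if "w \<in> {x..y}" for w
    using p(2)[OF that] q(2)[of "(x + y) / 2"] xy(2) by simp
  then have "local_max_point a b f ((x + y) / 2)"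
    using xy(2) by (intro max) auto
  then show False using no xy unfolding X_def by auto
qed

text \<open>Any two non-exceptional points of a level set are separated by an exceptional one, so
  the number of exceptional points to the left distinguishes them and takes finitely many
  values.\<close>

lemma finite_level_set:
  fixes f :: "real \<Rightarrow> real"
  assumes "finite {x. local_max_point a b f x}" "finite {x. local_min_point a b f x}"
    "finite {x. discontinuity_point a b f x}"
  shows "finite {x\<in>{a..b}. f x = y}"
proof -
  define X where "X = {x. local_max_point a b f x} \<union> {x. local_min_point a b f x} \<union> {x. discontinuity_point a b f x}"
  define L where "L = {x\<in>{a..b}. f x = y} - X"
  have X: "finite X" unfolding X_def using assms by auto
  define g where "g x = card {z\<in>X. z \<le> x}" for x
  have "g u < g v" if uv: "u \<in> L" "v \<in> L" "u < v" for u v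
  proof -
    obtain z where z: "z \<in> X" "u \<le> z" "z \<le> v"
      using equal_values_separated[of a u v b f] uv unfolding L_def X_def[symmetric] by auto
    moreover have "u \<noteq> z" using uv(1) z(1) unfolding L_def by auto
    ultimately have "u < z" by simp
    have "{z\<in>X. z \<le> u} \<subset> {z\<in>X. z \<le> v}" using z \<open>u < z\<close> uv(3) by force
    then show ?thesis unfolding g_def using X by (intro psubset_card_mono) auto
  qed
  then have "inj_on g L" by (metis inj_onI linorder_neqE_linordered_idom order_less_irrefl)
  moreover have "g ` L \<subseteq> {..card X}" unfolding g_def using X by (auto intro!: card_mono)
  ultimately have "finite L" by (meson finite_atMost finite_imageD finite_subset)
  then show ?thesis unfolding L_def using X by (metis Diff_infinite_finite)
qed

text \<open>Continuity off a finite set supplies the measurability of the symbol, which the theorem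
  does not assume explicitly.\<close>

lemma borel_measurable_finite_discontinuities:
  fixes f :: "real \<Rightarrow> real"
  assumes "finite {x. discontinuity_point a b f x}"
  shows "f \<in> borel_measurable (lebesgue_on {a..b})"
proof -
  define D where "D = {x. discontinuity_point a b f x}"
  define g where "g x = (if x \<in> {a..b} - D then f x else 0)" for x
  have S: "{a..b} - D \<in> sets lebesgue"
    using assms unfolding D_def by (intro sets.Diff) (auto simp: finite_imp_closed)
  have "continuous_on ({a..b} - D) f"
    unfolding continuous_on_eq_continuous_within
  proof
    fix z assume z: "z \<in> {a..b} - D"
    then have "continuous (at z within {a..b}) f" unfolding discontinuity_point_def D_def by auto
    then show "continuous (at z within {a..b} - D) f" by (rule continuous_within_subset) auto
  qed
  then have "f \<in> borel_measurable (lebesgue_on ({a..b} - D))"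
    using S by (rule continuous_imp_measurable_on_sets_lebesgue)
  then have "g \<in> borel_measurable lebesgue"
    unfolding g_def using S by (subst borel_measurable_if) auto
  then have "g \<in> borel_measurable (lebesgue_on {a..b})" by (rule measurable_restrict_space1)
  then show ?thesis
  proof (rule measurable_discrete_difference)
    show "countable (D \<inter> {a..b})" using assms unfolding D_def by (auto intro: countable_finite)
    show "{x} \<in> sets (lebesgue_on {a..b})" if "x \<in> D \<inter> {a..b}" for x
      using that by (auto simp: sets_restrict_space_iff)
    show "g x = f x" if "x \<in> space (lebesgue_on {a..b})" "x \<notin> D \<inter> {a..b}" for x
      using that unfolding g_def by (auto simp: space_restrict_space)
  qed simp
qed

section \<open>Images of intervals have finite frontier\<close>

lemma finite_frontier_connected:
  fixes S :: "real set"
  assumes "connected S" "bounded S"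
  shows "finite (frontier S)"
proof (cases "S = {}")
  case False
  have bdd: "bdd_below S" "bdd_above S" using assms(2) bounded_imp_bdd_below bounded_imp_bdd_above by auto
  have "frontier S \<subseteq> {Inf S, Sup S}"
  proof
    fix x assume x: "x \<in> frontier S"
    have "S \<subseteq> {Inf S..Sup S}" using bdd by (auto intro: cInf_lower cSup_upper)
    then have "closure S \<subseteq> {Inf S..Sup S}" by (rule closure_minimal) simp
    then have "Inf S \<le> x" "x \<le> Sup S" using x unfolding frontier_def by auto
    moreover have "\<not> (Inf S < x \<and> x < Sup S)"
    proof
      assume "Inf S < x \<and> x < Sup S"
      then obtain s t where "s \<in> S" "t \<in> S" "s < x" "x < t"
        using cInf_less_iff[OF False bdd(1)] less_cSup_iff[OF False bdd(2)] by auto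
      moreover from this have "{s..t} \<subseteq> S" using assms(1) by (simp add: connected_contains_Icc)
      ultimately have "x \<in> interior S" by (intro interiorI[of "{s<..<t}"]) auto
      then show False using x unfolding frontier_def by simp
    qed
    ultimately show "x \<in> {Inf S, Sup S}" by auto
  qed
  then show ?thesis by (rule finite_subset) simp
qed simp

lemma finite_frontier_Un: "finite (frontier S) \<Longrightarrow> finite (frontier T) \<Longrightarrow> finite (frontier (S \<union> T))"
  using frontier_Un_subset[of S T] by (meson finite_UnI finite_subset)

lemma finite_frontier_finite: "finite S \<Longrightarrow> finite (frontier S)" for S :: "real set"
  by (meson finite_imp_closed finite_subset frontier_subset_closed)

text \<open>Cutting at a discontinuity leaves fewer discontinuities on either side; without any, the
  image is connected and bounded, so its frontier consists of at most two points.\<close>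

lemma finite_frontier_image_open_interval:
  fixes f :: "real \<Rightarrow> real"
  assumes D: "finite D" and f: "continuous_on ({u<..<v} - D) f" and bnd: "bounded (f ` {u<..<v})"
  shows "finite (frontier (f ` ({u<..<v} - D)))"
  using f bnd
proof (induction "card (D \<inter> {u<..<v})" arbitrary: u v rule: less_induct)
  case less
  show ?case
  proof (cases "D \<inter> {u<..<v} = {}")
    case True
    then have "{u<..<v} - D = {u<..<v}" by auto
    then show ?thesis using less.prems
      by (auto intro!: finite_frontier_connected connected_continuous_image)
  next
    case False
    then obtain d where d: "d \<in> D" "u < d" "d < v" by auto
    have "{u<..<v} - D = ({u<..<d} - D) \<union> ({d<..<v} - D)" using d by (auto simp: not_less le_less)
    then have *: "f ` ({u<..<v} - D) = f ` ({u<..<d} - D) \<union> f ` ({d<..<v} - D)" by (simp add: image_Un)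
    have "card (D \<inter> {u<..<d}) < card (D \<inter> {u<..<v})"
      using D d by (intro psubset_card_mono) auto
    then have 1: "finite (frontier (f ` ({u<..<d} - D)))"
      by (rule less.hyps) (use less.prems d in \<open>auto elim!: continuous_on_subset bounded_subset\<close>)
    have "card (D \<inter> {d<..<v}) < card (D \<inter> {u<..<v})"
      using D d by (intro psubset_card_mono) auto
    then have 2: "finite (frontier (f ` ({d<..<v} - D)))"
      by (rule less.hyps) (use less.prems d in \<open>auto elim!: continuous_on_subset bounded_subset\<close>)
    show ?thesis unfolding * using 1 2 by (rule finite_frontier_Un)
  qed
qed

lemma finite_frontier_image:
  fixes f :: "real \<Rightarrow> real"
  assumes "finite {x. discontinuity_point a b f x}" "bounded (f ` {a..b})" "a \<le> u" "v \<le> b"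
  shows "finite (frontier (f ` {u..v}))"
proof -
  define D where "D = {x. discontinuity_point a b f x}"
  have D: "finite D" unfolding D_def by fact
  have "continuous_on ({u<..<v} - D) f"
    unfolding continuous_on_eq_continuous_within
  proof
    fix z assume z: "z \<in> {u<..<v} - D"
    then have "continuous (at z within {a..b}) f" using assms unfolding discontinuity_point_def D_def by auto
    then show "continuous (at z within {u<..<v} - D) f"
      by (rule continuous_within_subset) (use assms in auto)
  qed
  moreover have "bounded (f ` {u<..<v})"
    using assms(2) by (rule bounded_subset) (use assms in auto)
  ultimately have 1: "finite (frontier (f ` ({u<..<v} - D)))"
    by (rule finite_frontier_image_open_interval[OF D])
  have 2: "f ` {u..v} = f ` ({u<..<v} - D) \<union> f ` ((D \<union> {u, v}) \<inter> {u..v})" by force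
  show ?thesis unfolding 2
    by (rule finite_frontier_Un[OF 1]) (use D in \<open>auto intro!: finite_frontier_finite\<close>)
qed

section \<open>Strict spectral bounds and reduction of Fourier to cosine coefficients\<close>

lemma finite_AE_leb0pi:
  assumes "finite X" shows "AE x in leb0pi. x \<notin> X"
proof -
  have "X \<inter> {0..pi} \<in> null_sets leb0pi"
    using assms by (subst null_sets_restrict_space) (auto intro!: finite_imp_null_set_lborel null_sets_completionI)
  then have "AE x in leb0pi. x \<notin> X \<inter> {0..pi}" by (rule AE_not_in)
  moreover have "AE x in leb0pi. x \<in> {0..pi}" by (rule AE_I2) (simp add: space_restrict_space)
  ultimately show ?thesis by eventually_elim auto
qed

lemma borel_finite_frontier:
  fixes C :: "real set"
  assumes "finite (frontier C)"
  shows "C \<in> sets borel"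
proof -
  have "C = interior C \<union> (C \<inter> frontier C)"
    using interior_subset[of C] closure_subset[of C] unfolding frontier_def by auto
  moreover have "C \<inter> frontier C \<in> sets borel" using assms by (intro borel_closed finite_imp_closed) auto
  ultimately show ?thesis by (metis borel_open open_interior sets.Un)
qed

text \<open>The Rayleigh quotient is a weighted mean of the symbol.\<close>

lemma toeplitz_eigenvalue_gt:
  fixes g :: "real \<Rightarrow> real"
  assumes g: "g \<in> borel_measurable leb0pi" "\<And>x. x \<in> {0..pi} \<Longrightarrow> \<bar>g x\<bar> \<le> K"
    and m: "\<And>x. x \<in> {0..pi} \<Longrightarrow> m \<le> g x" "finite {x\<in>{0..pi}. g x = m}"
    and v: "(\<Sum>i<n. (v i)\<^sup>2) = 1"
      "\<And>i. i < n \<Longrightarrow> (\<Sum>j<n. cos_coeff g (int i - int j) * v j) = lam * v i"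
  shows "m < lam"
proof -
  define h1 where "h1 x = (\<Sum>i<n. v i * cos (real i * x))" for x
  define h2 where "h2 x = (\<Sum>i<n. v i * sin (real i * x))" for x
  \<comment> \<open>The squared modulus of the trigonometric polynomial with coefficients
    \<open>v\<close>. Its integral over \<open>[0, pi]\<close> is \<open>pi\<close>, and its
    integral against \<open>g\<close> is \<open>pi * lam\<close>.\<close>
  define q where "q x = (h1 x)\<^sup>2 + (h2 x)\<^sup>2" for x
  have q: "q x = (\<Sum>i<n. \<Sum>j<n. v i * v j * cos (of_int (int i - int j) * x))" for x
    unfolding q_def h1_def h2_def power2_eq_square sum_product sum.distrib[symmetric]
    by (intro sum.cong refl) (simp add: left_diff_distrib cos_diff algebra_simps)
  have i1: "integrable leb0pi (\<lambda>x. cos (of_int k * x))" for k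
    by (intro integrable_continuous_0pi continuous_intros)
  have cm: "(\<lambda>x. cos (of_int k * x)) \<in> borel_measurable leb0pi" for k
    by (intro continuous_borel_measurable_leb0pi continuous_intros)
  have K: "K \<ge> 0" using g(2)[of 0] by simp
  have i2: "integrable leb0pi (\<lambda>x. g x * cos (of_int k * x))" for k
  proof (rule integrable_bounded_leb0pi[of _ K])
    show "(\<lambda>x. g x * cos (of_int k * x)) \<in> borel_measurable leb0pi" using g(1) cm by measurable
    fix x :: real assume "x \<in> {0..pi}"
    then have "\<bar>g x\<bar> * \<bar>cos (of_int k * x)\<bar> \<le> K * 1" using g(2) K by (intro mult_mono) auto
    then show "\<bar>g x * cos (of_int k * x)\<bar> \<le> K" by (simp add: abs_mult)
  qed
  have gq: "g x * q x = (\<Sum>i<n. \<Sum>j<n. v i * v j * (g x * cos (of_int (int i - int j) * x)))" for x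
    unfolding q by (simp add: sum_distrib_left mult_ac)
  have Iq: "integrable leb0pi q" "(LINT x|leb0pi. q x) = pi"
  proof -
    show "integrable leb0pi q" unfolding q
      by (intro Bochner_Integration.integrable_sum integrable_mult_right i1)
    have "(LINT x|leb0pi. q x) = (\<Sum>i<n. \<Sum>j<n. v i * v j * (LINT x|leb0pi. cos (of_int (int i - int j) * x)))"
      unfolding q using i1 by (simp add: Bochner_Integration.integral_sum del: of_int_diff)
    also have "\<dots> = (\<Sum>i<n. \<Sum>j<n. if j = i then (v i)\<^sup>2 * pi else 0)"
      unfolding integral_cos_0pi by (intro sum.cong refl) (auto simp: power2_eq_square)
    also have "\<dots> = pi" using v(1) by (simp flip: sum_distrib_right)
    finally show "(LINT x|leb0pi. q x) = pi" .
  qed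
  have Igq: "integrable leb0pi (\<lambda>x. g x * q x)" "(LINT x|leb0pi. g x * q x) = pi * lam"
  proof -
    show "integrable leb0pi (\<lambda>x. g x * q x)" unfolding gq
      by (intro Bochner_Integration.integrable_sum integrable_mult_right i2)
    have "(LINT x|leb0pi. g x * q x) = (\<Sum>i<n. \<Sum>j<n. v i * v j * (LINT x|leb0pi. g x * cos (of_int (int i - int j) * x)))"
      unfolding gq using i2 by (simp add: Bochner_Integration.integral_sum del: of_int_diff)
    also have "\<dots> = (\<Sum>i<n. pi * (v i * (\<Sum>j<n. cos_coeff g (int i - int j) * v j)))"
      unfolding cos_coeff_def by (simp add: sum_distrib_left mult_ac)
    also have "\<dots> = (\<Sum>i<n. pi * lam * (v i)\<^sup>2)"
      by (intro sum.cong refl) (simp add: v(2) power2_eq_square)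
    also have "\<dots> = pi * lam" using v(1) by (simp flip: sum_distrib_left)
    finally show "(LINT x|leb0pi. g x * q x) = pi * lam" .
  qed
  have q0: "0 \<le> q x" for x unfolding q_def by simp
  have eq: "(LINT x|leb0pi. (g x - m) * q x) = pi * (lam - m)"
    using Iq Igq by (simp add: left_diff_distrib right_diff_distrib)
  have int: "integrable leb0pi (\<lambda>x. (g x - m) * q x)"
    using Iq(1) Igq(1) by (simp add: left_diff_distrib)
  have ae: "AE x in leb0pi. 0 \<le> (g x - m) * q x"
    by (rule AE_I2) (use m(1) q0 in \<open>auto simp: space_restrict_space intro!: mult_nonneg_nonneg\<close>)
  \<comment> \<open>Equality would force \<open>q = 0\<close> almost everywhere, because
    \<open>g\<close> takes the value \<open>m\<close> only finitely often; this contradicts the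
    positive integral of \<open>q\<close>.\<close>
  have "(LINT x|leb0pi. (g x - m) * q x) \<noteq> 0"
  proof
    assume "(LINT x|leb0pi. (g x - m) * q x) = 0"
    then have "AE x in leb0pi. (g x - m) * q x = 0"
      using integral_nonneg_eq_0_iff_AE[OF int ae] by simp
    moreover have "AE x in leb0pi. x \<notin> {x\<in>{0..pi}. g x = m}" using m(2) by (rule finite_AE_leb0pi)
    moreover have "AE x in leb0pi. x \<in> {0..pi}" by (rule AE_I2) (simp add: space_restrict_space)
    ultimately have "AE x in leb0pi. q x = 0" by eventually_elim auto
    then have "(LINT x|leb0pi. q x) = 0" using integral_nonneg_eq_0_iff_AE[OF Iq(1)] q0 by simp
    then show False using Iq(2) by simp
  qed
  moreover have "0 \<le> (LINT x|leb0pi. (g x - m) * q x)" using ae by (rule integral_nonneg_AE)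
  ultimately have "0 < pi * (lam - m)" unfolding eq[symmetric] by linarith
  then show ?thesis by (simp add: zero_less_mult_iff)
qed

lemma toeplitz_eigenvalue_less:
  fixes g :: "real \<Rightarrow> real"
  assumes g: "g \<in> borel_measurable leb0pi" "\<And>x. x \<in> {0..pi} \<Longrightarrow> \<bar>g x\<bar> \<le> K"
    and m: "\<And>x. x \<in> {0..pi} \<Longrightarrow> g x \<le> m" "finite {x\<in>{0..pi}. g x = m}"
    and v: "(\<Sum>i<n. (v i)\<^sup>2) = 1"
      "\<And>i. i < n \<Longrightarrow> (\<Sum>j<n. cos_coeff g (int i - int j) * v j) = lam * v i"
  shows "lam < m"
proof -
  have c: "cos_coeff (\<lambda>x. - g x) k = - cos_coeff g k" for k
    unfolding cos_coeff_def by simp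
  have "{x\<in>{0..pi}. - g x = - m} = {x\<in>{0..pi}. g x = m}" by auto
  then have fin: "finite {x\<in>{0..pi}. - g x = - m}" using m(2) by simp
  have "- m < - lam"
    by (rule toeplitz_eigenvalue_gt[where g = "\<lambda>x. - g x" and K = K and n = n and v = v])
      (use g m v fin in \<open>simp_all add: c sum_negf\<close>)
  then show ?thesis by simp
qed

text \<open>Folding the integral at 0 pairs the two exponentials into
  \<open>2 * cos (k * x)\<close>, and the 2 cancels against the normalization
  \<open>1 / (2 * pi)\<close>.\<close>

lemma fourier_coeff_even:
  fixes f :: "real \<Rightarrow> real"
  assumes even: "\<forall>x\<in>{-pi..pi}. f (- x) = f x"
    and f: "f \<in> borel_measurable (lebesgue_on {-pi..pi})" "bounded (f ` {-pi..pi})"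
  shows "fourier_coeff (\<lambda>x. complex_of_real (f x)) k = complex_of_real (cos_coeff f k)"
proof -
  define G where "G x = complex_of_real (f x) * exp (- (\<i> * of_int k * complex_of_real x))" for x
  obtain K where "\<forall>x\<in>{-pi..pi}. \<bar>f x\<bar> \<le> K"
    using f(2) unfolding bounded_iff by auto
  then have K: "\<And>x. x \<in> {-pi..pi} \<Longrightarrow> \<bar>f x\<bar> \<le> K" by blast
  have em: "(\<lambda>x. exp (- (\<i> * of_int k * complex_of_real x))) \<in> borel_measurable (lebesgue_on {-pi..pi})"
    by (intro continuous_imp_measurable_on_sets_lebesgue continuous_intros) auto
  have "finite_measure (lebesgue_on {-pi..pi})"
    by (intro finite_measureI) (simp add: emeasure_restrict_space space_restrict_space)
  then have "integrable (lebesgue_on {-pi..pi}) G"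
  proof (rule finite_measure.integrable_const_bound)
    show "AE x in lebesgue_on {-pi..pi}. norm (G x) \<le> K"
      by (rule AE_I2) (use K in \<open>auto simp: G_def space_restrict_space norm_mult norm_exp_eq_Re\<close>)
    show "G \<in> borel_measurable (lebesgue_on {-pi..pi})"
      unfolding G_def using f(1) em by measurable
  qed
  then have int: "set_integrable lebesgue {-pi..pi} G"
    by (simp add: set_integrable_def integrable_restrict_space)
  have HK: "G integrable_on {-pi..pi}"
    using int by (rule set_lebesgue_integral_eq_integral(1))
  have HKp: "G integrable_on {0..pi}" "G integrable_on {-pi..0}"
    using HK by (auto elim!: integrable_on_subinterval)
  have HKm: "(\<lambda>x. G (- x)) integrable_on {0..pi}"
    using HKp(2) Henstock_Kurzweil_Integration.integrable_reflect_real[of G 0 "-pi"] by simp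
  have "(LINT x:{-pi..pi}|lebesgue. G x) = integral {-pi..pi} G"
    using int by (rule set_lebesgue_integral_eq_integral(2))
  also have "\<dots> = integral {-pi..0} G + integral {0..pi} G"
    by (rule Henstock_Kurzweil_Integration.integral_combine[symmetric]) (use HK in auto)
  also have "integral {-pi..0} G = integral {0..pi} (\<lambda>x. G (- x))"
    using Henstock_Kurzweil_Integration.integral_reflect_real[of 0 "-pi" G] by simp
  also have "integral {0..pi} (\<lambda>x. G (- x)) + integral {0..pi} G = integral {0..pi} (\<lambda>x. G (- x) + G x)"
    using HKp HKm by (simp add: Henstock_Kurzweil_Integration.integral_add)
  also have "\<dots> = integral {0..pi} (\<lambda>x. complex_of_real (2 * (f x * cos (of_int k * x))))"
  proof (rule Henstock_Kurzweil_Integration.integral_cong)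
    fix x assume "x \<in> {0..pi}"
    then have "f (- x) = f x" using even by auto
    moreover have "exp (\<i> * (of_int k * complex_of_real x)) + exp (- (\<i> * (of_int k * complex_of_real x)))
        = 2 * complex_of_real (cos (of_int k * x))"
      by (simp add: cos_of_real[symmetric] cos_exp_eq)
    ultimately show "G (- x) + G x = complex_of_real (2 * (f x * cos (of_int k * x)))"
      unfolding G_def by (simp add: algebra_simps flip: distrib_left)
  qed
  also have "\<dots> = complex_of_real (2 * (pi * cos_coeff f k))"
  proof -
    have fm: "f \<in> borel_measurable leb0pi"
      using f(1) by (rule measurable_restrict_mono) auto
    have cm: "(\<lambda>x. cos (of_int k * x)) \<in> borel_measurable leb0pi"
      by (intro continuous_borel_measurable_leb0pi continuous_intros)
    have K0: "K \<ge> 0" using K[of 0] by simp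
    have i2: "integrable leb0pi (\<lambda>x. 2 * (f x * cos (of_int k * x)))"
    proof (rule integrable_bounded_leb0pi[of _ "2 * K"])
      show "(\<lambda>x. 2 * (f x * cos (of_int k * x))) \<in> borel_measurable leb0pi" using fm cm by measurable
      fix x :: real assume "x \<in> {0..pi}"
      then have "\<bar>f x\<bar> * \<bar>cos (of_int k * x)\<bar> \<le> K * 1" using K K0 by (intro mult_mono) auto
      then show "\<bar>2 * (f x * cos (of_int k * x))\<bar> \<le> 2 * K" by (simp add: abs_mult)
    qed
    then have H: "(\<lambda>x. 2 * (f x * cos (of_int k * x))) integrable_on {0..pi}"
      by (rule integrable_on_lebesgue_on) simp
    have "integral {0..pi} (\<lambda>x. complex_of_real (2 * (f x * cos (of_int k * x))))
        = complex_of_real (integral {0..pi} (\<lambda>x. 2 * (f x * cos (of_int k * x))))"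
      using integral_linear[OF H bounded_linear_of_real] by (simp only: o_def)
    also have "integral {0..pi} (\<lambda>x. 2 * (f x * cos (of_int k * x))) = (LINT x|leb0pi. 2 * (f x * cos (of_int k * x)))"
      using i2 by (subst lebesgue_integral_eq_integral) auto
    finally show ?thesis unfolding cos_coeff_def by simp
  qed
  finally show ?thesis unfolding fourier_coeff_def G_def by simp
qed

section \<open>Asymptotic eigenvalue distribution\<close>

abbreviation parity_class :: "nat \<Rightarrow> nat \<Rightarrow> nat set" where
  "parity_class n e \<equiv> {k. k < n \<and> k mod 2 = e}"

lemma parity_class_bij:
  assumes "e \<le> 1"
  shows parity_class_image: "bij_betw (\<lambda>r. 2 * r + e) {..<(n + 1 - e) div 2} (parity_class n e)"
    and parity_class_div: "bij_betw (\<lambda>k. k div 2) (parity_class n e) {..<(n + 1 - e) div 2}"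
proof -
  have 1: "(\<lambda>r. 2 * r + e) ` {..<(n + 1 - e) div 2} \<subseteq> parity_class n e"
    and 2: "(\<lambda>k. k div 2) ` parity_class n e \<subseteq> {..<(n + 1 - e) div 2}"
    using assms by (auto simp: le_Suc_eq) presburger
  have 3: "\<forall>k\<in>parity_class n e. 2 * (k div 2) + e = k"
    and 4: "\<forall>r\<in>{..<(n + 1 - e) div 2}. (2 * r + e) div 2 = r"
    using assms by auto
  show "bij_betw (\<lambda>r. 2 * r + e) {..<(n + 1 - e) div 2} (parity_class n e)"
    using 4 3 1 2 by (rule bij_betw_byWitness)
  show "bij_betw (\<lambda>k. k div 2) (parity_class n e) {..<(n + 1 - e) div 2}"
    using 3 4 2 1 by (rule bij_betw_byWitness)
qed

lemma card_parity_class: "e \<le> 1 \<Longrightarrow> card (parity_class n e) = (n + 1 - e) div 2"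
  using bij_betw_same_card[OF parity_class_image] by simp

text \<open>Every second point of the sine grid is compared with the left endpoint of a cell in the
  uniform division into \<open>N = (n + 1 - e) div 2\<close> cells. As
  \<open>2 * N \<le> n + 1 \<le> 2 * N + 2\<close>, they differ by at most one cell width. The
  estimate serves both the Riemann sums and the final interlacing.\<close>

lemma parity_grid_close:
  assumes e: "e \<le> 1" and r: "r < (n + 1 - e) div 2"
  shows "\<bar>real (2 * r + e + 1) * (pi / (real n + 1)) - real r * pi / real ((n + 1 - e) div 2)\<bar>
    \<le> pi / real ((n + 1 - e) div 2)"
proof -
  define N where "N = (n + 1 - e) div 2"
  have N: "N > 0" "r < N" using r unfolding N_def by auto
  have Nn: "2 * N \<le> n + 1" "n + 1 \<le> 2 * N + 2" using e unfolding N_def by auto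
  define u where "u r = real r * pi / real N" for r
  define t where "t r = real (2 * r + e + 1) * (pi / (real n + 1))" for r
  have Nn': "2 * real N \<le> real n + 1" "real n + 1 \<le> 2 * real N + 2" using Nn by linarith+
  have e': "real e \<le> 1" using e by simp
  have "t r \<le> u (Suc r)"
  proof -
    have "real (2 * r + e + 1) * real N \<le> real (r + 1) * (2 * real N)"
    proof -
      have "real (2 * r + e + 1) \<le> 2 * real (r + 1)" using e' by simp
      then have "real (2 * r + e + 1) * real N \<le> 2 * real (r + 1) * real N" by (rule mult_right_mono) simp
      then show ?thesis by (simp add: mult_ac)
    qed
    also have "\<dots> \<le> real (r + 1) * (real n + 1)" using Nn' by (intro mult_left_mono) auto
    finally have "real (2 * r + e + 1) / (real n + 1) \<le> real (r + 1) / real N"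
      using N by (simp add: divide_le_eq le_divide_eq)
    then have "real (2 * r + e + 1) / (real n + 1) * pi \<le> real (r + 1) / real N * pi"
      by (rule mult_right_mono) simp
    then show ?thesis unfolding t_def u_def
      by (simp only: times_divide_eq_right times_divide_eq_left Suc_eq_plus1)
  qed
  moreover have "u r - pi / real N \<le> t r"
  proof -
    have "(real r - 1) / real N \<le> real (2 * r + e + 1) / (real n + 1)"
    proof (cases "r = 0")
      case False
      then have "(real r - 1) * (real n + 1) \<le> (real r - 1) * (2 * real N + 2)"
        using Nn' by (intro mult_left_mono) auto
      also have "\<dots> \<le> (2 * real r) * real N"
        using N(2) by (simp add: algebra_simps)
      also have "\<dots> \<le> real (2 * r + e + 1) * real N" by (intro mult_right_mono) auto
      finally show ?thesis using N by (simp add: divide_le_eq le_divide_eq)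
    qed (auto intro: order_trans[of _ 0] divide_nonneg_nonneg)
    then have "(real r - 1) / real N * pi \<le> real (2 * r + e + 1) / (real n + 1) * pi"
      by (rule mult_right_mono) simp
    moreover have "u r - pi / real N = (real r - 1) / real N * pi"
      unfolding u_def by (simp add: left_diff_distrib diff_divide_distrib)
    ultimately show ?thesis unfolding t_def
      by (simp only: times_divide_eq_right times_divide_eq_left)
  qed
  moreover have "u (Suc r) = u r + pi / real N"
    unfolding u_def by (simp add: distrib_right add_divide_distrib)
  ultimately show ?thesis unfolding t_def[symmetric] N_def[symmetric] u_def[symmetric] by (simp add: abs_le_iff)
qed

text \<open>Each parity class alone samples \<open>[0, pi]\<close> uniformly, so it already yields
  the full mean of \<open>h\<close>.\<close>

lemma riemann_sum_dst_grid:
  fixes h :: "real \<Rightarrow> real"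
  assumes h: "continuous_on {0..pi} h" and e: "e \<le> 1"
  shows "(\<lambda>n. (\<Sum>j\<in>parity_class n e. h (real (j + 1) * (pi / (real n + 1)))) / card (parity_class n e))
    \<longlonglongrightarrow> (LINT x|leb0pi. h x) / pi"
proof (rule LIMSEQ_I)
  fix \<epsilon> :: real assume eps: "\<epsilon> > 0"
  obtain F where F: "\<And>x. x \<in> {0..pi} \<Longrightarrow> (F has_vector_derivative h x) (at x within {0..pi})"
    using antiderivative_continuous[OF h] by blast
  have "(h has_integral (F pi - F 0)) {0..pi}"
    by (rule fundamental_theorem_of_calculus) (use F in auto)
  then have I: "(LINT x|leb0pi. h x) = F pi - F 0"
    using lebesgue_integral_eq_integral[OF integrable_continuous_0pi[OF h]] by (simp add: integral_unique)
  have "uniformly_continuous_on {0..pi} h" using h by (intro compact_uniformly_continuous) auto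
  then obtain d where d: "d > 0" "\<And>x y. x \<in> {0..pi} \<Longrightarrow> y \<in> {0..pi} \<Longrightarrow> \<bar>x - y\<bar> < d \<Longrightarrow> \<bar>h x - h y\<bar> < \<epsilon> / 2"
  proof -
    from \<open>uniformly_continuous_on {0..pi} h\<close> obtain d where
      d: "d > 0" "\<forall>x\<in>{0..pi}. \<forall>y\<in>{0..pi}. dist y x < d \<longrightarrow> dist (h y) (h x) < \<epsilon> / 2"
      unfolding uniformly_continuous_on_def using half_gt_zero[OF eps] by blast
    show thesis by (rule that[OF d(1)]) (use d(2) in \<open>simp add: dist_real_def\<close>)
  qed
  \<comment> \<open>A sample and the comparison point of the same cell are at most two cell widths
    \<open>pi / N\<close> apart; \<open>N \<ge> M\<close> makes this less than
    \<open>d\<close>.\<close>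
  obtain M :: nat where M: "real M > 2 * pi / d" using reals_Archimedean2 by blast
  have "norm ((\<Sum>j\<in>parity_class n e. h (real (j + 1) * (pi / (real n + 1)))) / card (parity_class n e)
      - (LINT x|leb0pi. h x) / pi) < \<epsilon>" if n: "n \<ge> 2 * M + 2" for n
  proof -
    define N where "N = (n + 1 - e) div 2"
    have N: "N \<ge> M" "N > 0" using n e unfolding N_def by auto
    define u where "u r = real r * pi / real N" for r
    have u: "u r < u (Suc r)" "u (Suc r) - u r = pi / real N" for r
      using N by (auto simp: u_def field_simps)
    have u01: "0 \<le> u r" "u (Suc r) \<le> pi" if "r < N" for r
    proof -
      show "0 \<le> u r" by (simp add: u_def)
      have "real (Suc r) * pi \<le> real N * pi" using that by (intro mult_right_mono) auto
      then show "u (Suc r) \<le> pi" using N unfolding u_def by (simp add: field_simps)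
    qed
    \<comment> \<open>The mean value theorem for the antiderivative yields tags whose Riemann sum
      equals the integral exactly, so only samples and tags remain to be compared.\<close>
    have "\<exists>\<xi>. u r < \<xi> \<and> \<xi> < u (Suc r) \<and> F (u (Suc r)) - F (u r) = pi / real N * h \<xi>" if "r < N" for r
    proof -
      have "\<exists>x\<in>{u r<..<u (Suc r)}. F (u (Suc r)) - F (u r) = (\<lambda>t. t *\<^sub>R h x) (u (Suc r) - u r)"
      proof (rule mvt_simple[OF u(1)])
        fix x assume "u r \<le> x" "x \<le> u (Suc r)"
        then have x: "x \<in> {0..pi}" using u01[OF that] by auto
        show "(F has_derivative (\<lambda>t. t *\<^sub>R h x)) (at x within {u r..u (Suc r)})"
          using F[OF x] unfolding has_vector_derivative_def
          by (rule has_derivative_subset) (use u01[OF that] in auto)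
      qed
      then show ?thesis unfolding u(2) by auto
    qed
    then obtain \<xi> where xi: "\<And>r. r < N \<Longrightarrow> u r < \<xi> r" "\<And>r. r < N \<Longrightarrow> \<xi> r < u (Suc r)"
      "\<And>r. r < N \<Longrightarrow> F (u (Suc r)) - F (u r) = pi / real N * h (\<xi> r)" by metis
    have "F pi - F 0 = F (u N) - F (u 0)" using N by (simp add: u_def)
    also have "\<dots> = (\<Sum>r<N. F (u (Suc r)) - F (u r))" by (rule sum_lessThan_telescope[symmetric])
    also have "\<dots> = (\<Sum>r<N. pi / real N * h (\<xi> r))" by (intro sum.cong refl) (simp add: xi(3))
    also have "\<dots> = pi / real N * (\<Sum>r<N. h (\<xi> r))" by (rule sum_distrib_left[symmetric])
    finally have J: "(LINT x|leb0pi. h x) / pi = (\<Sum>r<N. h (\<xi> r)) / real N" unfolding I by simp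
    define t where "t r = real (2 * r + e + 1) * (pi / (real n + 1))" for r
    have S: "(\<Sum>j\<in>parity_class n e. h (real (j + 1) * (pi / (real n + 1)))) = (\<Sum>r<N. h (t r))"
      using sum.reindex_bij_betw[OF parity_class_image[OF e, of n],
        of "\<lambda>j. h (real (j + 1) * (pi / (real n + 1)))"] unfolding N_def t_def by simp
    have close: "\<bar>h (t r) - h (\<xi> r)\<bar> < \<epsilon> / 2" if r: "r < N" for r
    proof (rule d(2))
      have tu: "\<bar>t r - u r\<bar> \<le> pi / real N"
        using parity_grid_close[OF e, of r n] r unfolding t_def u_def N_def by simp
      then have "\<bar>t r - \<xi> r\<bar> \<le> 2 * (pi / real N)"
        using xi(1,2)[OF r] u(2)[of r] by (simp add: abs_le_iff)
      also have "\<dots> < d"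
      proof -
        have "2 * pi / d < real N" using M N by linarith
        then show ?thesis using d(1) N by (simp add: field_simps)
      qed
      finally show "\<bar>t r - \<xi> r\<bar> < d" .
      show "\<xi> r \<in> {0..pi}" using xi(1,2)[OF r] u01[OF r] by auto
      show "t r \<in> {0..pi}"
        using tu u(2)[of r] u01[OF r] by (auto simp: t_def abs_le_iff)
    qed
    have "(\<Sum>r<N. h (t r)) / real N - (\<Sum>r<N. h (\<xi> r)) / real N = (\<Sum>r<N. h (t r) - h (\<xi> r)) / real N"
      by (simp add: sum_subtractf diff_divide_distrib)
    moreover have "\<bar>\<Sum>r<N. h (t r) - h (\<xi> r)\<bar> \<le> (\<Sum>r<N. \<epsilon> / 2)"
      using close by (intro order_trans[OF sum_abs] sum_mono) (auto intro: less_imp_le)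
    ultimately have "\<bar>(\<Sum>r<N. h (t r)) / real N - (\<Sum>r<N. h (\<xi> r)) / real N\<bar> \<le> \<epsilon> / 2"
      using N by (simp add: field_simps)
    then show ?thesis unfolding S J card_parity_class[OF e] N_def[symmetric] using eps by simp
  qed
  then show "\<exists>no. \<forall>n\<ge>no. norm ((\<Sum>j\<in>parity_class n e. h (real (j + 1) * (pi / (real n + 1)))) / card (parity_class n e)
      - (LINT x|leb0pi. h x) / pi) < \<epsilon>" by blast
qed

text \<open>Measurability provides continuous functions converging to \<open>f\<close> almost
  everywhere; one of them is close in mean square, and it is then approximated uniformly by a cosine
  polynomial.\<close>

lemma cos_poly_L2_dense:
  fixes f :: "real \<Rightarrow> real"
  assumes f: "f \<in> borel_measurable leb0pi" "\<And>x. x \<in> {0..pi} \<Longrightarrow> \<bar>f x\<bar> \<le> K" and e: "e > 0"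
  obtains d a where "(LINT x|leb0pi. (f x - cos_poly d a x)\<^sup>2) < e"
proof -
  have K: "K \<ge> 0" using f(2)[of 0] by simp
  have "f measurable_on {0..pi}" using f(1) by (subst measurable_on_iff_borel_measurable) auto
  then obtain N g where N: "negligible N" and gc: "\<And>n. continuous_on UNIV (g n)"
    and gl: "\<And>x. x \<notin> N \<Longrightarrow> (\<lambda>n. g n x) \<longlonglongrightarrow> (if x \<in> {0..pi} then f x else 0)"
    unfolding measurable_on_def by blast
  \<comment> \<open>Truncation at the bound of \<open>f\<close> keeps the limit and provides a
    dominating constant.\<close>
  define h where "h n x = max (-K) (min K (g n x))" for n :: nat and x
  have hc: "continuous_on UNIV (h n)" for n unfolding h_def by (intro continuous_intros gc)
  have hK: "\<bar>h n x\<bar> \<le> K" for n x unfolding h_def using K by auto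
  have NA: "AE x in leb0pi. x \<notin> N"
  proof -
    have "N \<inter> {0..pi} \<in> null_sets leb0pi"
      using N by (subst null_sets_restrict_space) (auto simp: negligible_iff_null_sets[symmetric] intro: negligible_subset)
    then have "AE x in leb0pi. x \<notin> N \<inter> {0..pi}" by (rule AE_not_in)
    moreover have "AE x in leb0pi. x \<in> {0..pi}" by (rule AE_I2) (simp add: space_restrict_space)
    ultimately show ?thesis by eventually_elim auto
  qed
  have hm: "h n \<in> borel_measurable leb0pi" for n
    using hc by (rule continuous_borel_measurable_leb0pi)
  have "(\<lambda>n. LINT x|leb0pi. (f x - h n x)\<^sup>2) \<longlonglongrightarrow> (LINT x|leb0pi. 0)"
  proof (rule integral_dominated_convergence[where w = "\<lambda>_. (2 * K)\<^sup>2"])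
    show "AE x in leb0pi. (\<lambda>n. (f x - h n x)\<^sup>2) \<longlonglongrightarrow> 0"
      using NA AE_space
    proof eventually_elim
      case (elim x)
      then have x: "x \<in> {0..pi}" by (simp add: space_restrict_space)
      have "(\<lambda>n. h n x) \<longlonglongrightarrow> max (-K) (min K (f x))"
        unfolding h_def using gl[OF elim(1)] x by (intro tendsto_intros) auto
      moreover have "max (-K) (min K (f x)) = f x" using f(2)[OF x] by auto
      ultimately have "(\<lambda>n. (f x - h n x)\<^sup>2) \<longlonglongrightarrow> (f x - f x)\<^sup>2" by (intro tendsto_intros) simp
      then show ?case by simp
    qed
    show "AE x in leb0pi. norm ((f x - h n x)\<^sup>2) \<le> (2 * K)\<^sup>2" for n
      using AE_space
    proof eventually_elim
      case (elim x)
      then have "x \<in> {0..pi}" by (simp add: space_restrict_space)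
      then have "\<bar>f x - h n x\<bar> \<le> 2 * K" using f(2)[of x] hK[of n x] by linarith
      then show ?case using power_mono[of "\<bar>f x - h n x\<bar>" "2 * K" 2] by simp
    qed
    show "integrable leb0pi (\<lambda>_. (2 * K)\<^sup>2)" by (rule integrable_bounded_leb0pi) auto
  qed (use f(1) hm in measurable)
  then have "(\<lambda>n. LINT x|leb0pi. (f x - h n x)\<^sup>2) \<longlonglongrightarrow> 0" by simp
  then have "eventually (\<lambda>n. (LINT x|leb0pi. (f x - h n x)\<^sup>2) < e / 4) sequentially"
    by (rule order_tendstoD) (use e in simp)
  then obtain n where n: "(LINT x|leb0pi. (f x - h n x)\<^sup>2) < e / 4"
    by (auto simp: eventually_sequentially)
  \<comment> \<open>Chosen so that \<open>2 * r\<^sup>2 * pi = e / 4\<close>; squaring the sum of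
    the two errors doubles both, and \<open>2 * (e / 4) + e / 4\<close> stays below
    \<open>e\<close>.\<close>
  define r where "r = sqrt (e / 8 / pi)"
  have r: "r > 0" "r\<^sup>2 = e / 8 / pi" unfolding r_def using e by auto
  obtain d a where da: "\<And>x. x \<in> {0..pi} \<Longrightarrow> \<bar>h n x - cos_poly d a x\<bar> < r"
    using cos_poly_dense[of "h n" r] hc[of n] r(1) by (metis continuous_on_subset top_greatest)
  have pc: "cos_poly d a \<in> borel_measurable leb0pi"
    by (intro continuous_borel_measurable_leb0pi continuous_intros)
  have i1: "integrable leb0pi (\<lambda>x. 2 * (f x - h n x)\<^sup>2 + 2 * r\<^sup>2)"
  proof (rule integrable_bounded_leb0pi[where K = "2 * (2 * K)\<^sup>2 + 2 * r\<^sup>2"])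
    show "(\<lambda>x. 2 * (f x - h n x)\<^sup>2 + 2 * r\<^sup>2) \<in> borel_measurable leb0pi" using f(1) hm by measurable
    fix x assume "x \<in> {0..pi}"
    then have "\<bar>f x - h n x\<bar> \<le> 2 * K" using f(2)[of x] hK[of n x] by linarith
    then show "\<bar>2 * (f x - h n x)\<^sup>2 + 2 * r\<^sup>2\<bar> \<le> 2 * (2 * K)\<^sup>2 + 2 * r\<^sup>2"
      using power_mono[of "\<bar>f x - h n x\<bar>" "2 * K" 2] by simp
  qed
  have "(LINT x|leb0pi. (f x - cos_poly d a x)\<^sup>2) \<le> (LINT x|leb0pi. 2 * (f x - h n x)\<^sup>2 + 2 * r\<^sup>2)"
  proof (rule integral_mono'[OF i1])
    fix x assume "x \<in> space leb0pi"
    then have x: "x \<in> {0..pi}" by (simp add: space_restrict_space)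
    have "(f x - cos_poly d a x)\<^sup>2 \<le> 2 * (f x - h n x)\<^sup>2 + 2 * (h n x - cos_poly d a x)\<^sup>2"
      using sum_squares_bound[of "f x - h n x" "h n x - cos_poly d a x"]
      by (simp add: power2_eq_square algebra_simps)
    moreover have "(h n x - cos_poly d a x)\<^sup>2 \<le> r\<^sup>2"
      using power_mono[of "\<bar>h n x - cos_poly d a x\<bar>" r 2] da[OF x] by simp
    ultimately show "(f x - cos_poly d a x)\<^sup>2 \<le> 2 * (f x - h n x)\<^sup>2 + 2 * r\<^sup>2" by linarith
  qed simp
  also have "\<dots> = 2 * (LINT x|leb0pi. (f x - h n x)\<^sup>2) + 2 * r\<^sup>2 * pi"
  proof -
    have "integrable leb0pi (\<lambda>x. (f x - h n x)\<^sup>2)"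
    proof (rule integrable_bounded_leb0pi[where K = "(2 * K)\<^sup>2"])
      show "(\<lambda>x. (f x - h n x)\<^sup>2) \<in> borel_measurable leb0pi" using f(1) hm by measurable
      fix x assume "x \<in> {0..pi}"
      then have "\<bar>f x - h n x\<bar> \<le> 2 * K" using f(2)[of x] hK[of n x] by linarith
      then show "\<bar>(f x - h n x)\<^sup>2\<bar> \<le> (2 * K)\<^sup>2"
        using power_mono[of "\<bar>f x - h n x\<bar>" "2 * K" 2] by simp
    qed
    moreover have "integrable leb0pi (\<lambda>x. 2 * r\<^sup>2)" by (rule integrable_bounded_leb0pi) auto
    ultimately show ?thesis by (simp add: measure_restrict_space)
  qed
  also have "2 * r\<^sup>2 * pi = e / 4" unfolding r(2) by simp
  also have "2 * (LINT x|leb0pi. (f x - h n x)\<^sup>2) + e / 4 < e" using n e by linarith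
  finally show thesis by (rule that)
qed

lemma cos_coeff_diff:
  fixes f g :: "real \<Rightarrow> real"
  assumes f: "f \<in> borel_measurable leb0pi" "\<And>x. x \<in> {0..pi} \<Longrightarrow> \<bar>f x\<bar> \<le> K"
    and g: "g \<in> borel_measurable leb0pi" "\<And>x. x \<in> {0..pi} \<Longrightarrow> \<bar>g x\<bar> \<le> K'"
  shows "cos_coeff (\<lambda>x. f x - g x) k = cos_coeff f k - cos_coeff g k"
proof -
  have i: "integrable leb0pi (\<lambda>x. h x * cos (of_int k * x))"
    if h: "h \<in> borel_measurable leb0pi" "\<And>x. x \<in> {0..pi} \<Longrightarrow> \<bar>h x\<bar> \<le> B" for h :: "real \<Rightarrow> real" and B
  proof (rule integrable_bounded_leb0pi[of _ B])
    have "(\<lambda>x. cos (of_int k * x)) \<in> borel_measurable leb0pi"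
      by (intro continuous_borel_measurable_leb0pi continuous_intros)
    then show "(\<lambda>x. h x * cos (of_int k * x)) \<in> borel_measurable leb0pi" using h(1) by measurable
    fix x :: real assume "x \<in> {0..pi}"
    then have "\<bar>h x\<bar> * \<bar>cos (of_int k * x)\<bar> \<le> B * 1" using h(2)[of x] by (intro mult_mono) auto
    then show "\<bar>h x * cos (of_int k * x)\<bar> \<le> B" by (simp add: abs_mult)
  qed
  show ?thesis unfolding cos_coeff_def left_diff_distrib
    using i[OF f] i[OF g] by (simp add: diff_divide_distrib)
qed

text \<open>Split \<open>f\<close> into \<open>f - p\<close> and the cosine polynomial
  \<open>p\<close>. The first part contributes the Frobenius norm of its Toeplitz matrix, unchanged
  by the orthogonal sine transform, and the second only the corner term.\<close>

lemma sum_dst_residual_le: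
  fixes f :: "real \<Rightarrow> real"
  assumes f: "f \<in> borel_measurable leb0pi" "\<And>x. x \<in> {0..pi} \<Longrightarrow> \<bar>f x\<bar> \<le> K"
  shows "(\<Sum>j<n. \<Sum>i<n. ((\<Sum>b<n. cos_coeff f (int i - int b) * dst n b j)
      - cos_poly d a (real (j + 1) * (pi / (real n + 1))) * dst n i j)\<^sup>2)
    \<le> 2 * (real n * ((LINT x|leb0pi. (f x - cos_poly d a x)\<^sup>2) / pi)) + 8 * real d * (\<Sum>m\<le>d. \<bar>a m\<bar>)\<^sup>2"
proof -
  let ?p = "cos_poly d a"
  define A where "A = (\<Sum>m\<le>d. \<bar>a m\<bar>)"
  have pA: "\<bar>?p x\<bar> \<le> A" for x
    unfolding cos_poly_def A_def
    by (rule order_trans[OF sum_abs]) (intro sum_mono, simp add: abs_mult mult_left_le)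
  have pm: "?p \<in> borel_measurable leb0pi"
    by (intro continuous_borel_measurable_leb0pi continuous_intros)
  have c: "cos_coeff f k = cos_coeff (\<lambda>x. f x - ?p x) k + cos_coeff ?p k" for k
    using cos_coeff_diff[OF f pm pA] by simp
  define X where "X i j = (\<Sum>b<n. cos_coeff (\<lambda>x. f x - ?p x) (int i - int b) * dst n b j)" for i j
  define Y where "Y i j = (\<Sum>b<n. cos_coeff ?p (int i - int b) * dst n b j)
      - ?p (real (j + 1) * (pi / (real n + 1))) * dst n i j" for i j
  have "(\<Sum>j<n. \<Sum>i<n. ((\<Sum>b<n. cos_coeff f (int i - int b) * dst n b j)
      - ?p (real (j + 1) * (pi / (real n + 1))) * dst n i j)\<^sup>2) = (\<Sum>j<n. \<Sum>i<n. (X i j + Y i j)\<^sup>2)"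
    unfolding c X_def Y_def by (simp only: distrib_right sum.distrib add_diff_eq)
  also have "\<dots> \<le> (\<Sum>j<n. \<Sum>i<n. 2 * (X i j)\<^sup>2 + 2 * (Y i j)\<^sup>2)"
  proof (intro sum_mono)
    fix i j show "(X i j + Y i j)\<^sup>2 \<le> 2 * (X i j)\<^sup>2 + 2 * (Y i j)\<^sup>2"
      using sum_squares_bound[of "X i j" "Y i j"] by (simp add: power2_eq_square algebra_simps)
  qed
  also have "\<dots> = 2 * (\<Sum>j<n. \<Sum>i<n. (X i j)\<^sup>2) + 2 * (\<Sum>j<n. \<Sum>i<n. (Y i j)\<^sup>2)"
    by (simp add: sum.distrib sum_distrib_left)
  also have "(\<Sum>j<n. \<Sum>i<n. (X i j)\<^sup>2) = (\<Sum>i<n. \<Sum>j<n. (\<Sum>b<n. dst n b j * cos_coeff (\<lambda>x. f x - ?p x) (int i - int b))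
      * (\<Sum>b<n. dst n b j * cos_coeff (\<lambda>x. f x - ?p x) (int i - int b)))"
    unfolding X_def by (subst sum.swap) (simp add: power2_eq_square mult.commute)
  also have "\<dots> = (\<Sum>i<n. \<Sum>b<n. (cos_coeff (\<lambda>x. f x - ?p x) (int i - int b))\<^sup>2)"
    by (simp add: orthonormal_inner[of n "\<lambda>j b. dst n b j"] dst_orthonormal_rows power2_eq_square)
  also have "\<dots> \<le> real n * ((LINT x|leb0pi. (f x - ?p x)\<^sup>2) / pi)"
  proof (rule toeplitz_frobenius_le)
    show "(\<lambda>x. f x - ?p x) \<in> borel_measurable leb0pi" using f(1) pm by measurable
    show "\<bar>f x - ?p x\<bar> \<le> K + A" if "x \<in> {0..pi}" for x
      using f(2)[OF that] pA[of x] by linarith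
  qed
  also have "(\<Sum>j<n. \<Sum>i<n. (Y i j)\<^sup>2) \<le> 4 * real d * A\<^sup>2"
    unfolding Y_def A_def by (rule sum_dst_residual_cos_poly)
  finally show ?thesis unfolding A_def by simp
qed

text \<open>The squares \<open>(U n j k)\<^sup>2\<close> couple the eigenvalues with samples of a cosine polynomial on the
  sine-transform grid; they form doubly stochastic matrices that respect the parity classes. So a
  small weighted mean square distance suffices to compare Lipschitz averages.\<close>

lemma eigenvalue_averages:
  fixes f g :: "real \<Rightarrow> real" and U :: "nat \<Rightarrow> nat \<Rightarrow> nat \<Rightarrow> real" and l :: "nat \<Rightarrow> nat \<Rightarrow> real"
  assumes f: "f \<in> borel_measurable leb0pi" "\<And>x. x \<in> {0..pi} \<Longrightarrow> \<bar>f x\<bar> \<le> K"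
    and U1: "\<And>n j. j < n \<Longrightarrow> (\<Sum>k<n. (U n j k)\<^sup>2) = 1"
    and U2: "\<And>n k. k < n \<Longrightarrow> (\<Sum>j<n. (U n j k)\<^sup>2) = 1"
    and U3: "\<And>n j k. odd (j + k) \<Longrightarrow> U n j k = 0"
    and U4: "\<And>n q. (\<Sum>j<n. \<Sum>k<n. (U n j k)\<^sup>2 * (l n k - q j)\<^sup>2) =
      (\<Sum>j<n. \<Sum>i<n. ((\<Sum>b<n. cos_coeff f (int i - int b) * dst n b j) - q j * dst n i j)\<^sup>2)"
    and g: "\<And>y z. \<bar>g y - g z\<bar> \<le> L * \<bar>y - z\<bar>" and e: "e \<le> 1"
  shows "(\<lambda>n. (\<Sum>k\<in>parity_class n e. g (l n k)) / card (parity_class n e))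
    \<longlonglongrightarrow> (LINT x|leb0pi. g (f x)) / pi"
proof (rule LIMSEQ_I)
  fix \<epsilon> :: real assume eps: "\<epsilon> > 0"
  have L: "L \<ge> 0" using g[of 0 1] by simp
  \<comment> \<open>The weight in \<open>2 * \<bar>t\<bar> \<le> \<eta> + t ^ 2 / \<eta>\<close>,
    which trades Lipschitz differences for the mean squares controlled by \<open>U4\<close>. The
    comparison will cost \<open>4 * L * \<eta>\<close>, hence the 8; \<open>L + 1\<close> keeps the
    denominator positive for \<open>L = 0\<close>.\<close>
  define \<eta> where "\<eta> = \<epsilon> / (8 * (L + 1))"
  have eta: "\<eta> > 0" "L * \<eta> \<le> \<epsilon> / 8"
    unfolding \<eta>_def using eps L by (auto simp: field_simps)
  have gl: "\<bar>g y - g z\<bar> \<le> L / 2 * (\<eta> + (y - z)\<^sup>2 / \<eta>)" for y z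
  proof -
    have "2 * \<bar>y - z\<bar> * \<eta> \<le> \<eta>\<^sup>2 + (y - z)\<^sup>2"
      using sum_squares_bound[of "\<bar>y - z\<bar>" \<eta>] by simp
    then have "2 * \<bar>y - z\<bar> \<le> \<eta> + (y - z)\<^sup>2 / \<eta>"
      using eta(1) by (simp add: field_simps power2_eq_square)
    then have "L * (2 * \<bar>y - z\<bar>) \<le> L * (\<eta> + (y - z)\<^sup>2 / \<eta>)" using L by (rule mult_left_mono)
    then show ?thesis using g[of y z] by simp
  qed
  obtain d a where da: "(LINT x|leb0pi. (f x - cos_poly d a x)\<^sup>2) < pi * \<eta>\<^sup>2"
    using cos_poly_L2_dense[OF f, of "pi * \<eta>\<^sup>2"] eta(1) by auto
  let ?p = "cos_poly d a"
  define C where "C = 8 * real d * (\<Sum>m\<le>d. \<bar>a m\<bar>)\<^sup>2"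
  have pA: "\<bar>?p x\<bar> \<le> (\<Sum>m\<le>d. \<bar>a m\<bar>)" for x
    unfolding cos_poly_def
    by (rule order_trans[OF sum_abs]) (intro sum_mono, simp add: abs_mult mult_left_le)
  have pm: "?p \<in> borel_measurable leb0pi"
    by (intro continuous_borel_measurable_leb0pi continuous_intros)
  have gc: "continuous_on UNIV g"
    using g L by (intro lipschitz_on_continuous_on[of L]) (auto simp: lipschitz_on_def dist_real_def)
  have gp: "continuous_on S (\<lambda>x. g (?p x))" for S
    by (rule continuous_on_compose2[OF gc continuous_on_cos_poly]) auto
  have gm: "g \<in> borel_measurable borel" using gc by (rule borel_measurable_continuous_onI)
  have gB: "\<bar>g y\<bar> \<le> \<bar>g 0\<bar> + L * B" if "\<bar>y\<bar> \<le> B" for y B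
    using g[of y 0] mult_left_mono[OF that L] by simp
  define \<theta> where "\<theta> n j = real (j + 1) * (pi / (real n + 1))" for n j :: nat
  have "\<exists>n0. \<forall>n\<ge>n0. norm ((\<Sum>j\<in>parity_class n e. g (?p (\<theta> n j))) / card (parity_class n e)
      - (LINT x|leb0pi. g (?p x)) / pi) < \<epsilon> / 8"
    using LIMSEQ_D[OF riemann_sum_dst_grid[OF gp e], of "\<epsilon> / 8"] eps unfolding \<theta>_def by simp
  then obtain n0 where n0: "\<And>n. n \<ge> n0 \<Longrightarrow> \<bar>(\<Sum>j\<in>parity_class n e. g (?p (\<theta> n j))) / card (parity_class n e)
      - (LINT x|leb0pi. g (?p x)) / pi\<bar> < \<epsilon> / 8" by auto
  \<comment> \<open>The corner term \<open>C\<close> does not grow with \<open>n\<close>, so a large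
    class absorbs it into \<open>card P * \<eta>\<^sup>2\<close>.\<close>
  obtain M :: nat where M: "3 * C / \<eta>\<^sup>2 < real M" using reals_Archimedean2 by blast
  have I: "\<bar>(LINT x|leb0pi. g (?p x)) / pi - (LINT x|leb0pi. g (f x)) / pi\<bar> \<le> \<epsilon> / 8"
  proof -
    have i1: "integrable leb0pi (\<lambda>x. g (?p x))"
      by (rule integrable_continuous_0pi[OF gp])
    have i2: "integrable leb0pi (\<lambda>x. g (f x))"
      by (rule integrable_bounded_leb0pi) (use f gm gB in \<open>auto intro: measurable_compose\<close>)
    have i3: "integrable leb0pi (\<lambda>x. (f x - ?p x)\<^sup>2)"
    proof (rule integrable_bounded_leb0pi)
      show "(\<lambda>x. (f x - ?p x)\<^sup>2) \<in> borel_measurable leb0pi" using f(1) pm by measurable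
      fix x assume "x \<in> {0..pi}"
      then have "\<bar>f x - ?p x\<bar> \<le> K + (\<Sum>m\<le>d. \<bar>a m\<bar>)" using f(2)[of x] pA[of x] by linarith
      from power_mono[OF this, of 2] show "\<bar>(f x - ?p x)\<^sup>2\<bar> \<le> (K + (\<Sum>m\<le>d. \<bar>a m\<bar>))\<^sup>2" by simp
    qed
    have i4: "integrable leb0pi (\<lambda>_. \<eta>)" by (rule integrable_bounded_leb0pi) auto
    have i5: "integrable leb0pi (\<lambda>x. L / 2 * (\<eta> + (f x - ?p x)\<^sup>2 / \<eta>))"
      by (intro integrable_mult_right Bochner_Integration.integrable_add i4 integrable_divide i3)
    have "\<bar>LINT x|leb0pi. g (?p x) - g (f x)\<bar> \<le> (LINT x|leb0pi. \<bar>g (?p x) - g (f x)\<bar>)"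
      by (rule integral_abs_bound)
    also have "\<dots> \<le> (LINT x|leb0pi. L / 2 * (\<eta> + (f x - ?p x)\<^sup>2 / \<eta>))"
    proof (rule integral_mono'[OF i5])
      show "\<bar>g (?p x) - g (f x)\<bar> \<le> L / 2 * (\<eta> + (f x - ?p x)\<^sup>2 / \<eta>)" for x
        using gl[of "f x" "?p x"] by (simp only: abs_minus_commute)
      show "0 \<le> L / 2 * (\<eta> + (f x - ?p x)\<^sup>2 / \<eta>)" for x using L eta(1) by simp
    qed
    also have "\<dots> = L / 2 * (\<eta> * pi + (LINT x|leb0pi. (f x - ?p x)\<^sup>2) / \<eta>)"
      using i3 i4 by (simp add: measure_restrict_space)
    also have "\<dots> \<le> L / 2 * (\<eta> * pi + pi * \<eta>\<^sup>2 / \<eta>)"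
      using da L eta(1) by (intro mult_left_mono add_left_mono divide_right_mono) auto
    also have "\<dots> = L * \<eta> * pi" using eta(1) by (simp add: power2_eq_square field_simps)
    also have "\<dots> \<le> \<epsilon> / 8 * pi" using eta(2) by (intro mult_right_mono) auto
    finally have "\<bar>(LINT x|leb0pi. g (?p x)) - (LINT x|leb0pi. g (f x))\<bar> \<le> \<epsilon> / 8 * pi"
      using i1 i2 by simp
    then have "\<bar>(LINT x|leb0pi. g (?p x)) - (LINT x|leb0pi. g (f x))\<bar> / pi \<le> \<epsilon> / 8"
      by (simp add: divide_le_eq)
    then show ?thesis by (simp add: abs_divide flip: diff_divide_distrib)
  qed
  have "norm ((\<Sum>k\<in>parity_class n e. g (l n k)) / card (parity_class n e) - (LINT x|leb0pi. g (f x)) / pi) < \<epsilon>"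
    if n: "n \<ge> n0 + M + 2" for n
  proof -
    define P where "P = parity_class n e"
    have P: "finite P" "P \<subseteq> {..<n}" unfolding P_def by auto
    have cP: "card P = (n + 1 - e) div 2" unfolding P_def by (rule card_parity_class[OF e])
    have N: "real (card P) > 0" "real n \<le> 3 * real (card P)"
    proof -
      have "card P > 0" "n \<le> 3 * card P" unfolding cP using n e by auto
      then show "real (card P) > 0" "real n \<le> 3 * real (card P)" by linarith+
    qed
    define w where "w j k = (U n j k)\<^sup>2" for j k
    have w0: "w j k \<ge> 0" for j k unfolding w_def by simp
    have wP: "w j k = 0" if "j \<in> P" "k < n" "k \<notin> P" for j k
    proof -
      have "odd (j + k)" using that e unfolding P_def by (auto simp: le_Suc_eq)
      then show ?thesis by (simp add: w_def U3)
    qed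
    have wP': "w j k = 0" if "k \<in> P" "j < n" "j \<notin> P" for j k
    proof -
      have "odd (j + k)" using that e unfolding P_def by (auto simp: le_Suc_eq)
      then show ?thesis by (simp add: w_def U3)
    qed
    have r: "(\<Sum>k\<in>P. w j k) = 1" if "j \<in> P" for j
    proof -
      have "(\<Sum>k\<in>P. w j k) = (\<Sum>k<n. w j k)"
        using P wP[OF that] by (intro sum.mono_neutral_left) auto
      then show ?thesis using U1[of j n] that P unfolding w_def by auto
    qed
    have s: "(\<Sum>j\<in>P. w j k) = 1" if "k \<in> P" for k
    proof -
      have "(\<Sum>j\<in>P. w j k) = (\<Sum>j<n. w j k)"
        using P wP'[OF that] by (intro sum.mono_neutral_left) auto
      then show ?thesis using U2[of k n] that P unfolding w_def by auto
    qed
    \<comment> \<open>Unit row and column sums put both averages over the same weights, so their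
      difference becomes a weighted sum of differences.\<close>
    have 1: "(\<Sum>k\<in>P. g (l n k)) = (\<Sum>j\<in>P. \<Sum>k\<in>P. w j k * g (l n k))"
      by (subst sum.swap) (simp add: s flip: sum_distrib_right)
    have 2: "(\<Sum>j\<in>P. g (?p (\<theta> n j))) = (\<Sum>j\<in>P. \<Sum>k\<in>P. w j k * g (?p (\<theta> n j)))"
      by (simp add: r flip: sum_distrib_right)
    have T: "(\<Sum>j\<in>P. \<Sum>k\<in>P. w j k * (l n k - ?p (\<theta> n j))\<^sup>2) \<le> 2 * real n * \<eta>\<^sup>2 + C"
    proof -
      have "(\<Sum>j\<in>P. \<Sum>k\<in>P. w j k * (l n k - ?p (\<theta> n j))\<^sup>2) \<le> (\<Sum>j\<in>P. \<Sum>k<n. w j k * (l n k - ?p (\<theta> n j))\<^sup>2)"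
        using P w0 by (intro sum_mono sum_mono2) auto
      also have "\<dots> \<le> (\<Sum>j<n. \<Sum>k<n. w j k * (l n k - ?p (\<theta> n j))\<^sup>2)"
        using P w0 by (intro sum_mono2 sum_nonneg) auto
      also have "\<dots> \<le> 2 * (real n * ((LINT x|leb0pi. (f x - ?p x)\<^sup>2) / pi)) + C"
        unfolding w_def U4 C_def \<theta>_def by (rule sum_dst_residual_le[OF f])
      also have "\<dots> \<le> 2 * (real n * \<eta>\<^sup>2) + C"
        using da by (intro add_mono mult_left_mono) (auto simp: divide_le_eq mult.commute)
      finally show ?thesis by simp
    qed
    have CM: "C \<le> real (card P) * \<eta>\<^sup>2"
    proof -
      have "real M \<le> 3 * real (card P)" using N(2) n by linarith
      then have "3 * C / \<eta>\<^sup>2 \<le> 3 * real (card P)" using M by linarith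
      then show ?thesis using eta(1) by (simp add: field_simps)
    qed
    have "\<bar>(\<Sum>k\<in>P. g (l n k)) - (\<Sum>j\<in>P. g (?p (\<theta> n j)))\<bar>
        = \<bar>\<Sum>j\<in>P. \<Sum>k\<in>P. w j k * (g (l n k) - g (?p (\<theta> n j)))\<bar>"
      unfolding 1 2 by (simp add: sum_subtractf right_diff_distrib)
    also have "\<dots> \<le> (\<Sum>j\<in>P. \<Sum>k\<in>P. \<bar>w j k * (g (l n k) - g (?p (\<theta> n j)))\<bar>)"
      by (rule order_trans[OF sum_abs]) (intro sum_mono sum_abs)
    also have "\<dots> \<le> (\<Sum>j\<in>P. \<Sum>k\<in>P. w j k * (L / 2 * (\<eta> + (l n k - ?p (\<theta> n j))\<^sup>2 / \<eta>)))"
    proof (intro sum_mono)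
      fix j k
      show "\<bar>w j k * (g (l n k) - g (?p (\<theta> n j)))\<bar> \<le> w j k * (L / 2 * (\<eta> + (l n k - ?p (\<theta> n j))\<^sup>2 / \<eta>))"
        unfolding abs_mult abs_of_nonneg[OF w0] by (intro mult_left_mono gl w0)
    qed
    also have "\<dots> = L / 2 * (\<Sum>j\<in>P. \<Sum>k\<in>P. w j k * \<eta> + w j k * (l n k - ?p (\<theta> n j))\<^sup>2 / \<eta>)"
      by (simp add: sum_distrib_left algebra_simps)
    also have "\<dots> = L / 2 * (card P * \<eta> + (\<Sum>j\<in>P. \<Sum>k\<in>P. w j k * (l n k - ?p (\<theta> n j))\<^sup>2) / \<eta>)"
      by (simp add: sum.distrib r flip: sum_distrib_right sum_divide_distrib)
    \<comment> \<open>A parity class contains at least a third of the indices, hence the 3. In total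
      this gives \<open>L / 2 * 8 * \<eta>\<close> per element.\<close>
    also have "\<dots> \<le> L / 2 * (card P * \<eta> + (2 * (3 * card P) * \<eta>\<^sup>2 + card P * \<eta>\<^sup>2) / \<eta>)"
    proof -
      have "2 * real n * \<eta>\<^sup>2 + C \<le> 2 * (3 * card P) * \<eta>\<^sup>2 + card P * \<eta>\<^sup>2"
        using N(2) CM by (intro add_mono mult_right_mono) auto
      then show ?thesis using T L eta(1)
        by (intro mult_left_mono add_left_mono divide_right_mono) auto
    qed
    also have "\<dots> = 4 * card P * (L * \<eta>)" using eta(1) by (simp add: power2_eq_square field_simps)
    also have "\<dots> \<le> 4 * card P * (\<epsilon> / 8)" using eta(2) by (intro mult_left_mono) auto
    finally have "\<bar>(\<Sum>k\<in>P. g (l n k)) - (\<Sum>j\<in>P. g (?p (\<theta> n j)))\<bar> \<le> \<epsilon> / 2 * card P" by simp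
    then have "\<bar>(\<Sum>k\<in>P. g (l n k)) / card P - (\<Sum>j\<in>P. g (?p (\<theta> n j))) / card P\<bar> \<le> \<epsilon> / 2"
      using N(1) by (simp add: divide_le_eq abs_divide flip: diff_divide_distrib)
    moreover have "\<bar>(\<Sum>j\<in>P. g (?p (\<theta> n j))) / card P - (LINT x|leb0pi. g (?p x)) / pi\<bar> < \<epsilon> / 8"
      unfolding P_def by (rule n0) (use n in simp)
    ultimately show ?thesis unfolding P_def[symmetric] real_norm_def using I eps by linarith
  qed
  then show "\<exists>no. \<forall>n\<ge>no. norm ((\<Sum>k\<in>parity_class n e. g (l n k)) / card (parity_class n e)
      - (LINT x|leb0pi. g (f x)) / pi) < \<epsilon>" by blast
qed

text \<open>The portmanteau argument: Lipschitz majorants of the indicator bound the frequencies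
  from above, and the same bound for the complement gives the lower estimate. Finite level sets make
  the preimage of the finite frontier a null set.\<close>

lemma averages_imp_counts:
  fixes l :: "nat \<Rightarrow> nat \<Rightarrow> real" and f :: "real \<Rightarrow> real"
  assumes fin: "\<And>n. finite (K n)" and ne: "eventually (\<lambda>n. K n \<noteq> {}) sequentially"
    and f: "f \<in> borel_measurable leb0pi" and lev: "\<And>y. finite {x\<in>{0..pi}. f x = y}"
    and avg: "\<And>g L. (\<And>y z. \<bar>g y - g z\<bar> \<le> L * \<bar>y - z\<bar>) \<Longrightarrow>
      (\<lambda>n. (\<Sum>k\<in>K n. g (l n k)) / card (K n)) \<longlonglongrightarrow> (LINT x|leb0pi. g (f x)) / pi"
    and C: "finite (frontier C)"
  shows "(\<lambda>n. card {k\<in>K n. l n k \<in> C} / card (K n)) \<longlonglongrightarrow> measure leb0pi {x\<in>{0..pi}. f x \<in> C} / pi"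
proof -
  have meas: "{x\<in>{0..pi}. f x \<in> C} \<in> sets leb0pi" if "finite (frontier C)" for C
    using measurable_sets[OF f borel_finite_frontier[OF that]]
    by (simp add: space_restrict_space vimage_def Int_def conj_commute)
  have upper: "eventually (\<lambda>n. card {k\<in>K n. l n k \<in> C} / card (K n) < measure leb0pi {x\<in>{0..pi}. f x \<in> C} / pi + \<epsilon>) sequentially"
    if C: "finite (frontier C)" and eps: "\<epsilon> > 0" for C \<epsilon>
  \<comment> \<open>Treated apart because \<open>infdist\<close> to the empty set is 0, so the
    majorants below would be constantly 1.\<close>
  proof (cases "C = {}")
    case True
    then show ?thesis using eps by simp
  next
    case False
    define h where "h m y = max 0 (1 - real m * infdist y C)" for m :: nat and y
    have lip: "\<bar>h m y - h m z\<bar> \<le> real m * \<bar>y - z\<bar>" for m y z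
    proof -
      have "\<bar>real m * infdist y C - real m * infdist z C\<bar> \<le> real m * \<bar>y - z\<bar>"
        using infdist_triangle_abs[of y C z]
        by (simp add: dist_real_def mult_left_mono flip: right_diff_distrib abs_mult_pos')
      then show ?thesis unfolding h_def by linarith
    qed
    have h01: "0 \<le> h m y" "h m y \<le> 1" for m y unfolding h_def by (auto simp: infdist_nonneg)
    have hC: "h m y = 1" if "y \<in> C" for m y using that unfolding h_def by simp
    have hm: "h m \<in> borel_measurable borel" for m
      unfolding h_def by (intro borel_measurable_continuous_onI continuous_intros)
    have "(\<lambda>m. LINT x|leb0pi. h m (f x)) \<longlonglongrightarrow> (LINT x|leb0pi. indicator {x\<in>{0..pi}. f x \<in> C} x)"
    proof (rule integral_dominated_convergence[where w = "\<lambda>_. 1"])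
      show "integrable leb0pi (\<lambda>_. 1 :: real)" by (rule integrable_bounded_leb0pi) auto
      show "AE x in leb0pi. norm (h m (f x)) \<le> 1" for m using h01 by auto
      show "(\<lambda>x. h m (f x)) \<in> borel_measurable leb0pi" for m using f hm by measurable
      show "indicator {x\<in>{0..pi}. f x \<in> C} \<in> borel_measurable leb0pi"
        using meas[OF C] by (rule borel_measurable_indicator)
      \<comment> \<open>Off these finitely many points, \<open>f x\<close> lies either in
        \<open>C\<close> or at positive distance from it, where \<open>h m (f x)\<close> is
        eventually 0.\<close>
      have "finite (\<Union>y\<in>frontier C. {x\<in>{0..pi}. f x = y})" using C lev by blast
      then have "AE x in leb0pi. x \<notin> (\<Union>y\<in>frontier C. {x\<in>{0..pi}. f x = y})" by (rule finite_AE_leb0pi)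
      then show "AE x in leb0pi. (\<lambda>m. h m (f x)) \<longlonglongrightarrow> indicator {x\<in>{0..pi}. f x \<in> C} x"
        using AE_space
      proof eventually_elim
        case (elim x)
        then have x: "x \<in> {0..pi}" "f x \<notin> frontier C" by (auto simp: space_restrict_space)
        show ?case
        proof (cases "f x \<in> C")
          case True
          then show ?thesis using x by (simp add: hC)
        next
          case nC: False
          then have "f x \<notin> closure C" using x(2) interior_subset unfolding frontier_def by auto
          then have pos: "infdist (f x) C > 0"
            using in_closure_iff_infdist_zero[OF False] infdist_nonneg[of "f x" C] by (simp add: less_le)
          obtain M :: nat where M: "1 / infdist (f x) C < real M" using reals_Archimedean2 by blast
          have "h m (f x) = 0" if "m \<ge> M" for m
          proof -
            have "1 / infdist (f x) C \<le> real m" using M that by linarith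
            then have "1 \<le> real m * infdist (f x) C" using pos by (simp add: divide_le_eq)
            then show ?thesis unfolding h_def by simp
          qed
          then have "eventually (\<lambda>m. h m (f x) = 0) sequentially"
            by (auto simp: eventually_sequentially)
          then show ?thesis using nC by (simp add: tendsto_eventually)
        qed
      qed
    qed
    then have "(\<lambda>m. (LINT x|leb0pi. h m (f x)) / pi) \<longlonglongrightarrow> measure leb0pi {x\<in>{0..pi}. f x \<in> C} / pi"
      using meas[OF C] by (intro tendsto_intros) (auto simp: space_restrict_space Int_absorb2 subset_iff)
    then have "eventually (\<lambda>m. (LINT x|leb0pi. h m (f x)) / pi < measure leb0pi {x\<in>{0..pi}. f x \<in> C} / pi + \<epsilon>) sequentially"
      by (rule order_tendstoD) (use eps in simp)
    then obtain m where m: "(LINT x|leb0pi. h m (f x)) / pi < measure leb0pi {x\<in>{0..pi}. f x \<in> C} / pi + \<epsilon>"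
      by (auto simp: eventually_sequentially)
    have "eventually (\<lambda>n. (\<Sum>k\<in>K n. h m (l n k)) / card (K n) < measure leb0pi {x\<in>{0..pi}. f x \<in> C} / pi + \<epsilon>) sequentially"
      by (rule order_tendstoD(2)[OF avg[OF lip] m])
    then show ?thesis
    proof eventually_elim
      case (elim n)
      have "real (card {k\<in>K n. l n k \<in> C}) = (\<Sum>k\<in>{k\<in>K n. l n k \<in> C}. h m (l n k))"
        by (simp add: hC)
      also have "\<dots> \<le> (\<Sum>k\<in>K n. h m (l n k))"
        using fin h01 by (intro sum_mono2) auto
      finally have "card {k\<in>K n. l n k \<in> C} / card (K n) \<le> (\<Sum>k\<in>K n. h m (l n k)) / card (K n)"
        by (rule divide_right_mono) simp
      then show ?case using elim by linarith
    qed
  qed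
  have compl: "measure leb0pi {x\<in>{0..pi}. f x \<in> - C} = pi - measure leb0pi {x\<in>{0..pi}. f x \<in> C}"
  proof -
    have "{x\<in>{0..pi}. f x \<in> - C} = space leb0pi - {x\<in>{0..pi}. f x \<in> C}" by (auto simp: space_restrict_space)
    then show ?thesis
      using finite_measure.finite_measure_compl[OF finite_measure_leb0pi meas[OF C]]
      by (simp add: measure_restrict_space space_restrict_space)
  qed
  show ?thesis
  proof (rule order_tendstoI)
    fix a assume a: "a > measure leb0pi {x\<in>{0..pi}. f x \<in> C} / pi"
    show "eventually (\<lambda>n. card {k\<in>K n. l n k \<in> C} / card (K n) < a) sequentially"
      using upper[OF C, of "a - measure leb0pi {x\<in>{0..pi}. f x \<in> C} / pi"] a by simp
  next
    fix a assume a: "a < measure leb0pi {x\<in>{0..pi}. f x \<in> C} / pi"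
    \<comment> \<open>\<open>C\<close> and its complement share their frontier, so
      \<open>upper\<close> applies to the complement with the gap as tolerance.\<close>
    have "finite (frontier (- C))" using C by (simp add: frontier_complement)
    then have "eventually (\<lambda>n. card {k\<in>K n. l n k \<in> - C} / card (K n) < measure leb0pi {x\<in>{0..pi}. f x \<in> - C} / pi
        + (measure leb0pi {x\<in>{0..pi}. f x \<in> C} / pi - a)) sequentially"
      by (rule upper) (use a in simp)
    then show "eventually (\<lambda>n. a < card {k\<in>K n. l n k \<in> C} / card (K n)) sequentially"
      using ne
    proof eventually_elim
      case (elim n)
      have "K n = {k\<in>K n. l n k \<in> C} \<union> {k\<in>K n. l n k \<in> - C}" by auto
      then have "card (K n) = card ({k\<in>K n. l n k \<in> C} \<union> {k\<in>K n. l n k \<in> - C})" by (rule arg_cong)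
      also have "\<dots> = card {k\<in>K n. l n k \<in> C} + card {k\<in>K n. l n k \<in> - C}"
        by (rule card_Un_disjoint) (use fin in auto)
      finally have "card (K n) = card {k\<in>K n. l n k \<in> C} + card {k\<in>K n. l n k \<in> - C}" .
      moreover have "card (K n) > 0" using elim(2) fin by (simp add: card_gt_0_iff)
      ultimately have "card {k\<in>K n. l n k \<in> - C} / card (K n) = 1 - card {k\<in>K n. l n k \<in> C} / card (K n)"
      proof -
        assume a: "card (K n) = card {k\<in>K n. l n k \<in> C} + card {k\<in>K n. l n k \<in> - C}" "card (K n) > 0"
        then have "real (card {k\<in>K n. l n k \<in> - C}) = real (card (K n)) - real (card {k\<in>K n. l n k \<in> C})" by linarith
        then show ?thesis using a(2) by (simp add: diff_divide_distrib del: Compl_iff)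
      qed
      then show ?case using elim(1) unfolding compl by (simp add: diff_divide_distrib)
    qed
  qed
qed

section \<open>Matching values with grid points\<close>

text \<open>Greedy filling: \<open>t\<close> receives exactly its quota while enough elements
  remain, which leaves the total mismatch unchanged; once they do not suffice, it receives all the
  rest and every later shortfall is covered by the mismatch. A last single target absorbs any
  surplus.\<close>

lemma near_prescribed_allocation:
  fixes b :: "'b \<Rightarrow> nat"
  assumes "finite T" "T \<noteq> {}" "finite S"
  shows "\<exists>\<kappa>. (\<forall>s\<in>S. \<kappa> s \<in> T) \<and>
    (\<forall>t\<in>T. \<bar>int (card {s\<in>S. \<kappa> s = t}) - int (b t)\<bar> \<le> \<bar>int (card S) - int (\<Sum>t\<in>T. b t)\<bar>)"
  using assms
proof (induction T arbitrary: S rule: finite_ne_induct)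
  case (singleton t)
  show ?case by (rule exI[of _ "\<lambda>_. t"]) simp
next
  case (insert t T)
  show ?case
  proof (cases "b t \<le> card S")
    case True
    then obtain S1 where S1: "S1 \<subseteq> S" "card S1 = b t" by (metis obtain_subset_with_card_n)
    obtain \<kappa> where k: "\<And>s. s \<in> S - S1 \<Longrightarrow> \<kappa> s \<in> T"
      "\<And>u. u \<in> T \<Longrightarrow> \<bar>int (card {s\<in>S - S1. \<kappa> s = u}) - int (b u)\<bar> \<le> \<bar>int (card (S - S1)) - int (\<Sum>t\<in>T. b t)\<bar>"
      using insert.IH[of "S - S1"] insert.prems by auto
    define \<kappa>' where "\<kappa>' s = (if s \<in> S1 then t else \<kappa> s)" for s
    have t: "{s\<in>S. \<kappa>' s = t} = S1" using S1 k(1) insert.hyps unfolding \<kappa>'_def by auto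
    have u: "{s\<in>S. \<kappa>' s = u} = {s\<in>S - S1. \<kappa> s = u}" if "u \<in> T" for u
      using that insert.hyps unfolding \<kappa>'_def by auto
    have c: "int (card (S - S1)) = int (card S) - int (b t)"
      using S1 True insert.prems by (simp add: card_Diff_subset finite_subset)
    have "\<bar>int (card {s\<in>S. \<kappa>' s = v}) - int (b v)\<bar> \<le> \<bar>int (card S) - int (\<Sum>t\<in>insert t T. b t)\<bar>"
      if v: "v \<in> insert t T" for v
    proof (cases "v = t")
      case True
      then show ?thesis using t S1(2) by simp
    next
      case False
      then have "v \<in> T" using v by simp
      then show ?thesis using u[OF \<open>v \<in> T\<close>] k(2)[OF \<open>v \<in> T\<close>] insert.hyps unfolding c
        by (simp add: algebra_simps)
    qed
    moreover have "\<forall>s\<in>S. \<kappa>' s \<in> insert t T" using k(1) unfolding \<kappa>'_def by auto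
    ultimately show ?thesis by blast
  next
    case False
    have "\<bar>int (card {s\<in>S. t = v}) - int (b v)\<bar> \<le> \<bar>int (card S) - int (\<Sum>t\<in>insert t T. b t)\<bar>"
      if v: "v \<in> insert t T" for v
    proof (cases "v = t")
      case True
      have "(\<Sum>t\<in>insert t T. b t) = b t + (\<Sum>t\<in>T. b t)" using insert.hyps by simp
      then show ?thesis using False True by (simp del: of_nat_sum)
    next
      case vt: False
      then have "b v \<le> (\<Sum>t\<in>T. b t)" using v insert.hyps by (intro member_le_sum) auto
      moreover have "card {s\<in>S. t = v} = 0" using vt by auto
      moreover have "(\<Sum>t\<in>insert t T. b t) = b t + (\<Sum>t\<in>T. b t)" using insert.hyps by simp
      ultimately show ?thesis using False by linarith
    qed
    then show ?thesis by (intro exI[of _ "\<lambda>_. t"]) simp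
  qed
qed

lemma sorted_enumeration:
  fixes \<kappa> :: "'a \<Rightarrow> nat"
  assumes "finite K"
  obtains \<sigma> where "bij_betw \<sigma> {..<card K} K" "\<And>i j. i \<le> j \<Longrightarrow> j < card K \<Longrightarrow> \<kappa> (\<sigma> i) \<le> \<kappa> (\<sigma> j)"
proof -
  obtain xs where xs: "set xs = K" "distinct xs" using finite_distinct_list[OF assms] by blast
  define ys where "ys = sort_key \<kappa> xs"
  have ys: "set ys = K" "distinct ys" "sorted (map \<kappa> ys)" unfolding ys_def using xs by auto
  then have len: "length ys = card K" using distinct_card by fastforce
  show thesis
  proof (rule that[of "\<lambda>i. ys ! i"])
    show "bij_betw ((!) ys) {..<card K} K" using ys len by (intro bij_betw_nth) auto
    show "\<kappa> (ys ! i) \<le> \<kappa> (ys ! j)" if "i \<le> j" "j < card K" for i j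
      using sorted_nth_mono[OF ys(3) that(1)] that len by simp
  qed
qed

text \<open>Turns cumulative class counts into bounds for the rank of an element, which becomes its
  place in the grid.\<close>

lemma sorted_enumeration_position:
  fixes \<kappa> :: "'a \<Rightarrow> nat"
  assumes K: "finite K" and \<sigma>: "bij_betw \<sigma> {..<card K} K"
    "\<And>i j. i \<le> j \<Longrightarrow> j < card K \<Longrightarrow> \<kappa> (\<sigma> i) \<le> \<kappa> (\<sigma> j)" and i: "i < card K"
  shows "card {k\<in>K. \<kappa> k < \<kappa> (\<sigma> i)} \<le> i" "i < card {k\<in>K. \<kappa> k \<le> \<kappa> (\<sigma> i)}"
proof -
  have "{k\<in>K. \<kappa> k < \<kappa> (\<sigma> i)} \<subseteq> \<sigma> ` {..<i}"
  proof
    fix k assume k: "k \<in> {k\<in>K. \<kappa> k < \<kappa> (\<sigma> i)}"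
    then obtain j where j: "j < card K" "k = \<sigma> j" using \<sigma>(1) unfolding bij_betw_def by auto
    then have "j < i" using \<sigma>(2)[of i j] k by (cases "j < i") auto
    then show "k \<in> \<sigma> ` {..<i}" using j by auto
  qed
  then have "card {k\<in>K. \<kappa> k < \<kappa> (\<sigma> i)} \<le> card (\<sigma> ` {..<i})" by (intro card_mono) auto
  also have "\<dots> \<le> i" using card_image_le[of "{..<i}" \<sigma>] by simp
  finally show "card {k\<in>K. \<kappa> k < \<kappa> (\<sigma> i)} \<le> i" .
  have "inj_on \<sigma> {..i}" using \<sigma>(1) i by (auto simp: bij_betw_def elim: inj_on_subset)
  then have "Suc i = card (\<sigma> ` {..i})" by (simp add: card_image)
  also have "\<dots> \<le> card {k\<in>K. \<kappa> k \<le> \<kappa> (\<sigma> i)}"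
    using K \<sigma> i by (intro card_mono) (auto simp: bij_betw_def)
  finally show "i < card {k\<in>K. \<kappa> k \<le> \<kappa> (\<sigma> i)}" by simp
qed

lemma finite_frontier_INT:
  fixes F :: "'i \<Rightarrow> real set"
  assumes "finite I" "\<And>i. i \<in> I \<Longrightarrow> finite (frontier (F i))"
  shows "finite (frontier (\<Inter>i\<in>I. F i))"
  using assms
proof (induction I rule: finite_induct)
  case (insert i I)
  have "frontier (F i \<inter> (\<Inter>i\<in>I. F i)) \<subseteq> frontier (F i) \<union> frontier (\<Inter>i\<in>I. F i)"
    by (rule frontier_Int_subset)
  then show ?case using insert by (auto intro: finite_subset)
qed simp

text \<open>The type of a value is the set of cells of \<open>[0, \<pi>]\<close> on which \<open>f\<close> attains it. Within each
  type the values are distributed over the admissible cells in proportion to the measure of the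
  corresponding preimages, so that each cell receives about the same number of values; listing the
  values cell by cell then puts every value next to a point where it is attained.\<close>

lemma counts_imp_matching:
  fixes f :: "real \<Rightarrow> real" and l :: "nat \<Rightarrow> nat \<Rightarrow> real"
  assumes fin: "\<And>n. finite (K n)" and inf: "filterlim (\<lambda>n. card (K n)) at_top sequentially"
    and f: "f \<in> borel_measurable leb0pi"
    and img: "\<And>u v. 0 \<le> u \<Longrightarrow> v \<le> pi \<Longrightarrow> finite (frontier (f ` {u..v}))"
    and vals: "\<And>n k. k \<in> K n \<Longrightarrow> l n k \<in> f ` {0..pi}"
    and counts: "\<And>C. finite (frontier C) \<Longrightarrow>
      (\<lambda>n. card {k\<in>K n. l n k \<in> C} / card (K n)) \<longlonglongrightarrow> measure leb0pi {x\<in>{0..pi}. f x \<in> C} / pi"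
    and eps: "\<epsilon> > 0"
  shows "eventually (\<lambda>n. \<exists>\<sigma> x. bij_betw \<sigma> {..<card (K n)} (K n) \<and> (\<forall>i<card (K n).
    x i \<in> {0..pi} \<and> f (x i) = l n (\<sigma> i) \<and> \<bar>x i - real i * pi / card (K n)\<bar> \<le> \<epsilon>)) sequentially"
proof -
  \<comment> \<open>The number of cells. The final error is two cell widths: one for the cell
    containing the point and one for the cumulative counting error.\<close>
  obtain P :: nat where P: "2 * pi / \<epsilon> < real P" using reals_Archimedean2 by blast
  have "0 < 2 * pi / \<epsilon>" using eps by simp
  then have P0: "real P > 0" using P by linarith
  have Peps: "2 * (pi / real P) \<le> \<epsilon>" using P P0 eps by (simp add: field_simps)
  define u where "u p = real p * pi / real P" for p
  have u: "u p < u (Suc p)" "u (Suc p) - u p = pi / real P" for p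
    using P0 by (auto simp: u_def field_simps)
  have u0: "0 \<le> u p" for p by (simp add: u_def)
  have upi: "u p \<le> pi" if "p \<le> P" for p
  proof -
    have "real p * pi \<le> real P * pi" using that by (intro mult_right_mono) auto
    then show ?thesis using P0 unfolding u_def by (simp add: field_simps)
  qed
  define F where "F p = f ` {u p..u (Suc p)}" for p
  \<comment> \<open>There are finitely many types, and each class \<open>C \<tau>\<close> is a
    Boolean combination of the images \<open>F p\<close>; hence it has finite frontier and the
    counting law applies to it.\<close>
  define ty where "ty y = {p. p < P \<and> y \<in> F p}" for y
  define C where "C \<tau> = {y. ty y = \<tau>}" for \<tau>
  have Cfr: "finite (frontier (C \<tau>))" if \<tau>: "\<tau> \<subseteq> {..<P}" for \<tau>
  proof -
    have eq: "C \<tau> = (\<Inter>p\<in>{..<P}. if p \<in> \<tau> then F p else - F p)"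
      using \<tau> unfolding C_def ty_def by (auto split: if_splits)
    have "finite (frontier (F p))" if "p < P" for p
      unfolding F_def using img u0 upi[of "Suc p"] that by auto
    then show ?thesis unfolding eq by (intro finite_frontier_INT) (auto simp: frontier_complement)
  qed
  have ty_sub: "ty y \<subseteq> {..<P}" for y unfolding ty_def by auto
  \<comment> \<open>Cells are half-open here, so that the pieces are disjoint and their measures add
    up, losing only the point \<open>pi\<close>. The cells in \<open>F\<close> are closed, so that
    every value attained on \<open>[0, pi]\<close> has a nonempty type.\<close>
  define A where "A \<tau> p = {x. u p \<le> x \<and> x < u (Suc p) \<and> f x \<in> C \<tau>}" for \<tau> p
  have A_sub: "A \<tau> p \<subseteq> {0..pi}" if "p < P" for \<tau> p
    using u0[of p] upi[of "Suc p"] that unfolding A_def by auto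
  have meas: "{x\<in>{0..pi}. f x \<in> C \<tau>} \<in> sets leb0pi" if "\<tau> \<subseteq> {..<P}" for \<tau>
    using measurable_sets[OF f borel_finite_frontier[OF Cfr[OF that]]]
    by (simp add: space_restrict_space vimage_def Int_def conj_commute)
  have cell_meas: "{u p..<u (Suc p)} \<in> sets leb0pi" if "p < P" for p
    using u0[of p] upi[of "Suc p"] that by (subst sets_restrict_space_iff) auto
  have A_meas: "A \<tau> p \<in> sets leb0pi" if "\<tau> \<subseteq> {..<P}" "p < P" for \<tau> p
  proof -
    have "A \<tau> p = {x\<in>{0..pi}. f x \<in> C \<tau>} \<inter> {u p..<u (Suc p)}"
      using A_sub[OF that(2), of \<tau>] unfolding A_def by auto
    then show ?thesis using meas[OF that(1)] cell_meas[OF that(2)] by auto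
  qed
  have cell_unique: "p = q" if "u p \<le> x" "x < u (Suc p)" "u q \<le> x" "x < u (Suc q)" for p q x
  proof -
    have "u (Suc p) \<le> u q" if "p < q" for p q
      using that P0 unfolding u_def by (intro divide_right_mono mult_right_mono) auto
    then show ?thesis using that by (metis linorder_neqE_nat not_le order.strict_trans1)
  qed
  have cell_ex: "\<exists>p<P. u p \<le> x \<and> x < u (Suc p)" if "0 \<le> x" "x < pi" for x
  proof -
    define p where "p = nat \<lfloor>x * real P / pi\<rfloor>"
    have "0 \<le> x * real P / pi" using that by simp
    then have p: "real p \<le> x * real P / pi" "x * real P / pi < real p + 1"
      unfolding p_def by linarith+
    have "x * real P / pi < real P" using that P0 by (simp add: field_simps)
    then have "p < P" using p(1) by linarith
    moreover have "u p \<le> x" "x < u (Suc p)" using p P0 unfolding u_def by (auto simp: field_simps)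
    ultimately show ?thesis by blast
  qed
  define q where "q \<tau> p = measure leb0pi (A \<tau> p) / pi" for \<tau> p
  have q0: "q \<tau> p \<ge> 0" for \<tau> p unfolding q_def by simp
  have q_out: "q \<tau> p = 0" if "p < P" "p \<notin> \<tau>" for \<tau> p
  proof -
    have "A \<tau> p = {}" using that unfolding A_def C_def ty_def F_def by auto
    then show ?thesis unfolding q_def by simp
  qed
  have q_sum_p: "(\<Sum>p<P. q \<tau> p) = measure leb0pi {x\<in>{0..pi}. f x \<in> C \<tau>} / pi" if \<tau>: "\<tau> \<subseteq> {..<P}" for \<tau>
  proof -
    have "(\<Sum>p<P. measure leb0pi (A \<tau> p)) = measure leb0pi (\<Union>p<P. A \<tau> p)"
      by (rule finite_measure.finite_measure_finite_Union[OF finite_measure_leb0pi, symmetric])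
        (use A_meas[OF \<tau>] cell_unique in \<open>auto simp: disjoint_family_on_def A_def\<close>)
    also have "\<dots> = measure leb0pi {x\<in>{0..pi}. f x \<in> C \<tau>}"
    proof (rule measure_eq_AE)
      have "AE x in leb0pi. x \<notin> {pi}" by (rule finite_AE_leb0pi) simp
      then show "AE x in leb0pi. x \<in> (\<Union>p<P. A \<tau> p) \<longleftrightarrow> x \<in> {x\<in>{0..pi}. f x \<in> C \<tau>}"
      proof eventually_elim
        case (elim x)
        have "x \<in> (\<Union>p<P. A \<tau> p)" if x: "x \<in> {0..pi}" "f x \<in> C \<tau>"
          using cell_ex[of x] x elim unfolding A_def by auto
        moreover have "x \<in> {0..pi} \<and> f x \<in> C \<tau>" if "p < P" "x \<in> A \<tau> p" for p
          using A_sub[OF that(1), of \<tau>] that(2) unfolding A_def by blast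
        ultimately show ?case by blast
      qed
      show "(\<Union>p<P. A \<tau> p) \<in> sets leb0pi" using A_meas[OF \<tau>] by auto
    qed (rule meas[OF \<tau>])
    finally show ?thesis unfolding q_def by (simp flip: sum_divide_distrib)
  qed
  have q_sum_ty: "(\<Sum>\<tau>\<in>Pow {..<P}. q \<tau> p) = 1 / real P" if p: "p < P" for p
  proof -
    have "(\<Sum>\<tau>\<in>Pow {..<P}. measure leb0pi (A \<tau> p)) = measure leb0pi (\<Union>\<tau>\<in>Pow {..<P}. A \<tau> p)"
      by (rule finite_measure.finite_measure_finite_Union[OF finite_measure_leb0pi, symmetric])
        (use A_meas p in \<open>auto simp: disjoint_family_on_def A_def C_def\<close>)
    also have "(\<Union>\<tau>\<in>Pow {..<P}. A \<tau> p) = {u p..<u (Suc p)}"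
      using ty_sub unfolding A_def C_def by auto
    also have "measure leb0pi {u p..<u (Suc p)} = pi / real P"
      using u[of p] u0[of p] upi[of "Suc p"] p by (subst measure_restrict_space) auto
    finally show ?thesis unfolding q_def by (simp flip: sum_divide_distrib)
  qed
  define N where "N n = real (card (K n))" for n
  define \<Delta> where "\<Delta> n = (\<Sum>\<tau>\<in>Pow {..<P}. \<bar>card {k\<in>K n. l n k \<in> C \<tau>} / N n - (\<Sum>p<P. q \<tau> p)\<bar>)" for n
  \<comment> \<open>Rounding budget: each of the \<open>2 ^ P\<close> types costs at most
    \<open>P + 1\<close>, namely \<open>P\<close> for the floors in its total quota and 1 for the
    floor in the cell considered.\<close>
  define B where "B = 2 ^ P * (real P + 1)"
  have "\<Delta> \<longlonglongrightarrow> (\<Sum>\<tau>\<in>Pow {..<P}. \<bar>(\<Sum>p<P. q \<tau> p) - (\<Sum>p<P. q \<tau> p)\<bar>)"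
    unfolding \<Delta>_def N_def
  proof (intro tendsto_sum tendsto_rabs tendsto_diff tendsto_const)
    fix \<tau> assume "\<tau> \<in> Pow {..<P}"
    then show "(\<lambda>n. card {k\<in>K n. l n k \<in> C \<tau>} / card (K n)) \<longlonglongrightarrow> (\<Sum>p<P. q \<tau> p)"
      using counts[OF Cfr, of \<tau>] q_sum_p[of \<tau>] by auto
  qed
  then have "\<Delta> \<longlonglongrightarrow> 0" by simp
  \<comment> \<open>Half of the tolerance \<open>N n / P ^ 2\<close> per cell goes to convergence,
    the other half to \<open>B\<close>. The square is needed because the errors of up to
    \<open>P\<close> cells accumulate and must not exceed \<open>N n / P\<close>, the ideal content
    of one cell.\<close>
  then have "eventually (\<lambda>n. \<Delta> n < 1 / (2 * real P ^ 2)) sequentially"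
    by (rule order_tendstoD) (use P0 in simp)
  moreover have "eventually (\<lambda>n. card (K n) \<ge> nat \<lceil>2 * real P ^ 2 * B\<rceil> + 1) sequentially"
    using inf by (simp add: filterlim_at_top)
  ultimately show ?thesis
  proof eventually_elim
    case (elim n)
    have Npos: "N n > 0" using elim(2) unfolding N_def by linarith
    have NB: "B \<le> N n / (2 * real P ^ 2)"
    proof -
      have "2 * real P ^ 2 * B \<le> N n" using elim(2) unfolding N_def by linarith
      then show ?thesis using P0 by (simp add: le_divide_eq mult_ac)
    qed
    define Kt where "Kt \<tau> = {k\<in>K n. l n k \<in> C \<tau>}" for \<tau>
    define b where "b \<tau> p = nat \<lfloor>N n * q \<tau> p\<rfloor>" for \<tau> p
    have b: "real (b \<tau> p) \<le> N n * q \<tau> p" "N n * q \<tau> p \<le> real (b \<tau> p) + 1" for \<tau> p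
    proof -
      have "0 \<le> N n * q \<tau> p" using Npos q0[of \<tau> p] by simp
      then show "real (b \<tau> p) \<le> N n * q \<tau> p" "N n * q \<tau> p \<le> real (b \<tau> p) + 1" unfolding b_def by linarith+
    qed
    have b_out: "b \<tau> p = 0" if "p < P" "p \<notin> \<tau>" for \<tau> p using q_out[OF that] unfolding b_def by simp
    define good where "good \<tau> \<kappa> \<longleftrightarrow> (\<forall>k\<in>Kt \<tau>. \<kappa> k \<in> \<tau>) \<and> (\<forall>p\<in>\<tau>. \<bar>int (card {k\<in>Kt \<tau>. \<kappa> k = p}) - int (b \<tau> p)\<bar>
        \<le> \<bar>int (card (Kt \<tau>)) - int (\<Sum>p\<in>\<tau>. b \<tau> p)\<bar>)" for \<tau> \<kappa>
    have "\<exists>\<kappa>. good \<tau> \<kappa>" if "\<tau> \<subseteq> {..<P}" "\<tau> \<noteq> {}" for \<tau>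
      unfolding good_def
      by (rule near_prescribed_allocation) (use that fin finite_subset in \<open>auto simp: Kt_def\<close>)
    then obtain kap where "\<And>\<tau>. \<tau> \<subseteq> {..<P} \<Longrightarrow> \<tau> \<noteq> {} \<Longrightarrow> good \<tau> (kap \<tau>)" by metis
    then have kap: "\<And>\<tau> k. \<tau> \<subseteq> {..<P} \<Longrightarrow> \<tau> \<noteq> {} \<Longrightarrow> k \<in> Kt \<tau> \<Longrightarrow> kap \<tau> k \<in> \<tau>"
      and kap_card: "\<And>\<tau> p. \<tau> \<subseteq> {..<P} \<Longrightarrow> \<tau> \<noteq> {} \<Longrightarrow> p \<in> \<tau> \<Longrightarrow>
        \<bar>int (card {k\<in>Kt \<tau>. kap \<tau> k = p}) - int (b \<tau> p)\<bar> \<le> \<bar>int (card (Kt \<tau>)) - int (\<Sum>p\<in>\<tau>. b \<tau> p)\<bar>"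
      unfolding good_def by blast+
    have ty_ne: "ty (l n k) \<noteq> {}" if k: "k \<in> K n" for k
    proof -
      obtain x where x: "x \<in> {0..pi}" "l n k = f x" using vals[OF k] by auto
      have "\<exists>p<P. u p \<le> x \<and> x \<le> u (Suc p)"
      proof (cases "x = pi")
        case True
        have "u (P - 1) \<le> pi" "u (Suc (P - 1)) = pi" using P0 upi[of "P - 1"] by (auto simp: u_def)
        then show ?thesis using True P0 by (intro exI[of _ "P - 1"]) auto
      next
        case False
        then show ?thesis using cell_ex[of x] x by (auto intro: less_imp_le)
      qed
      then show ?thesis unfolding ty_def F_def x(2) by auto
    qed
    define \<kappa> where "\<kappa> k = kap (ty (l n k)) k" for k
    have kt: "k \<in> Kt (ty (l n k))" if "k \<in> K n" for k using that unfolding Kt_def C_def by simp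
    have \<kappa>: "\<kappa> k \<in> ty (l n k)" if "k \<in> K n" for k
      unfolding \<kappa>_def using kap[OF ty_sub ty_ne[OF that] kt[OF that]] .
    have cnt: "\<bar>real (card {k\<in>K n. \<kappa> k = p}) - N n / real P\<bar> \<le> N n / real P ^ 2" if p: "p < P" for p
    proof -
      \<comment> \<open>Three errors are added: the allocation misses its quota by at most the
        mismatch between class size and total quota, that mismatch differs from the distribution
        error by at most \<open>P\<close>, and the quota itself is rounded by at most 1.\<close>
      have cnt_ty: "\<bar>real (card {k\<in>Kt \<tau>. kap \<tau> k = p}) - N n * q \<tau> p\<bar>
          \<le> N n * \<bar>card (Kt \<tau>) / N n - (\<Sum>p<P. q \<tau> p)\<bar> + (real P + 1)" if \<tau>: "\<tau> \<subseteq> {..<P}" for \<tau>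
      proof (cases "p \<in> \<tau>")
        case True
        have sb: "(\<Sum>p\<in>\<tau>. b \<tau> p) = (\<Sum>p<P. b \<tau> p)"
          using \<tau> b_out by (intro sum.mono_neutral_left) auto
        have "\<bar>int (card {k\<in>Kt \<tau>. kap \<tau> k = p}) - int (b \<tau> p)\<bar> \<le> \<bar>int (card (Kt \<tau>)) - int (\<Sum>p<P. b \<tau> p)\<bar>"
          using kap_card[OF \<tau> _ True] True unfolding sb by auto
        then have "\<bar>real (card {k\<in>Kt \<tau>. kap \<tau> k = p}) - real (b \<tau> p)\<bar> \<le> \<bar>real (card (Kt \<tau>)) - real (\<Sum>p<P. b \<tau> p)\<bar>"
          by linarith
        moreover have "\<bar>real (card (Kt \<tau>)) - real (\<Sum>p<P. b \<tau> p)\<bar> \<le> N n * \<bar>card (Kt \<tau>) / N n - (\<Sum>p<P. q \<tau> p)\<bar> + real P"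
        proof -
          have "(\<Sum>p<P. real (b \<tau> p)) \<le> (\<Sum>p<P. N n * q \<tau> p)"
            "(\<Sum>p<P. N n * q \<tau> p) \<le> (\<Sum>p<P. real (b \<tau> p) + 1)" by (intro sum_mono b)+
          then have "\<bar>N n * (\<Sum>p<P. q \<tau> p) - real (\<Sum>p<P. b \<tau> p)\<bar> \<le> real P"
            by (simp add: sum_distrib_left sum.distrib)
          moreover have "N n * \<bar>card (Kt \<tau>) / N n - (\<Sum>p<P. q \<tau> p)\<bar> = \<bar>real (card (Kt \<tau>)) - N n * (\<Sum>p<P. q \<tau> p)\<bar>"
          proof -
            have "N n * \<bar>card (Kt \<tau>) / N n - (\<Sum>p<P. q \<tau> p)\<bar> = \<bar>N n * (card (Kt \<tau>) / N n - (\<Sum>p<P. q \<tau> p))\<bar>"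
              using Npos by (simp add: abs_mult)
            also have "N n * (card (Kt \<tau>) / N n - (\<Sum>p<P. q \<tau> p)) = real (card (Kt \<tau>)) - N n * (\<Sum>p<P. q \<tau> p)"
              using Npos by (simp add: right_diff_distrib)
            finally show ?thesis .
          qed
          ultimately show ?thesis by linarith
        qed
        ultimately show ?thesis using b[of \<tau> p] by linarith
      next
        case False
        have em: "{k\<in>Kt \<tau>. kap \<tau> k = p} = {}"
        proof (cases "\<tau> = {}")
          case True
          then show ?thesis using ty_ne unfolding Kt_def C_def by auto
        qed (use kap[OF \<tau>] False in auto)
        show ?thesis unfolding em using q_out[OF p False] Npos by simp
      qed
      have "{k\<in>K n. \<kappa> k = p} = (\<Union>\<tau>\<in>Pow {..<P}. {k\<in>Kt \<tau>. kap \<tau> k = p})"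
        using ty_sub unfolding \<kappa>_def Kt_def C_def by auto
      also have "card \<dots> = (\<Sum>\<tau>\<in>Pow {..<P}. card {k\<in>Kt \<tau>. kap \<tau> k = p})"
        by (rule card_UN_disjoint) (use fin in \<open>auto simp: Kt_def C_def\<close>)
      finally have "real (card {k\<in>K n. \<kappa> k = p}) - N n / real P
          = (\<Sum>\<tau>\<in>Pow {..<P}. real (card {k\<in>Kt \<tau>. kap \<tau> k = p}) - N n * q \<tau> p)"
        using q_sum_ty[OF p] by (simp add: sum_subtractf flip: sum_distrib_left)
      also have "\<bar>\<dots>\<bar> \<le> (\<Sum>\<tau>\<in>Pow {..<P}. N n * \<bar>card (Kt \<tau>) / N n - (\<Sum>p<P. q \<tau> p)\<bar> + (real P + 1))"
        using cnt_ty by (intro order_trans[OF sum_abs] sum_mono) auto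
      also have "\<dots> = N n * \<Delta> n + B"
        unfolding \<Delta>_def Kt_def B_def by (simp add: sum.distrib card_Pow sum_distrib_left)
      also have "\<dots> \<le> N n * (1 / (2 * real P ^ 2)) + N n / (2 * real P ^ 2)"
        using elim(1) Npos NB by (intro add_mono mult_left_mono) auto
      also have "\<dots> = N n / real P ^ 2" by simp
      finally show ?thesis .
    qed
    have cum: "\<bar>real (card {k\<in>K n. \<kappa> k < r}) - real r * (N n / real P)\<bar> \<le> N n / real P" if r: "r \<le> P" for r
    proof -
      have "{k\<in>K n. \<kappa> k < r} = (\<Union>p\<in>{..<r}. {k\<in>K n. \<kappa> k = p})" by auto
      also have "card \<dots> = (\<Sum>p<r. card {k\<in>K n. \<kappa> k = p})"
        by (rule card_UN_disjoint) (use fin in auto)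
      finally have "real (card {k\<in>K n. \<kappa> k < r}) - real r * (N n / real P)
          = (\<Sum>p<r. real (card {k\<in>K n. \<kappa> k = p}) - N n / real P)"
        by (simp add: sum_subtractf)
      also have "\<bar>\<dots>\<bar> \<le> (\<Sum>p<r. N n / real P ^ 2)"
        using cnt r by (intro order_trans[OF sum_abs] sum_mono) auto
      also have "\<dots> = real r * (N n / real P ^ 2)" by simp
      also have "\<dots> \<le> real P * (N n / real P ^ 2)" using r Npos by (intro mult_right_mono) auto
      also have "\<dots> = N n / real P" using P0 by (simp add: power2_eq_square)
      finally show ?thesis .
    qed
    obtain \<sigma> where \<sigma>: "bij_betw \<sigma> {..<card (K n)} (K n)"
      "\<And>i j. i \<le> j \<Longrightarrow> j < card (K n) \<Longrightarrow> \<kappa> (\<sigma> i) \<le> \<kappa> (\<sigma> j)"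
      using sorted_enumeration[OF fin] by blast
    have "\<exists>x. x \<in> {0..pi} \<and> f x = l n (\<sigma> i) \<and> \<bar>x - real i * pi / N n\<bar> \<le> \<epsilon>" if i: "i < card (K n)" for i
    proof -
      define p where "p = \<kappa> (\<sigma> i)"
      have "\<sigma> i \<in> K n" using \<sigma>(1) i by (auto simp: bij_betw_def)
      then have "p \<in> ty (l n (\<sigma> i))" unfolding p_def by (rule \<kappa>)
      then have p: "p < P" and "l n (\<sigma> i) \<in> f ` {u p..u (Suc p)}" unfolding ty_def F_def by auto
      then obtain x where x: "u p \<le> x" "x \<le> u (Suc p)" "f x = l n (\<sigma> i)" by auto
      have pos: "card {k\<in>K n. \<kappa> k < p} \<le> i" "i < card {k\<in>K n. \<kappa> k \<le> p}"
        unfolding p_def using sorted_enumeration_position[where \<kappa> = \<kappa>, OF fin \<sigma>(1) _ i] \<sigma>(2) by blast+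
      \<comment> \<open>The rank \<open>i\<close> lies between the cumulative counts below and
        through cell \<open>p\<close>. Rescaled by \<open>pi / N n\<close>, the grid position lies
        in cell \<open>p\<close> widened by one cell width on each side.\<close>
      have c1: "real p * (N n / real P) - N n / real P \<le> real i"
        using cum[of p] p pos(1) by linarith
      have "{k\<in>K n. \<kappa> k \<le> p} = {k\<in>K n. \<kappa> k < Suc p}" by auto
      then have "i < card {k\<in>K n. \<kappa> k < Suc p}" using pos(2) by simp
      then have c2: "real i \<le> real (Suc p) * (N n / real P) + N n / real P"
        using cum[of "Suc p"] p by linarith
      have e: "(real s * (N n / real P)) * pi / N n = u s" "N n / real P * pi / N n = pi / real P" for s
        using Npos unfolding u_def by auto
      have "(real p * (N n / real P) - N n / real P) * pi / N n \<le> real i * pi / N n"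
        using c1 Npos by (intro divide_right_mono mult_right_mono) auto
      then have l1: "u p - pi / real P \<le> real i * pi / N n"
        by (simp only: left_diff_distrib diff_divide_distrib e)
      have "real i * pi / N n \<le> (real (Suc p) * (N n / real P) + N n / real P) * pi / N n"
        using c2 Npos by (intro divide_right_mono mult_right_mono) auto
      then have l2: "real i * pi / N n \<le> u (Suc p) + pi / real P"
        by (simp only: distrib_right add_divide_distrib e)
      have "\<bar>x - real i * pi / N n\<bar> \<le> 2 * (pi / real P)"
        using l1 l2 x u(2)[of p] by (simp add: abs_le_iff)
      then have "\<bar>x - real i * pi / N n\<bar> \<le> \<epsilon>" using Peps by linarith
      moreover have "x \<in> {0..pi}" using x u0[of p] upi[of "Suc p"] p by auto
      ultimately show ?thesis using x(3) by blast
    qed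
    then obtain x where "\<And>i. i < card (K n) \<Longrightarrow> x i \<in> {0..pi} \<and> f (x i) = l n (\<sigma> i) \<and> \<bar>x i - real i * pi / N n\<bar> \<le> \<epsilon>"
      by metis
    then show ?case using \<sigma>(1) unfolding N_def by blast
  qed
qed

section \<open>Simultaneous diagonalization and interlacing\<close>

text \<open>Similarity preserves the characteristic polynomial, so a diagonalization accounts for
  algebraic multiplicities.\<close>

lemma unitary_diag_eigenvalue_ordering:
  assumes V: "unitary_mat n V" and A: "A = V * diag_mat1 n d * mat_adjoint V"
  shows "eigenvalue_ordering n A d"
proof -
  have Vc: "V \<in> carrier_mat n n" and adj: "mat_adjoint V \<in> carrier_mat n n"
    using V unfolding unitary_mat_def mat_adjoint_def by auto
  have D: "diag_mat1 n d \<in> carrier_mat n n" unfolding diag_mat1_def by simp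
  have Ac: "A \<in> carrier_mat n n" unfolding A using Vc adj D by simp
  have "similar_mat A (diag_mat1 n d)"
    using V A Vc adj D Ac unfolding unitary_mat_def by (intro similar_matI[of _ _ V "mat_adjoint V" n]) auto
  then have "char_poly A = char_poly (diag_mat1 n d)" by (rule char_poly_similar)
  also have "\<dots> = (\<Prod>a\<leftarrow>diag_mat (diag_mat1 n d). [:- a, 1:])"
    by (rule char_poly_upper_triangular[OF D]) (auto simp: diag_mat1_def mat_diag_def)
  also have "diag_mat (diag_mat1 n d) = map (\<lambda>i. d (Suc i)) [0..<n]"
    unfolding diag_mat_def diag_mat1_def mat_diag_def by (auto intro!: nth_equalityI)
  also have "(\<Prod>a\<leftarrow>map (\<lambda>i. d (Suc i)) [0..<n]. [:- a, 1:]) = (\<Prod>i<n. [:- d (Suc i), 1:])"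
    by (induction n) (simp_all add: mult.commute)
  also have "\<dots> = (\<Prod>i = 1..n. [:- d i, 1:])" by (simp add: prod.atLeast1_atMost_eq)
  finally show ?thesis using Ac unfolding eigenvalue_ordering_def by simp
qed

text \<open>The flip acts on column \<open>k\<close> as the scalar \<open>(-1) ^ k\<close>, so one
  basis diagonalizes \<open>Y\<close> and \<open>T\<close> simultaneously and hence their
  product.\<close>

lemma flipped_toeplitz_decomposition:
  fixes V :: "nat \<Rightarrow> nat \<Rightarrow> real" and l :: "nat \<Rightarrow> real" and c :: "int \<Rightarrow> real"
  assumes c: "\<And>k. fourier_coeff F k = complex_of_real (c k)"
    and cols: "\<And>j k. j < n \<Longrightarrow> k < n \<Longrightarrow> (\<Sum>i<n. V i j * V i k) = (if j = k then 1 else 0)"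
    and rows: "\<And>i j. i < n \<Longrightarrow> j < n \<Longrightarrow> (\<Sum>k<n. V i k * V j k) = (if i = j then 1 else 0)"
    and eig: "\<And>i k. i < n \<Longrightarrow> k < n \<Longrightarrow> (\<Sum>j<n. c (int i - int j) * V j k) = l k * V i k"
    and flip: "\<And>i k. i < n \<Longrightarrow> k < n \<Longrightarrow> V (n - 1 - i) k = (-1) ^ k * V i k"
  shows "\<exists>V lamT lamH.
       (let T = toeplitz_mat n F;
            H = flipped_toeplitz_mat n F;
            \<Delta> = diag_mat1 n (\<lambda>i. (-1) ^ (i + 1));
            D = diag_mat1 n lamT;
            E = diag_mat1 n lamH
        in real_mat V \<and> unitary_mat n V \<and>
           eigenvalue_ordering n T lamT \<and>
           eigenvalue_ordering n H lamH \<and>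
           exchange_mat n = V * \<Delta> * mat_adjoint V \<and>
           T = V * D * mat_adjoint V \<and>
           H = V * E * mat_adjoint V \<and>
           E = \<Delta> * D \<and>
           (\<forall>i\<in>{1..n}. lamH i = (-1) ^ (i + 1) * lamT i) \<and>
           (\<forall>i\<in>{1..n}. lamT i = complex_of_real (l (i - 1))))"
proof -
  define W where "W = Matrix.mat n n (\<lambda>(i, k). complex_of_real (V i k))"
  define W' where "W' = Matrix.mat n n (\<lambda>(i, k). complex_of_real (V k i))"
  define T where "T = toeplitz_mat n F"
  define Y where "Y = exchange_mat n"
  \<comment> \<open>Eigenvalues are numbered from 1 and columns from 0; with
    \<open>k = i - 1\<close>, the sign \<open>(-1) ^ k\<close> equals
    \<open>(-1) ^ (i + 1)\<close>.\<close>
  define lamT where "lamT i = complex_of_real (l (i - 1))" for i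
  define lamH where "lamH i = (-1) ^ (i + 1) * lamT i" for i
  define Del where "Del = diag_mat1 n (\<lambda>i. (-1) ^ (i + 1))"
  define D where "D = diag_mat1 n lamT"
  define E where "E = diag_mat1 n lamH"
  have carr: "W \<in> carrier_mat n n" "W' \<in> carrier_mat n n" "T \<in> carrier_mat n n" "Y \<in> carrier_mat n n"
    "Del \<in> carrier_mat n n" "D \<in> carrier_mat n n" "E \<in> carrier_mat n n"
    unfolding W_def W'_def T_def Y_def Del_def D_def E_def toeplitz_mat_def exchange_mat_def diag_mat1_def by auto
  have adj: "mat_adjoint W = W'"
    unfolding mat_adjoint_def W_def W'_def
    by (rule eq_matI) (auto simp: mat_of_rows_def)
  have WW': "W * W' = 1\<^sub>m n"
    by (rule eq_matI)
      (auto simp: W_def W'_def scalar_prod_def rows simp flip: of_real_mult of_real_sum lessThan_atLeast0)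
  have W'W: "W' * W = 1\<^sub>m n"
    by (rule eq_matI)
      (auto simp: W_def W'_def scalar_prod_def cols simp flip: of_real_mult of_real_sum lessThan_atLeast0)
  have TW: "T * W = W * D"
  proof (rule eq_matI)
    fix i k assume "i < dim_row (W * D)" "k < dim_col (W * D)"
    then have ik: "i < n" "k < n" using carr by auto
    have "(T * W) $$ (i, k) = (\<Sum>j<n. complex_of_real (c (int i - int j)) * complex_of_real (V j k))"
      using ik carr by (simp add: T_def W_def toeplitz_mat_def scalar_prod_def c lessThan_atLeast0)
    also have "\<dots> = complex_of_real (l k * V i k)"
      by (simp only: eig[OF ik] flip: of_real_mult of_real_sum)
    also have "\<dots> = (W * D) $$ (i, k)"
      unfolding D_def diag_mat1_def mat_diag_mult_right[OF carr(1)] using ik by (simp add: W_def lamT_def)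
    finally show "(T * W) $$ (i, k) = (W * D) $$ (i, k)" .
  qed (use carr in auto)
  have YW: "Y * W = W * Del"
  proof (rule eq_matI)
    fix i k assume "i < dim_row (W * Del)" "k < dim_col (W * Del)"
    then have ik: "i < n" "k < n" using carr by auto
    have "(Y * W) $$ (i, k) = (\<Sum>j<n. (if i + j + 1 = n then 1 else 0) * complex_of_real (V j k))"
      using ik carr by (simp add: Y_def W_def exchange_mat_def scalar_prod_def lessThan_atLeast0)
    also have "\<dots> = (\<Sum>j<n. if j = n - 1 - i then complex_of_real (V j k) else 0)"
      using ik by (intro sum.cong refl) auto
    also have "\<dots> = complex_of_real (V (n - 1 - i) k)" using ik by auto
    also have "\<dots> = (W * Del) $$ (i, k)"
      unfolding Del_def diag_mat1_def mat_diag_mult_right[OF carr(1)] flip[OF ik] using ik by (simp add: W_def)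
    finally show "(Y * W) $$ (i, k) = (W * Del) $$ (i, k)" .
  qed (use carr in auto)
  have decomp: "A = W * B * W'" if "A \<in> carrier_mat n n" "A * W = W * B" for A B
  proof -
    have "A = A * (W * W')" unfolding WW' using that(1) by simp
    also have "\<dots> = A * W * W'" using that(1) carr by (simp add: assoc_mult_mat[of _ n n _ n _ n])
    finally show ?thesis unfolding that(2) .
  qed
  have ED: "E = Del * D"
    unfolding E_def Del_def D_def diag_mat1_def lamH_def by (simp add: mat_diag_diag)
  have HW: "(Y * T) * W = W * E"
  proof -
    have "(Y * T) * W = Y * (T * W)" using carr by (simp add: assoc_mult_mat[of _ n n _ n _ n])
    also have "\<dots> = (Y * W) * D" unfolding TW using carr by (simp add: assoc_mult_mat[of _ n n _ n _ n])
    also have "\<dots> = W * E" unfolding YW ED using carr by (simp add: assoc_mult_mat[of _ n n _ n _ n])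
    finally show ?thesis .
  qed
  have uni: "unitary_mat n W" unfolding unitary_mat_def adj using carr WW' W'W by simp
  have T: "T = W * D * mat_adjoint W" and Y: "Y = W * Del * mat_adjoint W"
    and H: "Y * T = W * E * mat_adjoint W"
    unfolding adj using decomp[OF carr(3) TW] decomp[OF carr(4) YW]
      decomp[OF mult_carrier_mat[OF carr(4,3)] HW] by simp_all
  have "real_mat W" unfolding real_mat_def elements_mat_def W_def by auto
  then show ?thesis
    unfolding Let_def flipped_toeplitz_mat_def T_def[symmetric] Y_def[symmetric] Del_def[symmetric]
    using uni T Y H ED unitary_diag_eigenvalue_ordering[OF uni T[unfolded D_def]]
      unitary_diag_eigenvalue_ordering[OF uni H[unfolded E_def]]
    by (intro exI[of _ W] exI[of _ lamT] exI[of _ lamH])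
      (simp add: D_def E_def lamH_def lamT_def)
qed

text \<open>Choosing each \<open>x n\<close> within \<open>1 / (n + 1)\<close> of the infimum yields
  one sequence that serves every \<open>\<epsilon>\<close>, and \<open>Q\<close> holds even for
  those \<open>n\<close> where no closeness is available.\<close>

lemma near_optimal_selection:
  fixes dev :: "nat \<Rightarrow> 'a \<Rightarrow> real"
  assumes ex: "\<And>n. \<exists>x. Q n x" and pos: "\<And>n x. 0 \<le> dev n x"
    and ev: "\<And>\<epsilon>. \<epsilon> > 0 \<Longrightarrow> eventually (\<lambda>n. \<exists>x. Q n x \<and> dev n x \<le> \<epsilon>) sequentially"
  obtains x where "\<And>n. Q n (x n)" "(\<lambda>n. dev n (x n)) \<longlonglongrightarrow> 0"
proof -
  define S where "S n = dev n ` {x. Q n x}" for n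
  have S: "S n \<noteq> {}" "bdd_below (S n)" for n
    using ex[of n] pos unfolding S_def by (auto intro: bdd_belowI[of _ 0])
  have "\<exists>x. Q n x \<and> dev n x < Inf (S n) + inverse (real (Suc n))" for n
  proof -
    have "Inf (S n) < Inf (S n) + inverse (real (Suc n))" by simp
    then obtain y where "y \<in> S n" "y < Inf (S n) + inverse (real (Suc n))" using cInf_lessD[OF S(1)] by blast
    then show ?thesis unfolding S_def by blast
  qed
  then obtain x where x: "\<And>n. Q n (x n)" "\<And>n. dev n (x n) < Inf (S n) + inverse (real (Suc n))" by metis
  have "(\<lambda>n. dev n (x n)) \<longlonglongrightarrow> 0"
  proof (rule order_tendstoI)
    fix a :: real assume a: "0 < a"
    have "eventually (\<lambda>n. inverse (real (Suc n)) < a / 2) sequentially"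
      by (rule order_tendstoD(2)[OF LIMSEQ_inverse_real_of_nat]) (use a in simp)
    moreover have "eventually (\<lambda>n. \<exists>x. Q n x \<and> dev n x \<le> a / 2) sequentially"
      by (rule ev) (use a in simp)
    ultimately show "eventually (\<lambda>n. dev n (x n) < a) sequentially"
    proof eventually_elim
      case (elim n)
      then obtain y where "Q n y" "dev n y \<le> a / 2" by blast
      then have "Inf (S n) \<le> a / 2" using S(2)[of n] by (intro cInf_lower2[of "dev n y"]) (auto simp: S_def)
      then show ?case using x(2)[of n] elim(1) by linarith
    qed
  next
    fix a :: real assume "a < 0"
    then show "eventually (\<lambda>n. a < dev n (x n)) sequentially"
      by (intro always_eventually allI) (rule less_le_trans[OF _ pos])
  qed
  then show thesis using that x(1) by blast
qed

text \<open>Position \<open>k = 2 * r + e\<close> takes the \<open>r\<close>-th entry of the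
  enumeration of class \<open>e\<close>. Both class grids are nearly uniform on all of
  \<open>[0, pi]\<close>, so their alternation is nearly uniform as well.\<close>

lemma interlaced_matching:
  fixes f :: "real \<Rightarrow> real" and l :: "nat \<Rightarrow> nat \<Rightarrow> real"
  assumes match: "\<And>e \<epsilon>. e \<le> 1 \<Longrightarrow> \<epsilon> > 0 \<Longrightarrow> eventually (\<lambda>n. \<exists>\<sigma> x. bij_betw \<sigma> {..<card (parity_class n e)} (parity_class n e) \<and>
      (\<forall>i<card (parity_class n e). x i \<in> {0..pi} \<and> f (x i) = l n (\<sigma> i) \<and>
        \<bar>x i - real i * pi / card (parity_class n e)\<bar> \<le> \<epsilon>)) sequentially"
    and eps: "\<epsilon> > 0"
  shows "eventually (\<lambda>n. \<exists>\<rho> x. bij_betw \<rho> {..<n} {..<n} \<and> (\<forall>k<n. \<rho> k mod 2 = k mod 2) \<and>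
    (\<forall>k<n. x k \<in> {0..pi} \<and> f (x k) = l n (\<rho> k) \<and> \<bar>x k - real (k + 1) * (pi / (real n + 1))\<bar> \<le> \<epsilon>)) sequentially"
proof -
  \<comment> \<open>For \<open>n \<ge> 2 * M\<close> each class has at least \<open>M\<close>
    elements, so the error \<open>pi / N e\<close> of \<open>parity_grid_close\<close> takes at most
    the half of \<open>\<epsilon>\<close> left by the class matching.\<close>
  obtain M :: nat where M: "2 * pi / \<epsilon> < real M" using reals_Archimedean2 by blast
  have M0: "0 < real M" by (rule less_trans[OF _ M]) (use eps in simp)
  have "eventually (\<lambda>n. n \<ge> 2 * M) sequentially" by (rule eventually_ge_at_top)
  moreover have "eventually (\<lambda>n. \<exists>\<sigma> x. bij_betw \<sigma> {..<card (parity_class n 0)} (parity_class n 0) \<and>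
      (\<forall>i<card (parity_class n 0). x i \<in> {0..pi} \<and> f (x i) = l n (\<sigma> i) \<and>
        \<bar>x i - real i * pi / card (parity_class n 0)\<bar> \<le> \<epsilon> / 2)) sequentially"
    by (rule match) (use eps in auto)
  moreover have "eventually (\<lambda>n. \<exists>\<sigma> x. bij_betw \<sigma> {..<card (parity_class n 1)} (parity_class n 1) \<and>
      (\<forall>i<card (parity_class n 1). x i \<in> {0..pi} \<and> f (x i) = l n (\<sigma> i) \<and>
        \<bar>x i - real i * pi / card (parity_class n 1)\<bar> \<le> \<epsilon> / 2)) sequentially"
    by (rule match) (use eps in auto)
  ultimately show ?thesis
  proof eventually_elim
    case (elim n)
    define N where "N e = (n + 1 - e) div 2" for e
    have cN: "card (parity_class n e) = N e" if "e \<le> 1" for e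
      using card_parity_class[OF that] unfolding N_def .
    obtain \<sigma>0 x0 where s0: "bij_betw \<sigma>0 {..<N 0} (parity_class n 0)"
      "\<And>i. i < N 0 \<Longrightarrow> x0 i \<in> {0..pi} \<and> f (x0 i) = l n (\<sigma>0 i) \<and> \<bar>x0 i - real i * pi / N 0\<bar> \<le> \<epsilon> / 2"
      using elim(2) unfolding cN[OF zero_le_one] by blast
    obtain \<sigma>1 x1 where s1: "bij_betw \<sigma>1 {..<N 1} (parity_class n 1)"
      "\<And>i. i < N 1 \<Longrightarrow> x1 i \<in> {0..pi} \<and> f (x1 i) = l n (\<sigma>1 i) \<and> \<bar>x1 i - real i * pi / N 1\<bar> \<le> \<epsilon> / 2"
      using elim(3) unfolding cN[OF order_refl] by blast
    define \<sigma> where "\<sigma> e = (if e = 0 then \<sigma>0 else \<sigma>1)" for e :: nat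
    define y where "y e = (if e = 0 then x0 else x1)" for e :: nat
    have s: "bij_betw (\<sigma> e) {..<N e} (parity_class n e)"
      "\<And>i. i < N e \<Longrightarrow> y e i \<in> {0..pi} \<and> f (y e i) = l n (\<sigma> e i) \<and> \<bar>y e i - real i * pi / N e\<bar> \<le> \<epsilon> / 2"
      if "e \<le> 1" for e
      using that s0 s1 unfolding \<sigma>_def y_def by (auto simp: le_Suc_eq)
    define \<rho> where "\<rho> k = \<sigma> (k mod 2) (k div 2)" for k
    define x where "x k = y (k mod 2) (k div 2)" for k
    have rho: "bij_betw \<rho> (parity_class n e) (parity_class n e)" if e: "e \<le> 1" for e
    proof -
      have "bij_betw (\<sigma> e \<circ> (\<lambda>k. k div 2)) (parity_class n e) (parity_class n e)"
        using parity_class_div[OF e, of n, folded N_def] s(1)[OF e] by (rule bij_betw_trans)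
      then show ?thesis by (rule iffD1[OF bij_betw_cong, rotated]) (auto simp: \<rho>_def)
    qed
    have un: "parity_class n 0 \<union> parity_class n 1 = {..<n}" by auto
    have "bij_betw \<rho> (parity_class n 0 \<union> parity_class n 1) (parity_class n 0 \<union> parity_class n 1)"
      by (rule bij_betw_combine) (use rho in auto)
    then have 1: "bij_betw \<rho> {..<n} {..<n}" unfolding un .
    have 2: "\<rho> k mod 2 = k mod 2" if k: "k < n" for k
    proof -
      have "k mod 2 \<le> 1" by simp
      then have "\<rho> k \<in> parity_class n (k mod 2)"
        using bij_betw_apply[OF rho, of "k mod 2" k] k by blast
      then show ?thesis by simp
    qed
    have 3: "x k \<in> {0..pi} \<and> f (x k) = l n (\<rho> k) \<and> \<bar>x k - real (k + 1) * (pi / (real n + 1))\<bar> \<le> \<epsilon>" if k: "k < n" for k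
    proof -
      define e where "e = k mod 2"
      define r where "r = k div 2"
      have e: "e \<le> 1" unfolding e_def by simp
      have kr: "k = 2 * r + e" unfolding e_def r_def by simp
      have r: "r < N e" using parity_class_div[OF e, of n, folded N_def] k
        by (auto simp: bij_betw_def r_def e_def)
      have "real M \<le> real (N e)" using elim(1) e unfolding N_def by auto
      then have "2 * pi / \<epsilon> < real (N e)" using M by linarith
      then have Ne: "pi / real (N e) \<le> \<epsilon> / 2" using eps M0 \<open>real M \<le> real (N e)\<close> by (simp add: field_simps)
      have close: "\<bar>real (k + 1) * (pi / (real n + 1)) - real r * pi / real (N e)\<bar> \<le> pi / real (N e)"
        using parity_grid_close[OF e, of r n] r unfolding N_def kr by simp
      have y: "y e r \<in> {0..pi}" "f (y e r) = l n (\<sigma> e r)" "\<bar>y e r - real r * pi / real (N e)\<bar> \<le> \<epsilon> / 2"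
        using s(2)[OF e r] by blast+
      have "\<bar>y e r - real (k + 1) * (pi / (real n + 1))\<bar> \<le> \<epsilon>"
      proof -
        have "\<bar>y - t\<bar> \<le> \<epsilon>" if "\<bar>t - v\<bar> \<le> w" "\<bar>y - v\<bar> \<le> \<epsilon> / 2" "w \<le> \<epsilon> / 2" for y t v w :: real
          using that by linarith
        from this[OF close y(3) Ne] show ?thesis .
      qed
      then show ?thesis using y unfolding x_def \<rho>_def e_def[symmetric] r_def[symmetric] by blast
    qed
    show ?case using 1 2 3 by blast
  qed
qed

theorem theorem3p3:
  fixes f :: "real \<Rightarrow> real"
  assumes even: "\<forall>x\<in>{-pi..pi}. f (- x) = f x"
    and bounded: "bounded (f ` {-pi..pi})"
    and fin_max: "finite {x. local_max_point (-pi) pi f x}"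
    and fin_min: "finite {x. local_min_point (-pi) pi f x}"
    and fin_disc: "finite {x. discontinuity_point (-pi) pi f x}"
    and ess_range: "essential_range {-pi..pi} (\<lambda>x. complex_of_real (f x)) =
           complex_of_real ` {(INF x\<in>{0..pi}. f x)..(SUP x\<in>{0..pi}. f x)}"
    and range: "{(INF x\<in>{0..pi}. f x)<..<(SUP x\<in>{0..pi}. f x)} \<subseteq> f ` {0..pi}"
  shows "\<exists>x :: nat \<Rightarrow> nat \<Rightarrow> real.
    asymptotically_uniform 0 pi (\<lambda>n. n) x \<and>
    (\<forall>n\<ge>1. \<exists>V lamT lamH.
       (let T = toeplitz_mat n (\<lambda>x. complex_of_real (f x));
            H = flipped_toeplitz_mat n (\<lambda>x. complex_of_real (f x));
            \<Delta> = diag_mat1 n (\<lambda>i. (-1) ^ (i + 1));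
            D = diag_mat1 n lamT;
            E = diag_mat1 n lamH
        in real_mat V \<and> unitary_mat n V \<and>
           eigenvalue_ordering n T lamT \<and>
           eigenvalue_ordering n H lamH \<and>
           exchange_mat n = V * \<Delta> * mat_adjoint V \<and>
           T = V * D * mat_adjoint V \<and>
           H = V * E * mat_adjoint V \<and>
           E = \<Delta> * D \<and>
           (\<forall>i\<in>{1..n}. lamH i = (-1) ^ (i + 1) * lamT i) \<and>
           (\<forall>i\<in>{1..n}. lamT i = complex_of_real (f (x n i)))))"
proof -
  have fm: "f \<in> borel_measurable (lebesgue_on {-pi..pi})"
    using fin_disc by (rule borel_measurable_finite_discontinuities)
  then have fm0: "f \<in> borel_measurable leb0pi" by (rule measurable_restrict_mono) auto
  obtain K where "\<forall>x\<in>{-pi..pi}. \<bar>f x\<bar> \<le> K" using bounded unfolding bounded_iff by auto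
  then have K: "\<bar>f x\<bar> \<le> K" if "x \<in> {0..pi}" for x using that by auto
  have lev: "finite {x\<in>{0..pi}. f x = y}" for y
    by (rule finite_subset[OF _ finite_level_set[OF fin_max fin_min fin_disc, of y]]) auto
  have img: "finite (frontier (f ` {u..v}))" if "0 \<le> u" "v \<le> pi" for u v
    by (rule finite_frontier_image[OF fin_disc bounded]) (use that pi_ge_zero in linarith)+
  define mi where "mi = (INF x\<in>{0..pi}. f x)"
  define ma where "ma = (SUP x\<in>{0..pi}. f x)"
  have "bounded (f ` {0..pi})" using bounded by (rule bounded_subset) auto
  then have bdd: "bdd_below (f ` {0..pi})" "bdd_above (f ` {0..pi})"
    by (auto intro: bounded_imp_bdd_below bounded_imp_bdd_above)
  have mi: "mi \<le> f x" and ma: "f x \<le> ma" if "x \<in> {0..pi}" for x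
    unfolding mi_def ma_def using that bdd by (auto intro: cINF_lower cSUP_upper)
  \<comment> \<open>All properties are bundled in one predicate so that \<open>V\<close>,
    \<open>U\<close> and \<open>l\<close> can be chosen consistently for all \<open>n\<close> at
    once.\<close>
  define basis where "basis n V U l \<longleftrightarrow>
    (\<forall>j k. j < n \<longrightarrow> k < n \<longrightarrow> (\<Sum>i<n. V i j * V i k) = (if j = k then 1 else 0)) \<and>
    (\<forall>i j. i < n \<longrightarrow> j < n \<longrightarrow> (\<Sum>k<n. V i k * V j k) = (if i = j then 1 else 0)) \<and>
    (\<forall>i k. i < n \<longrightarrow> k < n \<longrightarrow> (\<Sum>j<n. cos_coeff f (int i - int j) * V j k) = l k * V i k) \<and>
    (\<forall>i k. i < n \<longrightarrow> k < n \<longrightarrow> V (n - 1 - i) k = (-1) ^ k * V i k) \<and>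
    (\<forall>j. j < n \<longrightarrow> (\<Sum>k<n. (U j k)\<^sup>2) = 1) \<and>
    (\<forall>k. k < n \<longrightarrow> (\<Sum>j<n. (U j k)\<^sup>2) = 1) \<and>
    (\<forall>j k. odd (j + k) \<longrightarrow> U j k = 0) \<and>
    (\<forall>q. (\<Sum>j<n. \<Sum>k<n. (U j k)\<^sup>2 * (l k - q j)\<^sup>2) =
      (\<Sum>j<n. \<Sum>i<n. ((\<Sum>b<n. cos_coeff f (int i - int b) * dst n b j) - q j * dst n i j)\<^sup>2))"
    for n and V U :: "nat \<Rightarrow> nat \<Rightarrow> real" and l :: "nat \<Rightarrow> real"
  have "\<exists>V U l. basis n V U l" for n
    by (rule toeplitz_parity_eigenbasis[of "cos_coeff f" n, OF cos_coeff_minus])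
      (unfold basis_def, intro exI conjI allI impI, assumption+)
  then obtain V U l where basis: "\<And>n. basis n (V n) (U n) (l n)" by metis
  note basis = basis[unfolded basis_def]
  note V1 = basis[THEN conjunct1, rule_format]
    and V2 = basis[THEN conjunct2, THEN conjunct1, rule_format]
    and V3 = basis[THEN conjunct2, THEN conjunct2, THEN conjunct1, rule_format]
    and V4 = basis[THEN conjunct2, THEN conjunct2, THEN conjunct2, THEN conjunct1, rule_format]
  note basis' = basis[THEN conjunct2, THEN conjunct2, THEN conjunct2, THEN conjunct2]
  note U1 = basis'[THEN conjunct1, rule_format]
    and U2 = basis'[THEN conjunct2, THEN conjunct1, rule_format]
    and U3 = basis'[THEN conjunct2, THEN conjunct2, THEN conjunct1, rule_format]
    and U4 = basis'[THEN conjunct2, THEN conjunct2, THEN conjunct2, rule_format]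
  have vals: "l n k \<in> f ` {0..pi}" if k: "k < n" for n k
  proof -
    have v: "(\<Sum>i<n. (V n i k)\<^sup>2) = 1" using V1[OF k k] by (simp add: power2_eq_square)
    \<comment> \<open>Both inequalities must be strict, because the infimum and the supremum need
      not be attained by \<open>f\<close>.\<close>
    have "mi < l n k"
      by (rule toeplitz_eigenvalue_gt[where g = f and v = "\<lambda>i. V n i k", OF fm0 K mi lev v V3[OF _ k]])
    moreover have "l n k < ma"
      by (rule toeplitz_eigenvalue_less[where g = f and v = "\<lambda>i. V n i k", OF fm0 K ma lev v V3[OF _ k]])
    ultimately show ?thesis using range unfolding mi_def ma_def by auto
  qed
  have match: "eventually (\<lambda>n. \<exists>\<sigma> x. bij_betw \<sigma> {..<card (parity_class n e)} (parity_class n e) \<and>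
      (\<forall>i<card (parity_class n e). x i \<in> {0..pi} \<and> f (x i) = l n (\<sigma> i) \<and>
        \<bar>x i - real i * pi / card (parity_class n e)\<bar> \<le> \<epsilon>)) sequentially"
    if e: "e \<le> 1" and eps: "\<epsilon> > 0" for e \<epsilon>
  proof (rule counts_imp_matching[OF _ _ fm0 img _ _ eps])
    show "filterlim (\<lambda>n. card (parity_class n e)) at_top sequentially"
      unfolding filterlim_at_top card_parity_class[OF e]
    proof
      fix M
      show "eventually (\<lambda>n. M \<le> (n + 1 - e) div 2) sequentially"
        using eventually_ge_at_top[of "2 * M"] by eventually_elim (use e in auto)
    qed
    show "l n k \<in> f ` {0..pi}" if "k \<in> parity_class n e" for n k using vals that by auto
    show "(\<lambda>n. card {k\<in>parity_class n e. l n k \<in> C} / card (parity_class n e))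
        \<longlonglongrightarrow> measure leb0pi {x\<in>{0..pi}. f x \<in> C} / pi" if "finite (frontier C)" for C
    proof (rule averages_imp_counts[OF _ _ fm0 lev _ that])
      show "eventually (\<lambda>n. parity_class n e \<noteq> {}) sequentially"
        using eventually_ge_at_top[of 2]
      proof eventually_elim
        case (elim n)
        then have "e \<in> parity_class n e" using e by auto
        then show ?case by blast
      qed
      show "(\<lambda>n. (\<Sum>k\<in>parity_class n e. g (l n k)) / card (parity_class n e))
          \<longlonglongrightarrow> (LINT x|leb0pi. g (f x)) / pi" if g: "\<And>y z. \<bar>g y - g z\<bar> \<le> L * \<bar>y - z\<bar>" for g L
        by (rule eigenvalue_averages[OF fm0 K U1 U2 U3 U4 g e])
    qed auto
  qed auto
  \<comment> \<open>Admissible grids: they realize the eigenvalues exactly, in an order that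
    permutes only within the parity classes. The identity permutation shows that one exists for
    every \<open>n\<close>.\<close>
  define Q where "Q n x \<longleftrightarrow> (\<exists>\<rho>. bij_betw \<rho> {..<n} {..<n} \<and> (\<forall>k<n. \<rho> k mod 2 = k mod 2) \<and>
    (\<forall>i\<in>{1..n}. x i \<in> {0..pi} \<and> f (x i) = l n (\<rho> (i - 1))))" for n and x :: "nat \<Rightarrow> real"
  \<comment> \<open>At \<open>n = 0\<close> the maximum runs over the empty set; the value 0 keeps
    \<open>dev\<close> nonnegative there and does not affect the limit.\<close>
  define dev where "dev n x = (if n = 0 then 0 else MAX i\<in>{1..n}. \<bar>x i - (0 + real i * (pi - 0) / (real n + 1))\<bar>)"
    for n :: nat and x :: "nat \<Rightarrow> real"
  have "\<exists>x. Q n x" for n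
  proof -
    have "\<forall>i. \<exists>x. i \<in> {1..n} \<longrightarrow> x \<in> {0..pi} \<and> f x = l n (i - 1)"
    proof (intro allI)
      fix i
      show "\<exists>x. i \<in> {1..n} \<longrightarrow> x \<in> {0..pi} \<and> f x = l n (i - 1)"
      proof (cases "i \<in> {1..n}")
        case True
        then have "l n (i - 1) \<in> f ` {0..pi}" by (intro vals) auto
        then obtain y where "y \<in> {0..pi}" "l n (i - 1) = f y" by blast
        then show ?thesis by (intro exI[of _ y]) simp
      qed blast
    qed
    then obtain x where "\<And>i. i \<in> {1..n} \<Longrightarrow> x i \<in> {0..pi} \<and> f (x i) = l n (i - 1)" by metis
    then show ?thesis unfolding Q_def by (intro exI[of _ x] exI[of _ "\<lambda>k. k"]) (auto simp: bij_betw_def)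
  qed
  moreover have "0 \<le> dev n x" for n x
  proof (cases "n = 0")
    case False
    then have "\<bar>x 1 - (0 + real 1 * (pi - 0) / (real n + 1))\<bar>
        \<le> (MAX i\<in>{1..n}. \<bar>x i - (0 + real i * (pi - 0) / (real n + 1))\<bar>)"
      by (intro Max_ge finite_imageI imageI) auto
    then show ?thesis unfolding dev_def using False by (auto intro: order_trans[OF abs_ge_zero])
  qed (simp add: dev_def)
  moreover have "eventually (\<lambda>n. \<exists>x. Q n x \<and> dev n x \<le> \<epsilon>) sequentially" if eps: "\<epsilon> > 0" for \<epsilon>
  proof -
    have "eventually (\<lambda>n. \<exists>\<rho> x. bij_betw \<rho> {..<n} {..<n} \<and> (\<forall>k<n. \<rho> k mod 2 = k mod 2) \<and>
      (\<forall>k<n. x k \<in> {0..pi} \<and> f (x k) = l n (\<rho> k) \<and> \<bar>x k - real (k + 1) * (pi / (real n + 1))\<bar> \<le> \<epsilon>)) sequentially"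
      by (rule interlaced_matching[OF match eps])
    then show ?thesis
    proof eventually_elim
      case (elim n)
      then obtain \<rho> x where r: "bij_betw \<rho> {..<n} {..<n}" "\<forall>k<n. \<rho> k mod 2 = k mod 2"
        "\<And>k. k < n \<Longrightarrow> x k \<in> {0..pi} \<and> f (x k) = l n (\<rho> k) \<and> \<bar>x k - real (k + 1) * (pi / (real n + 1))\<bar> \<le> \<epsilon>"
        by blast
      have "Q n (\<lambda>i. x (i - 1))"
        unfolding Q_def using r by (intro exI[of _ \<rho>]) auto
      moreover have "\<bar>x (i - 1) - (0 + real i * (pi - 0) / (real n + 1))\<bar> \<le> \<epsilon>" if "i \<in> {1..n}" for i
      proof -
        have "real (i - 1 + 1) * (pi / (real n + 1)) = 0 + real i * (pi - 0) / (real n + 1)" using that by simp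
        then show ?thesis using r(3)[of "i - 1"] that by auto
      qed
      then have "dev n (\<lambda>i. x (i - 1)) \<le> \<epsilon>" unfolding dev_def using eps by auto
      ultimately show ?case by blast
    qed
  qed
  ultimately obtain x where Q: "\<And>n. Q n (x n)" and dev: "(\<lambda>n. dev n (x n)) \<longlonglongrightarrow> 0"
    using near_optimal_selection[of Q dev] by blast
  have "(\<lambda>n. MAX i\<in>{1..n}. \<bar>x n i - (0 + real i * (pi - 0) / (real n + 1))\<bar>) \<longlonglongrightarrow> 0"
    by (rule Lim_transform_eventually[OF dev])
      (use eventually_gt_at_top[of 0] in \<open>eventually_elim, simp add: dev_def\<close>)
  moreover have "\<forall>n. \<forall>i\<in>{1..n}. x n i \<in> {0..pi}" using Q unfolding Q_def by blast
  ultimately have au: "asymptotically_uniform 0 pi (\<lambda>n. n) x"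
    unfolding asymptotically_uniform_def by (auto intro: filterlim_ident)
  show ?thesis
  proof (intro exI[of _ x] conjI allI impI au)
    fix n :: nat assume "n \<ge> 1"
    obtain \<rho> where \<rho>: "bij_betw \<rho> {..<n} {..<n}" "\<And>k. k < n \<Longrightarrow> \<rho> k mod 2 = k mod 2"
      and x: "\<And>i. i \<in> {1..n} \<Longrightarrow> f (x n i) = l n (\<rho> (i - 1))"
      using Q[of n] unfolding Q_def by blast
    have \<rho>n: "\<rho> k < n" if "k < n" for k using \<rho>(1) that by (auto simp: bij_betw_def)
    have \<rho>inj: "\<rho> j = \<rho> k \<longleftrightarrow> j = k" if "j < n" "k < n" for j k
      using \<rho>(1) that by (auto simp: bij_betw_def inj_on_def)
    have xf: "complex_of_real (l n (\<rho> (i - 1))) = complex_of_real (f (x n i))" if "i \<in> {1..n}" for i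
      using x[OF that] by simp
    \<comment> \<open>Since \<open>\<rho>\<close> preserves parity, the reordered columns still
      alternate between symmetric and skew-symmetric, as \<open>\<Delta>\<close> demands.\<close>
    have flip: "V n (n - 1 - i) (\<rho> k) = (-1) ^ k * V n i (\<rho> k)" if "i < n" "k < n" for i k
    proof -
      have "(-1 :: real) ^ \<rho> k = (-1) ^ k"
        using \<rho>(2)[OF that(2)] by (simp add: minus_one_power_iff even_iff_mod_2_eq_zero)
      then show ?thesis using V4[OF that(1) \<rho>n[OF that(2)]] by simp
    qed
    have rows: "(\<Sum>k<n. V n i (\<rho> k) * V n j (\<rho> k)) = (if i = j then 1 else 0)" if "i < n" "j < n" for i j
      using sum.reindex_bij_betw[OF \<rho>(1), of "\<lambda>k. V n i k * V n j k"] V2[OF that] by simp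
    have cols: "(\<Sum>i<n. V n i (\<rho> j) * V n i (\<rho> k)) = (if j = k then 1 else 0)" if "j < n" "k < n" for j k
      using V1[OF \<rho>n \<rho>n] that \<rho>inj by simp
    note dec = flipped_toeplitz_decomposition[where V = "\<lambda>i k. V n i (\<rho> k)" and l = "\<lambda>k. l n (\<rho> k)",
        OF fourier_coeff_even[OF even fm bounded] cols rows V3[OF _ \<rho>n] flip]
    show "\<exists>V lamT lamH.
       (let T = toeplitz_mat n (\<lambda>x. complex_of_real (f x));
            H = flipped_toeplitz_mat n (\<lambda>x. complex_of_real (f x));
            \<Delta> = diag_mat1 n (\<lambda>i. (-1) ^ (i + 1));
            D = diag_mat1 n lamT;
            E = diag_mat1 n lamH
        in real_mat V \<and> unitary_mat n V \<and>
           eigenvalue_ordering n T lamT \<and>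
           eigenvalue_ordering n H lamH \<and>
           exchange_mat n = V * \<Delta> * mat_adjoint V \<and>
           T = V * D * mat_adjoint V \<and>
           H = V * E * mat_adjoint V \<and>
           E = \<Delta> * D \<and>
           (\<forall>i\<in>{1..n}. lamH i = (-1) ^ (i + 1) * lamT i) \<and>
           (\<forall>i\<in>{1..n}. lamT i = complex_of_real (f (x n i))))"
      using dec by (simp only: xf Let_def cong: ball_cong)
  qed
qed

end
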